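(* Let $\kappa_1,\kappa_2,\dots$ and $\kappa_{i,j}$ ($i,j\ge1$) be formal indeterminates, $X(y)=\frac{1}{y}+\sum_{i\ge1}\kappa_iy^{i-1}$ and $X(y_1,y_2)=\sum_{i,j\ge1}\kappa_{i,j}y_1^{i-1}y_2^{j-1}$. Let $W^{(0)}_{par,2}(x_1,x_2)=\sum_{i,j\ge1}m^{(0)}_{i,j}x_1^{-i-1}x_2^{-j-1}$ be the generating series of connected partitions of cylinder type defined in the context. Then, as formal series in $y_1,y_2$, \begin{align*} W^{(0)}_{par,2}(X(y_1),X(y_2))=&\frac{X(y_1,y_2)+\frac{1}{(y_1-y_2)^2}}{X'(y_1)X'(y_2)}-\frac{1}{(X(y_1)-X(y_2))^2}\\ &+\frac{\frac{1}{y_1y_2}\left(1-y_1\partial_{y_1}y_2\partial_{y_2}\right)\left(y_1y_2\frac{X(y_1)-X(y_2)}{y_1-y_2}+1\right)}{X'(y_1)X'(y_2)}. \end{align*}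
   Context: Fix $i,j\ge1$, let $A=\{1,\dots,i\}$ (first boundary) and $B=\{i+1,\dots,i+j\}$ (second boundary), and let $\tau\in\mathcal S_{i+j}$ be the permutation with the two cycles $(1,2,\dots,i)(i+1,\dots,i+j)$. Write $l(\sigma)$ for the number of cycles of a permutation. A permutation $\sigma\in\mathcal S_{i+j}$ is called annular non-crossing if at least one cycle of $\sigma$ meets both $A$ and $B$ and $l(\sigma)+l(\sigma^{-1}\tau)=i+j$ (i.e. it has genus $0$ for the genus formula $2g=n+2-b-l(\sigma)-l(\sigma^{-1}\tau)$ with $b=2$ boundaries). A set partition of $A\cup B$ is annular non-crossing if it is the set of (supports of) cycles of some annular non-crossing permutation. A partition of $A$ (resp. $B$) is non-crossing if it has genus $0$ (equivalently, is non-crossing with respect to the cyclic order of $A$, resp. $B$). Define \[ m^{(0)}_{i,j}=\sum_{\pi}\prod_{V\in\pi}\kappa_{|V|}\;+\;\sum_{(\pi_1,V_1,\pi_2,V_2)}\kappa_{|V_1|,|V_2|}\prod_{V\in\pi_1\setminus\{V_1\}}\kappa_{|V|}\prod_{V\in\pi_2\setminus\{V_2\}}\kappa_{|V|}, \] where the first sum is over annular non-crossing partitions $\pi$ of $A\cup B$, and the second is over non-crossing partitions $\pi_1$ of $A$ with a distinguished block $V_1\in\pi_1$ and non-crossing partitions $\pi_2$ of $B$ with a distinguished block $V_2\in\pi_2$ (the two distinguished blocks forming a single block of cylinder type, weighted $\kappa_{|V_1|,|V_2|}$). Since $1/X(y)$ is a power series in $y$ with leading term $y$, $W^{(0)}_{par,2}(X(y_1),X(y_2))$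 is a formal power series in $y_1,y_2$; $X'$ denotes the $y$-derivative. *)

theory Defs
  imports
    "HOL-Computational_Algebra.Computational_Algebra"
    "HOL-Combinatorics.Combinatorics"
begin

unbundle fps_syntax

section \<open>Non-crossing partitions of the disc and of the annulus\<close>

text \<open>Fixed points of a permutation are cycles of length one:
  \<open>orbit \<sigma> x = {x}\<close> if \<open>\<sigma> x = x\<close>.\<close>

definition cycle_supports :: "nat set \<Rightarrow> (nat \<Rightarrow> nat) \<Rightarrow> nat set set" where
  "cycle_supports S \<sigma> = orbit \<sigma> ` S"

definition num_cycles :: "nat set \<Rightarrow> (nat \<Rightarrow> nat) \<Rightarrow> nat" where
  "num_cycles S \<sigma> = card (cycle_supports S \<sigma>)"

text \<open>The genus formula \<open>2 g = n + 2 - b - l(\<sigma>) - l(\<sigma>\<inverse>\<tau>)\<close> with \<open>g = 0\<close>, where \<open>n = |S|\<close> and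
  \<open>b\<close> is the number of boundaries, that is, of cycles of \<open>\<tau>\<close> on \<open>S\<close>.\<close>

definition genus_zero :: "nat \<Rightarrow> nat set \<Rightarrow> (nat \<Rightarrow> nat) \<Rightarrow> (nat \<Rightarrow> nat) \<Rightarrow> bool" where
  "genus_zero b S \<tau> \<sigma> \<longleftrightarrow>
     num_cycles S \<sigma> + num_cycles S (inv \<sigma> \<circ> \<tau>) + b = card S + 2"

definition interval_cycle :: "nat \<Rightarrow> nat \<Rightarrow> nat \<Rightarrow> nat" where
  "interval_cycle a b = cycle_of_list [a..<Suc b]"

text \<open>Partitions of \<open>{a..b}\<close> of genus 0 with respect to the cyclic order \<open>(a, a+1, \<dots>, b)\<close>
  (one boundary).\<close>

definition noncrossing_partitions :: "nat \<Rightarrow> nat \<Rightarrow> nat set set set" where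
  "noncrossing_partitions a b =
     {cycle_supports {a..b} \<sigma> | \<sigma>. \<sigma> permutes {a..b} \<and> genus_zero 1 {a..b} (interval_cycle a b) \<sigma>}"

definition annular_tau :: "nat \<Rightarrow> nat \<Rightarrow> nat \<Rightarrow> nat" where
  "annular_tau i j = interval_cycle 1 i \<circ> interval_cycle (i + 1) (i + j)"

definition annular_noncrossing_perm :: "nat \<Rightarrow> nat \<Rightarrow> (nat \<Rightarrow> nat) \<Rightarrow> bool" where
  "annular_noncrossing_perm i j \<sigma> \<longleftrightarrow>
     \<sigma> permutes {1..i + j} \<and>
     (\<exists>C \<in> cycle_supports {1..i + j} \<sigma>. C \<inter> {1..i} \<noteq> {} \<and> C \<inter> {i + 1..i + j} \<noteq> {}) \<and>
     genus_zero 2 {1..i + j} (annular_tau i j) \<sigma>"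

definition annular_noncrossing_partitions :: "nat \<Rightarrow> nat \<Rightarrow> nat set set set" where
  "annular_noncrossing_partitions i j =
     {cycle_supports {1..i + j} \<sigma> | \<sigma>. annular_noncrossing_perm i j \<sigma>}"

section \<open>The cylinder moments and their generating series\<close>

definition cylinder_moment ::
  "(nat \<Rightarrow> 'a::comm_ring_1) \<Rightarrow> (nat \<Rightarrow> nat \<Rightarrow> 'a) \<Rightarrow> nat \<Rightarrow> nat \<Rightarrow> 'a" where
  "cylinder_moment \<kappa> \<kappa>' i j =
     (\<Sum>\<pi> \<in> annular_noncrossing_partitions i j. \<Prod>V\<in>\<pi>. \<kappa> (card V)) +
     (\<Sum>(\<pi>\<^sub>1, V\<^sub>1, \<pi>\<^sub>2, V\<^sub>2) \<in>
        {(\<pi>\<^sub>1, V\<^sub>1, \<pi>\<^sub>2, V\<^sub>2).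
           \<pi>\<^sub>1 \<in> noncrossing_partitions 1 i \<and> V\<^sub>1 \<in> \<pi>\<^sub>1 \<and>
           \<pi>\<^sub>2 \<in> noncrossing_partitions (i + 1) (i + j) \<and> V\<^sub>2 \<in> \<pi>\<^sub>2}.
        \<kappa>' (card V\<^sub>1) (card V\<^sub>2) *
        (\<Prod>V \<in> \<pi>\<^sub>1 - {V\<^sub>1}. \<kappa> (card V)) * (\<Prod>V \<in> \<pi>\<^sub>2 - {V\<^sub>2}. \<kappa> (card V)))"

text \<open>\<open>W\<close> is a power series in \<open>x\<^sub>1\<inverse>\<close> (inner variable) and \<open>x\<^sub>2\<inverse>\<close> (outer variable):
  the coefficient of \<open>x\<^sub>1\<^bsup>-i-1\<^esup> x\<^sub>2\<^bsup>-j-1\<^esup>\<close> is \<open>m i j\<close> for \<open>i, j \<ge> 1\<close>, and the others vanish.\<close>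

definition W_par2 :: "(nat \<Rightarrow> 'a::comm_ring_1) \<Rightarrow> (nat \<Rightarrow> nat \<Rightarrow> 'a) \<Rightarrow> 'a fps fps" where
  "W_par2 \<kappa> \<kappa>' =
     Abs_fps (\<lambda>q. Abs_fps (\<lambda>p.
       if p \<ge> 2 \<and> q \<ge> 2 then cylinder_moment \<kappa> \<kappa>' (p - 1) (q - 1) else 0))"

definition X_series :: "(nat \<Rightarrow> 'a::field) \<Rightarrow> 'a fls" where
  "X_series \<kappa> = 1 / fls_X + fps_to_fls (Abs_fps (\<lambda>n. \<kappa> (n + 1)))"

section \<open>Formal series in two variables\<close>

text \<open>The identity lives in the field \<open>K((y\<^sub>1))((y\<^sub>2))\<close> of iterated Laurent series, in which the
  fraction field of \<open>K[[y\<^sub>1, y\<^sub>2]]\<close> embeds. The inner variable is \<open>y\<^sub>1\<close>, the outer one \<open>y\<^sub>2\<close>.\<close>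

definition fls_map_coeffs :: "('a::zero \<Rightarrow> 'b::zero) \<Rightarrow> 'a fls \<Rightarrow> 'b fls" where
  "fls_map_coeffs h F = Abs_fls (\<lambda>n. h (F $$ n))"

lemma fls_map_coeffs_nth:
  assumes "h 0 = 0"
  shows "fls_map_coeffs h F $$ n = h (F $$ n)"
proof -
  have "\<forall>n < fls_subdegree F. h (F $$ n) = 0"
    using assms by simp
  then show ?thesis
    unfolding fls_map_coeffs_def by (intro nth_Abs_fls_ex_lower_bound) blast
qed

definition y1 :: "'a::field fls fls" where
  "y1 = fls_const fls_X"

definition y2 :: "'a::field fls fls" where
  "y2 = fls_X"

definition in_y1 :: "'a::field fls \<Rightarrow> 'a fls fls" where
  "in_y1 f = fls_const f"

definition in_y2 :: "'a::field fls \<Rightarrow> 'a fls fls" where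
  "in_y2 f = fls_map_coeffs fls_const f"

definition deriv_y1 :: "'a::field fls fls \<Rightarrow> 'a fls fls" where
  "deriv_y1 F = fls_map_coeffs fls_deriv F"

definition deriv_y2 :: "'a::field fls fls \<Rightarrow> 'a fls fls" where
  "deriv_y2 F = fls_deriv F"

definition X_series2 :: "(nat \<Rightarrow> nat \<Rightarrow> 'a::field) \<Rightarrow> 'a fls fls" where
  "X_series2 \<kappa>' =
     fps_to_fls (Abs_fps (\<lambda>q. fps_to_fls (Abs_fps (\<lambda>p. \<kappa>' (p + 1) (q + 1)))))"

text \<open>Substitution of \<open>x\<^sub>1 = f(y\<^sub>1)\<close> and \<open>x\<^sub>2 = g(y\<^sub>2)\<close> in a power series in \<open>x\<^sub>1\<inverse>\<close> and \<open>x\<^sub>2\<inverse>\<close>.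
  It is meaningful if \<open>1/f\<close> and \<open>1/g\<close> are power series without constant term.\<close>

definition eval_at_inverses :: "'a::field fps fps \<Rightarrow> 'a fls \<Rightarrow> 'a fls \<Rightarrow> 'a fls fls" where
  "eval_at_inverses F f g =
     fps_to_fls (fps_compose
       (Abs_fps (\<lambda>q. fps_to_fls (fps_compose (F $ q) (fls_regpart (1 / f)))))
       (Abs_fps (\<lambda>n. fls_const (fls_regpart (1 / g) $ n))))"

text \<open>For \<open>f = X(y)\<close> this is the case, and \<open>fls_regpart\<close> loses nothing.\<close>

lemma inverse_X_series:
  fixes \<kappa> :: "nat \<Rightarrow> 'a::field"
  shows "fps_to_fls (fls_regpart (1 / X_series \<kappa>)) = 1 / X_series \<kappa>"
    and "fls_regpart (1 / X_series \<kappa>) $ 0 = 0"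
    and "fls_regpart (1 / X_series \<kappa>) $ 1 = 1"
proof -
  have lead: "X_series \<kappa> $$ (-1) = 1"
    by (simp add: X_series_def fls_inverse_X)
  have low: "X_series \<kappa> $$ n = 0" if "n < -1" for n
    using that by (simp add: X_series_def fls_inverse_X)
  have nz: "X_series \<kappa> \<noteq> 0"
    using lead by auto
  have sd: "fls_subdegree (X_series \<kappa>) = -1"
    by (rule fls_subdegree_eqI) (use lead low in auto)
  have sdi: "fls_subdegree (1 / X_series \<kappa>) = 1"
    using sd by (simp add: divide_inverse fls_inverse_subdegree)
  show "fps_to_fls (fls_regpart (1 / X_series \<kappa>)) = 1 / X_series \<kappa>"
    using sdi by (intro fls_regpart_to_fls_trivial) simp
  show "fls_regpart (1 / X_series \<kappa>) $ 0 = 0"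
    using sdi by simp
  have "(X_series \<kappa> * (1 / X_series \<kappa>)) $$
      (fls_subdegree (X_series \<kappa>) + fls_subdegree (1 / X_series \<kappa>)) =
      X_series \<kappa> $$ (-1) * (1 / X_series \<kappa>) $$ 1"
    using fls_times_base[of "X_series \<kappa>" "1 / X_series \<kappa>"] sd sdi by simp
  then show "fls_regpart (1 / X_series \<kappa>) $ 1 = 1"
    using nz sd sdi lead by simp
qed

end

theory Submission
  imports Defs
begin

text \<open>Planarity is an equality case of the inequality \<open>l(\<sigma>) + l(\<sigma>\<inverse>\<tau>) + l(\<tau>) \<le> n + 2 c\<close>, where \<open>c\<close> is the
  number of orbits of the group generated by \<open>\<sigma>\<close> and \<open>\<tau>\<close>. Multiplying \<open>\<sigma>\<close> and \<open>\<tau>\<close> on the left by the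
  same transposition does not change \<open>\<sigma>\<inverse>\<tau>\<close>, so that such a multiplication cuts a planar surface into
  two components or merges two boundaries. With the transposition of a marked point \<open>a\<close> and \<open>\<sigma> a\<close> this
  gives a recursion for the weighted numbers of planar permutations of the annulus, with the
  weight of the marked cycle as a parameter; it is solved by
  \<open>1 / ((y\<^sub>1 - y\<^sub>2)\<^sup>2 X'(y\<^sub>1) X'(y\<^sub>2)) - 1 / (X(y\<^sub>1) - X(y\<^sub>2))\<^sup>2\<close>.

  A partition with at least two blocks meeting both boundaries comes from exactly one annular
  permutation. If \<open>V\<close> is the only such block, meeting the boundaries in \<open>r\<close> and \<open>s\<close> points, it comes
  from \<open>r s\<close> permutations, and it corresponds to two disc partitions with one marked block each.
  Hence the term \<open>(1 - y\<^sub>1 \<partial>\<^sub>1 y\<^sub>2 \<partial>\<^sub>2)\<close> applied to \<open>\<Sum> \<kappa>\<^bsub>r+s\<^esub> y\<^sub>1\<^sup>r y\<^sub>2\<^sup>s\<close>, which is treated like the term with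
  \<open>\<kappa>\<^bsub>r,s\<^esub>\<close>.\<close>

section \<open>Permutations, transpositions and the genus inequality\<close>

text \<open>The weight \<open>w\<close> must be a parameter because removing the marked point
  shortens its cycle by one: the recursion passes from the weights \<open>w k\<close> to
  \<open>w (Suc k)\<close> and does not close on \<kappa> alone. Only at the end is w = \<kappa>
  inserted, which turns the solution formula into a linear equation for the unknown series. The
  formula is proved with all denominators multiplied out, since z1 - z2 and y(z1) - y(z2) are not
  invertible among double power series; division takes place in the field of iterated Laurent
  series, after the substitution z = 1/X(y). A through block with r and s points arises r s times
  because two disc cycles can be spliced at any pair of their points. For the same reason a sum over
  marked blocks becomes a sum over marked points after division by the block size, which is possible
  in characteristic 0. No embedding is ever drawn: cutting and gluing change numbers of classes of
  one connectivity relation by one, and the genus inequality turns these counts into statements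
  about separation.\<close>

definition conn :: "('a \<times> 'a) set \<Rightarrow> ('a \<times> 'a) set" where
  "conn r = (r \<union> r\<inverse>)\<^sup>*"

definition num_classes :: "'a set \<Rightarrow> ('a \<times> 'a) set \<Rightarrow> nat" where
  "num_classes S r = card ((\<lambda>x. conn r `` {x}) ` S)"

definition graph_of :: "('a \<Rightarrow> 'a) \<Rightarrow> ('a \<times> 'a) set" where
  "graph_of f = {(x, f x) | x. True}"

lemma conn_refl [simp]: "(x, x) \<in> conn r"
  by (simp add: conn_def)

lemma conn_sym: "(x, y) \<in> conn r \<Longrightarrow> (y, x) \<in> conn r"
  unfolding conn_def by (metis (no_types) converse_Un converse_converse rtrancl_converseI sup_commute)

lemma conn_trans: "(x, y) \<in> conn r \<Longrightarrow> (y, z) \<in> conn r \<Longrightarrow> (x, z) \<in> conn r"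
  unfolding conn_def by simp

lemma conn_base: "(x, y) \<in> r \<Longrightarrow> (x, y) \<in> conn r"
  unfolding conn_def by blast

lemma equiv_conn: "equiv UNIV (conn r)"
  by (intro equivI refl_onI symI transI) (auto intro: conn_sym conn_trans)

lemma conn_least: "r \<subseteq> conn s \<Longrightarrow> conn r \<subseteq> conn s"
proof -
  assume "r \<subseteq> conn s"
  then have "r \<union> r\<inverse> \<subseteq> conn s"
    by (auto intro: conn_sym)
  then show ?thesis
    unfolding conn_def by (metis rtrancl_idemp rtrancl_mono)
qed

lemma conn_mono: "r \<subseteq> s \<Longrightarrow> conn r \<subseteq> conn s"
  by (intro conn_least) (auto intro: conn_base)

lemma conn_mono': "(x, y) \<in> conn r \<Longrightarrow> r \<subseteq> s \<Longrightarrow> (x, y) \<in> conn s"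
  using conn_mono by blast

lemma conn_closed:
  assumes "(x, y) \<in> conn r" and "\<And>a b. (a, b) \<in> r \<Longrightarrow> a \<in> A \<longleftrightarrow> b \<in> A"
  shows "x \<in> A \<longleftrightarrow> y \<in> A"
  using assms(1) unfolding conn_def
  by (induction rule: rtrancl_induct) (use assms(2) in auto)

lemma conn_class_eq: "(x, y) \<in> conn r \<longleftrightarrow> conn r `` {x} = conn r `` {y}"
  using equiv_conn[of r] by (simp add: eq_equiv_class_iff)

lemma conn_insert:
  "(x, y) \<in> conn (insert (u, v) r) \<longleftrightarrow>
     (x, y) \<in> conn r \<or> (x, u) \<in> conn r \<and> (v, y) \<in> conn r \<or> (x, v) \<in> conn r \<and> (u, y) \<in> conn r"
  (is "?L \<longleftrightarrow> ?R")
proof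
  assume ?L
  then show ?R
    unfolding conn_def[of "insert (u, v) r"]
  proof (induction rule: rtrancl_induct)
    case (step y z)
    then consider "y = u" "z = v" | "y = v" "z = u" | "(y, z) \<in> conn r"
      by (auto intro: conn_base conn_sym)
    then show ?case
      using step.IH by cases (blast intro: conn_refl conn_trans conn_sym)+
  qed simp
next
  assume ?R
  have sub: "conn r \<subseteq> conn (insert (u, v) r)"
    by (intro conn_mono) auto
  have "(u, v) \<in> conn (insert (u, v) r)"
    by (intro conn_base) auto
  with \<open>?R\<close> show ?L
    using sub by (meson conn_sym conn_trans subsetD)
qed

text \<open>If the classes of \<open>u\<close> and \<open>v\<close> differ, exactly these two are
  replaced by their union. The later counts of cycles, faces and components reduce to this one
  comparison.\<close>

lemma num_classes_insert:
  assumes "finite S" "u \<in> S" "v \<in> S"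
  shows "num_classes S r =
    num_classes S (insert (u, v) r) + (if (u, v) \<in> conn r then 0 else 1)"
proof (cases "(u, v) \<in> conn r")
  case True
  then have "conn (insert (u, v) r) = conn r"
    by (intro set_eqI) (metis conn_insert conn_sym conn_trans surj_pair)
  then show ?thesis
    using True by (simp add: num_classes_def)
next
  case False
  define C where "C = (\<lambda>x. conn r `` {x})"
  define D where "D = (\<lambda>x. conn (insert (u, v) r) `` {x})"
  define R where "R = C ` S - {C u, C v}"
  have disj: "C u \<noteq> C v"
    using False by (auto simp: C_def conn_class_eq)
  have D: "D x = (if C x = C u \<or> C x = C v then C u \<union> C v else C x)" for x
  proof (intro set_eqI)
    fix y
    have "y \<in> D x \<longleftrightarrow> (x, y) \<in> conn r \<or> (x, u) \<in> conn r \<and> (v, y) \<in> conn r \<or> (x, v) \<in> conn r \<and> (u, y) \<in> conn r"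
      by (simp add: D_def conn_insert)
    moreover have "C x = C u \<longleftrightarrow> (x, u) \<in> conn r" "C x = C v \<longleftrightarrow> (x, v) \<in> conn r"
      by (simp_all add: C_def conn_class_eq)
    moreover have "y \<in> C z \<longleftrightarrow> (z, y) \<in> conn r" for z
      by (simp add: C_def)
    ultimately show "y \<in> D x \<longleftrightarrow> y \<in> (if C x = C u \<or> C x = C v then C u \<union> C v else C x)"
      by (metis UnE UnI1 UnI2 conn_sym conn_trans)
  qed
  have "D ` S = insert (C u \<union> C v) R"
    using assms by (auto simp: D R_def image_iff)
  moreover have "C u \<union> C v \<notin> R"
  proof
    assume "C u \<union> C v \<in> R"
    then obtain x where x: "C u \<union> C v = C x" "C x \<noteq> C u" unfolding R_def by blast
    have "u \<in> C u" by (simp add: C_def)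
    then have "u \<in> C x" using x(1) by blast
    then have "C x = C u" by (simp add: C_def conn_class_eq)
    with x(2) show False by simp
  qed
  moreover have "C ` S = insert (C u) (insert (C v) R)"
    using assms by (auto simp: R_def)
  moreover have "finite R"
    using assms by (simp add: R_def)
  moreover have "C u \<notin> R" "C v \<notin> R"
    by (simp_all add: R_def)
  moreover have "num_classes S r = card (C ` S)" "num_classes S (insert (u, v) r) = card (D ` S)"
    by (simp_all add: num_classes_def C_def D_def)
  ultimately show ?thesis
    using disj False by simp
qed

lemma num_classes_Un:
  assumes "finite S1" "finite S2" "S1 \<inter> S2 = {}"
    and "\<And>a b. (a, b) \<in> r \<Longrightarrow> a \<in> S1 \<longleftrightarrow> b \<in> S1"
  shows "num_classes (S1 \<union> S2) r = num_classes S1 r + num_classes S2 r"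
proof -
  have "(\<lambda>x. conn r `` {x}) ` S1 \<inter> (\<lambda>x. conn r `` {x}) ` S2 = {}"
  proof (clarsimp simp: disjoint_iff image_iff)
    fix x y assume xy: "x \<in> S1" "y \<in> S2" "conn r `` {x} = conn r `` {y}"
    then have "(x, y) \<in> conn r" by (simp add: conn_class_eq)
    then have "y \<in> S1" using conn_closed[OF _ assms(4)] xy by blast
    then show False using xy assms by auto
  qed
  then show ?thesis
    using assms by (simp add: num_classes_def image_Un card_Un_disjoint)
qed

lemma num_classes_cong:
  assumes "\<And>x. x \<in> S \<Longrightarrow> conn r `` {x} = conn r' `` {x}"
  shows "num_classes S r = num_classes S r'"
  unfolding num_classes_def using assms by (metis (mono_tags, lifting) image_cong)

lemma conn_class_cong:
  assumes "\<And>a b. (a, b) \<in> r \<Longrightarrow> a \<in> A \<longleftrightarrow> b \<in> A"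
    and "\<And>a b. a \<in> A \<Longrightarrow> (a, b) \<in> r \<Longrightarrow> (a, b) \<in> r'"
    and "\<And>a b. (a, b) \<in> r' \<Longrightarrow> a \<in> A \<longleftrightarrow> b \<in> A"
    and "\<And>a b. a \<in> A \<Longrightarrow> (a, b) \<in> r' \<Longrightarrow> (a, b) \<in> r"
    and "x \<in> A"
  shows "conn r `` {x} = conn r' `` {x}"
proof -
  have *: "(x, y) \<in> conn r2 \<and> y \<in> A"
    if "(x, y) \<in> conn r1"
      "\<And>a b. (a, b) \<in> r1 \<Longrightarrow> a \<in> A \<longleftrightarrow> b \<in> A"
      "\<And>a b. a \<in> A \<Longrightarrow> (a, b) \<in> r1 \<Longrightarrow> (a, b) \<in> r2" for r1 r2 y
    using that(1) unfolding conn_def[of r1]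
  proof (induction rule: rtrancl_induct)
    case base
    then show ?case using \<open>x \<in> A\<close> by simp
  next
    case (step y z)
    have "(y, z) \<in> conn r2" "z \<in> A"
      using step that(2,3) conn_base conn_sym by (metis Un_iff converseD)+
    then show ?case using step.IH conn_trans by metis
  qed
  show ?thesis
    using *[OF _ assms(1,2)] *[OF _ assms(3,4)] by blast
qed

lemma num_classes_eq_1_iff:
  assumes "finite S" "a \<in> S"
  shows "num_classes S r = 1 \<longleftrightarrow> (\<forall>x\<in>S. (a, x) \<in> conn r)"
proof
  assume "num_classes S r = 1"
  then obtain C where C: "(\<lambda>x. conn r `` {x}) ` S = {C}"
    unfolding num_classes_def by (rule card_1_singletonE)
  have cls: "conn r `` {x} = C" if "x \<in> S" for x
    using imageI[OF that, of "\<lambda>x. conn r `` {x}"] unfolding C by (rule singletonD)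
  show "\<forall>x\<in>S. (a, x) \<in> conn r"
    unfolding conn_class_eq using cls cls[OF assms(2)] by metis
next
  assume "\<forall>x\<in>S. (a, x) \<in> conn r"
  then have "conn r `` {x} = conn r `` {a}" if "x \<in> S" for x
    using that conn_class_eq[of a x r] by blast
  then have "(\<lambda>x. conn r `` {x}) ` S = (\<lambda>x. conn r `` {a}) ` S"
    by (intro image_cong refl)
  then have "(\<lambda>x. conn r `` {x}) ` S = {conn r `` {a}}"
    using assms(2) by blast
  then show "num_classes S r = 1" by (simp add: num_classes_def)
qed

section \<open>Cycles as connectivity classes, and the effect of a transposition on them\<close>

lemma graph_of_iff [simp]: "(x, y) \<in> graph_of f \<longleftrightarrow> y = f x"
  by (auto simp: graph_of_def)

lemma conn_graph_step: "(x, f x) \<in> conn (graph_of f)"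
  by (simp add: conn_base)

text \<open>The values \<open>f x\<close> and \<open>transpose u v (f x)\<close> differ only inside
  {u, v}, where the inserted edge makes them equivalent. So a permutation before and after a
  transposition can be compared with one common relation.\<close>

lemma conn_insert_swap:
  "conn (insert (u, v) (graph_of (transpose u v \<circ> f) \<union> s)) = conn (insert (u, v) (graph_of f \<union> s))"
proof -
  have *: "conn (insert (u, v) (graph_of (transpose u v \<circ> g) \<union> s))
             \<subseteq> conn (insert (u, v) (graph_of g \<union> s))" for g :: "'a \<Rightarrow> 'a"
  proof (rule conn_least)
    let ?c = "conn (insert (u, v) (graph_of g \<union> s))"
    have 1: "(x, g x) \<in> ?c" for x
      by (rule conn_base) simp
    have 2: "(u, v) \<in> ?c"
      by (rule conn_base) simp
    have "(x, transpose u v (g x)) \<in> ?c" for x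
    proof (cases "g x = u \<or> g x = v")
      case True
      then show ?thesis
        using 1[of x] conn_trans[OF _ 2, of x] conn_trans[OF _ conn_sym[OF 2], of x] by auto
    next
      case False
      then show ?thesis using 1[of x] by simp
    qed
    note 3 = this
    show "insert (u, v) (graph_of (transpose u v \<circ> g) \<union> s) \<subseteq> ?c"
    proof (rule subrelI)
      fix a b assume "(a, b) \<in> insert (u, v) (graph_of (transpose u v \<circ> g) \<union> s)"
      then consider "a = u" "b = v" | "b = transpose u v (g a)" | "(a, b) \<in> s" by auto
      then show "(a, b) \<in> ?c"
      proof cases
        case 1
        then show ?thesis using 2 by simp
      next
        case 2
        then show ?thesis using 3 by simp
      next
        case 3
        then show ?thesis by (intro conn_base) simp
      qed
    qed
  qed
  show ?thesis
    using *[of f] *[of "transpose u v \<circ> f"] by (simp add: o_assoc subset_antisym)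
qed

lemma orbit_eq_conn:
  assumes "permutation f"
  shows "orbit f x = conn (graph_of f) `` {x}"
proof (intro set_eqI iffI)
  fix y assume "y \<in> orbit f x"
  then have "(x, y) \<in> conn (graph_of f)"
    by induction (metis conn_graph_step conn_trans)+
  then show "y \<in> conn (graph_of f) `` {x}" by simp
next
  fix y assume "y \<in> conn (graph_of f) `` {x}"
  then have "(x, y) \<in> conn (graph_of f)" by simp
  moreover have "a \<in> orbit f x \<longleftrightarrow> b \<in> orbit f x" if "(a, b) \<in> graph_of f" for a b
    using that assms
    by (metis graph_of_iff orbit.step orbit_trans permutation_orbit_step permutation_self_in_orbit)
  ultimately show "y \<in> orbit f x"
    using conn_closed[of x y "graph_of f" "orbit f x"] assms permutation_self_in_orbit by metis
qed

lemma permutes_permutation: "finite S \<Longrightarrow> f permutes S \<Longrightarrow> permutation f"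
  by (auto simp: permutation_permutes)

lemma num_cycles_eq_classes:
  assumes "finite S" "f permutes S"
  shows "num_cycles S f = num_classes S (graph_of f)"
  using permutes_permutation[OF assms]
  by (simp add: num_cycles_def cycle_supports_def num_classes_def orbit_eq_conn)

lemma permutes_transpose_comp:
  "f permutes S \<Longrightarrow> u \<in> S \<Longrightarrow> v \<in> S \<Longrightarrow> transpose u v \<circ> f permutes S"
  by (intro permutes_compose permutes_swap_id)

text \<open>Suppose both maps separate \<open>u\<close> from \<open>v\<close>. On the intersection
  of the two classes of \<open>u\<close>, the map \<open>f\<close> stays inside and never takes the
  value \<open>u\<close>, since \<open>transpose u v \<circ> f\<close> would then reach
  \<open>v\<close>. But an injective self-map of a finite set cannot miss a point.\<close>

lemma transpose_connects_or:
  assumes S: "finite S" and f: "f permutes S" and uv: "u \<in> S" "v \<in> S" "u \<noteq> v"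
  shows "(u, v) \<in> conn (graph_of f) \<or> (u, v) \<in> conn (graph_of (transpose u v \<circ> f))"
proof (rule ccontr)
  assume neg: "\<not> ?thesis"
  define g where "g = transpose u v \<circ> f"
  have g: "g permutes S" unfolding g_def by (intro permutes_transpose_comp f uv)
  define C where "C = conn (graph_of g) `` {u}"
  define D where "D = conn (graph_of f) `` {u}"
  have v: "v \<notin> C" "v \<notin> D" using neg by (auto simp: C_def D_def g_def)
  have fin: "finite C"
    using orbit_eq_conn[OF permutes_permutation[OF S g], of u]
      permutes_orbit_subset[OF g uv(1)] S finite_subset by (metis C_def)
  have "f x \<in> (C \<inter> D) - {u}" if "x \<in> C \<inter> D" for x
  proof -
    have "g x \<in> C" "f x \<in> D"
      using that conn_graph_step[of x g] conn_graph_step[of x f] conn_trans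
      by (auto simp: C_def D_def)
    moreover have "f x \<noteq> u" using \<open>g x \<in> C\<close> v by (auto simp: g_def)
    moreover have "f x \<noteq> v" using \<open>f x \<in> D\<close> v by auto
    ultimately show ?thesis by (auto simp: g_def)
  qed
  then have "f ` (C \<inter> D) \<subseteq> (C \<inter> D) - {u}" by blast
  moreover have "card (f ` (C \<inter> D)) = card (C \<inter> D)"
    by (intro card_image inj_on_subset[OF permutes_inj[OF f]]) auto
  moreover have "card ((C \<inter> D) - {u}) < card (C \<inter> D)"
    using fin by (intro card_Diff1_less) (auto simp: C_def D_def)
  ultimately show False
    using fin by (metis card_mono finite_Diff finite_Int leD)
qed

text \<open>Follow the cycle of \<open>f\<close> from \<open>u\<close> up to the point before
  \<open>v\<close>. The transposition redirects the last arrow back to \<open>u\<close>, so this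
  segment closes up to a cycle that avoids \<open>v\<close>.\<close>

lemma transpose_splits:
  assumes S: "finite S" and f: "f permutes S" and uv: "u \<in> S" "v \<in> S" "u \<noteq> v"
    and "(u, v) \<in> conn (graph_of f)"
  shows "(u, v) \<notin> conn (graph_of (transpose u v \<circ> f))"
proof
  assume conn: "(u, v) \<in> conn (graph_of (transpose u v \<circ> f))"
  define g where "g = transpose u v \<circ> f"
  have perm: "permutation f" using S f by (rule permutes_permutation)
  have gp: "g permutes S" unfolding g_def by (intro permutes_transpose_comp f uv)
  have "v \<in> orbit f u" using assms orbit_eq_conn[OF perm] by simp
  then have "\<exists>n. (f ^^ n) u = v" by (auto simp: orbit_altdef)
  \<comment> \<open>First hitting time of \<open>v\<close>. Before it the path does not return to
    \<open>u\<close> either, since a return would produce an earlier hit.\<close>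
  define k where "k = (LEAST n. (f ^^ n) u = v)"
  have k: "(f ^^ k) u = v"
    unfolding k_def using \<open>\<exists>n. (f ^^ n) u = v\<close> by (rule LeastI_ex)
  have least: "(f ^^ i) u \<noteq> v" if "i < k" for i
    using that not_less_Least unfolding k_def by blast
  have k0: "k > 0" using k uv by (cases k) auto
  define C where "C = (\<lambda>i. (f ^^ i) u) ` {..<k}"
  have ne: "(f ^^ i) u \<noteq> u" if i: "0 < i" "i < k" for i
  proof
    assume eq: "(f ^^ i) u = u"
    have "(f ^^ k) u = (f ^^ (k - i)) ((f ^^ i) u)"
      using i by (metis add_diff_inverse_nat add.commute comp_apply funpow_add less_imp_not_less)
    then show False using eq k least[of "k - i"] i by simp
  qed
  have gC: "g x \<in> C" if "x \<in> C" for x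
  proof -
    obtain i where i: "i < k" "x = (f ^^ i) u"
      using \<open>x \<in> C\<close> unfolding C_def by blast
    have fx: "f x = (f ^^ Suc i) u" using i by simp
    show ?thesis
    proof (cases "Suc i = k")
      case True
      then have "g x = u" using fx k by (simp add: g_def)
      then show ?thesis using k0 by (auto simp: C_def image_iff intro!: bexI[of _ 0])
    next
      case False
      then have "Suc i < k" using i by simp
      then have "g x = (f ^^ Suc i) u"
        using fx least[of "Suc i"] ne[of "Suc i"] by (simp add: g_def)
      then show ?thesis using \<open>Suc i < k\<close> unfolding C_def by blast
    qed
  qed
  have finC: "finite C" by (simp add: C_def)
  have "g ` C = C"
  proof (rule card_subset_eq[OF finC])
    show "g ` C \<subseteq> C" using gC by blast
    show "card (g ` C) = card C"
      by (intro card_image inj_on_subset[OF permutes_inj[OF gp]]) auto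
  qed
  then have "a \<in> C \<longleftrightarrow> b \<in> C" if "(a, b) \<in> graph_of g" for a b
    using that permutes_inj[OF gp] by (metis (no_types, lifting) graph_of_iff inj_image_mem_iff)
  then have "u \<in> C \<longleftrightarrow> v \<in> C"
    using conn_closed[OF conn[folded g_def]] by blast
  moreover have "u \<in> C" using k0 by (auto simp: C_def image_iff intro!: bexI[of _ 0])
  moreover have "v \<notin> C" using least by (auto simp: C_def)
  ultimately show False by simp
qed

lemma transpose_cycle_iff:
  assumes "finite S" "f permutes S" "u \<in> S" "v \<in> S" "u \<noteq> v"
  shows "(u, v) \<in> conn (graph_of (transpose u v \<circ> f)) \<longleftrightarrow> (u, v) \<notin> conn (graph_of f)"
  using transpose_connects_or[OF assms] transpose_splits[OF assms] by blast

text \<open>Adding the edge (u, v) to either graph gives the same relation. It costs a class for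
  exactly one of the two permutations, the one that separates \<open>u\<close> and
  \<open>v\<close>.\<close>

lemma num_cycles_transpose:
  assumes "finite S" "f permutes S" "u \<in> S" "v \<in> S" "u \<noteq> v"
  shows "(u, v) \<in> conn (graph_of f) \<Longrightarrow> num_cycles S (transpose u v \<circ> f) = num_cycles S f + 1"
    and "(u, v) \<notin> conn (graph_of f) \<Longrightarrow> num_cycles S f = num_cycles S (transpose u v \<circ> f) + 1"
proof -
  note n1 = num_classes_insert[OF assms(1,3,4), of "graph_of f"]
  note n2 = num_classes_insert[OF assms(1,3,4), of "graph_of (transpose u v \<circ> f)"]
  have eq: "conn (insert (u, v) (graph_of (transpose u v \<circ> f))) = conn (insert (u, v) (graph_of f))"
    using conn_insert_swap[of u v f "{}"] by simp
  note e = num_cycles_eq_classes[OF assms(1,2)]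
    num_cycles_eq_classes[OF assms(1) permutes_transpose_comp[OF assms(2,3,4)]]
  show "(u, v) \<in> conn (graph_of f) \<Longrightarrow> num_cycles S (transpose u v \<circ> f) = num_cycles S f + 1"
    and "(u, v) \<notin> conn (graph_of f) \<Longrightarrow> num_cycles S f = num_cycles S (transpose u v \<circ> f) + 1"
    using n1 n2 eq e transpose_cycle_iff[OF assms] by (simp_all add: num_classes_def)
qed

section \<open>Components, faces and the genus inequality\<close>

definition comps :: "nat set \<Rightarrow> (nat \<Rightarrow> nat) \<Rightarrow> (nat \<Rightarrow> nat) \<Rightarrow> nat" where
  "comps S \<sigma> \<tau> = num_classes S (graph_of \<sigma> \<union> graph_of \<tau>)"

abbreviation linked :: "(nat \<Rightarrow> nat) \<Rightarrow> (nat \<Rightarrow> nat) \<Rightarrow> (nat \<times> nat) set" where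
  "linked \<sigma> \<tau> \<equiv> conn (graph_of \<sigma> \<union> graph_of \<tau>)"

text \<open>All components of the surface glued from \<open>\<sigma>\<close> and \<open>\<tau>\<close> have genus 0.\<close>

definition planar :: "nat set \<Rightarrow> (nat \<Rightarrow> nat) \<Rightarrow> (nat \<Rightarrow> nat) \<Rightarrow> bool" where
  "planar S \<sigma> \<tau> \<longleftrightarrow>
     num_cycles S \<sigma> + num_cycles S (inv \<sigma> \<circ> \<tau>) + num_cycles S \<tau> = card S + 2 * comps S \<sigma> \<tau>"

lemma comp_transpose: "inj f \<Longrightarrow> f \<circ> transpose u v = transpose (f u) (f v) \<circ> f"
  by (auto simp: fun_eq_iff transpose_def inj_eq)

lemma inv_transpose_comp:
  assumes "\<sigma> permutes S"
  shows "inv (transpose u v \<circ> \<sigma>) = inv \<sigma> \<circ> transpose u v"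
  using permutes_bij[OF assms] by (simp add: o_inv_distrib)

lemma inv_transpose_comp_both:
  assumes "\<sigma> permutes S"
  shows "inv (transpose u v \<circ> \<sigma>) \<circ> (transpose u v \<circ> \<tau>) = inv \<sigma> \<circ> \<tau>"
  by (simp add: inv_transpose_comp[OF assms] fun_eq_iff)

lemma inv_transpose_comp_left:
  assumes "\<sigma> permutes S"
  shows "inv (transpose u v \<circ> \<sigma>) \<circ> \<tau> = transpose (inv \<sigma> u) (inv \<sigma> v) \<circ> (inv \<sigma> \<circ> \<tau>)"
  using comp_transpose[OF permutes_inj[OF permutes_inv[OF assms]]]
  by (simp add: inv_transpose_comp[OF assms] o_assoc)

lemma transpose_twice: "transpose u v \<circ> (transpose u v \<circ> f) = f"
  by (simp add: fun_eq_iff)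

lemma linked_step1: "(x, \<sigma> x) \<in> linked \<sigma> \<tau>"
  by (rule conn_base) simp

lemma linked_step2: "(x, \<tau> x) \<in> linked \<sigma> \<tau>"
  by (rule conn_base) simp

lemma linked_mono1: "(x, y) \<in> conn (graph_of \<sigma>) \<Longrightarrow> (x, y) \<in> linked \<sigma> \<tau>"
  by (erule conn_mono') simp

lemma linked_mono2: "(x, y) \<in> conn (graph_of \<tau>) \<Longrightarrow> (x, y) \<in> linked \<sigma> \<tau>"
  by (erule conn_mono') simp

lemma linked_inv:
  assumes "\<sigma> permutes S" and "(x, y) \<in> conn (graph_of (inv \<sigma> \<circ> \<tau>))"
  shows "(x, y) \<in> linked \<sigma> \<tau>"
proof -
  have "graph_of (inv \<sigma> \<circ> \<tau>) \<subseteq> linked \<sigma> \<tau>"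
  proof (rule subrelI)
    fix a b assume "(a, b) \<in> graph_of (inv \<sigma> \<circ> \<tau>)"
    then have "\<sigma> b = \<tau> a" by (simp add: permutes_inverses[OF assms(1)])
    then show "(a, b) \<in> linked \<sigma> \<tau>"
      using linked_step1[of b \<sigma> \<tau>] linked_step2[of a \<tau> \<sigma>] conn_sym conn_trans by metis
  qed
  then show ?thesis using conn_least assms(2) by blast
qed

lemma linked_transpose_both:
  "conn (insert (u, v) (graph_of (transpose u v \<circ> \<sigma>) \<union> graph_of (transpose u v \<circ> \<tau>))) =
   conn (insert (u, v) (graph_of \<sigma> \<union> graph_of \<tau>))"
  using conn_insert_swap[of u v \<sigma> "graph_of (transpose u v \<circ> \<tau>)"]
    conn_insert_swap[of u v \<tau> "graph_of \<sigma>"] by (simp add: Un_commute)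

text \<open>With the edge (u, v) both pairs have the same classes. The unprimed pair already links
  \<open>u\<close> and \<open>v\<close>, so the edge costs it nothing.\<close>

lemma comps_transpose:
  assumes "finite S" "u \<in> S" "v \<in> S" "(u, v) \<in> linked \<sigma> \<tau>"
    and "conn (insert (u, v) (graph_of \<sigma>' \<union> graph_of \<tau>')) = conn (insert (u, v) (graph_of \<sigma> \<union> graph_of \<tau>))"
  shows "comps S \<sigma>' \<tau>' = comps S \<sigma> \<tau> + (if (u, v) \<in> linked \<sigma>' \<tau>' then 0 else 1)"
  using num_classes_insert[OF assms(1-3), of "graph_of \<sigma> \<union> graph_of \<tau>"]
    num_classes_insert[OF assms(1-3), of "graph_of \<sigma>' \<union> graph_of \<tau>'"] assms(4,5)
  by (simp add: comps_def num_classes_def)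

context
  fixes S :: "nat set" and \<sigma> \<tau> :: "nat \<Rightarrow> nat" and u v :: nat
  assumes fin: "finite S" and \<sigma>: "\<sigma> permutes S" and \<tau>: "\<tau> permutes S"
    and u: "u \<in> S" and v: "v \<in> S" and uv: "u \<noteq> v"
    and same: "(u, v) \<in> conn (graph_of \<sigma>)"
begin

lemma num_cycles_cut:
  "num_cycles S (transpose u v \<circ> \<sigma>) = num_cycles S \<sigma> + 1"
  using num_cycles_transpose(1)[OF fin \<sigma> u v uv same] .

lemma comps_cut:
  "comps S (transpose u v \<circ> \<sigma>) \<tau> =
     comps S \<sigma> \<tau> + (if (u, v) \<in> linked (transpose u v \<circ> \<sigma>) \<tau> then 0 else 1)"
  by (rule comps_transpose[OF fin u v linked_mono1[OF same]]) (rule conn_insert_swap)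

text \<open>The faces are the cycles of \<open>inv \<sigma> \<circ> \<tau>\<close>. A transposition
  on the left of \<sigma> acts on them as the transposition of the preimages \<open>p\<close>,
  \<open>q\<close> of \<open>u\<close>, \<open>v\<close>, so their number changes by one. If the cut
  disconnects \<open>u\<close> from \<open>v\<close>, then \<open>p\<close> and \<open>q\<close> lie
  in different faces afterwards, hence in the same face before.\<close>

lemma faces_cut:
  "num_cycles S (inv \<sigma> \<circ> \<tau>) \<le> num_cycles S (inv (transpose u v \<circ> \<sigma>) \<circ> \<tau>) + 1"
  "(u, v) \<notin> linked (transpose u v \<circ> \<sigma>) \<tau> \<Longrightarrow>
     num_cycles S (inv (transpose u v \<circ> \<sigma>) \<circ> \<tau>) = num_cycles S (inv \<sigma> \<circ> \<tau>) + 1"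
proof -
  define p q where "p = inv \<sigma> u" and "q = inv \<sigma> v"
  have pq: "p \<in> S" "q \<in> S" "p \<noteq> q"
    using permutes_in_image[OF permutes_inv[OF \<sigma>]] u v uv permutes_inj[OF permutes_inv[OF \<sigma>]]
    by (auto simp: p_def q_def inj_eq)
  have \<phi>: "inv \<sigma> \<circ> \<tau> permutes S" by (intro permutes_compose permutes_inv \<sigma> \<tau>)
  have \<phi>0: "inv (transpose u v \<circ> \<sigma>) \<circ> \<tau> = transpose p q \<circ> (inv \<sigma> \<circ> \<tau>)"
    unfolding p_def q_def by (rule inv_transpose_comp_left[OF \<sigma>])
  note n = num_cycles_transpose[OF fin \<phi> pq, folded \<phi>0]
  show "num_cycles S (inv \<sigma> \<circ> \<tau>) \<le> num_cycles S (inv (transpose u v \<circ> \<sigma>) \<circ> \<tau>) + 1"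
    using n by linarith
  assume neg: "(u, v) \<notin> linked (transpose u v \<circ> \<sigma>) \<tau>"
  have "(p, q) \<notin> conn (graph_of (inv (transpose u v \<circ> \<sigma>) \<circ> \<tau>))"
  proof
    assume "(p, q) \<in> conn (graph_of (inv (transpose u v \<circ> \<sigma>) \<circ> \<tau>))"
    then have "(p, q) \<in> linked (transpose u v \<circ> \<sigma>) \<tau>"
      by (rule linked_inv[OF permutes_transpose_comp[OF \<sigma> u v]])
    moreover have "(p, v) \<in> linked (transpose u v \<circ> \<sigma>) \<tau>" "(q, u) \<in> linked (transpose u v \<circ> \<sigma>) \<tau>"
      using linked_step1[of p "transpose u v \<circ> \<sigma>" \<tau>] linked_step1[of q "transpose u v \<circ> \<sigma>" \<tau>]
      by (simp_all add: p_def q_def permutes_inverses[OF \<sigma>])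
    ultimately show False using neg conn_sym conn_trans by metis
  qed
  then have "(p, q) \<in> conn (graph_of (inv \<sigma> \<circ> \<tau>))"
    using transpose_cycle_iff[OF fin \<phi> pq] by (simp add: \<phi>0)
  then show "num_cycles S (inv (transpose u v \<circ> \<sigma>) \<circ> \<tau>) = num_cycles S (inv \<sigma> \<circ> \<tau>) + 1"
    using n by simp
qed

end

lemma num_cycles_id: "num_cycles S id = card S"
proof -
  have "orbit id x = {x}" for x :: nat
    using orbit_eq_singleton_iff[of id x] by simp
  then show ?thesis
    by (simp add: num_cycles_def cycle_supports_def card_image)
qed

lemma comps_id:
  assumes "finite S" "\<tau> permutes S"
  shows "comps S id \<tau> = num_cycles S \<tau>"
proof -
  have "conn (graph_of id \<union> graph_of \<tau>) = conn (graph_of \<tau>)"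
  proof (rule antisym)
    show "conn (graph_of id \<union> graph_of \<tau>) \<subseteq> conn (graph_of \<tau>)"
    proof (rule conn_least, rule subrelI)
      fix a b assume "(a, b) \<in> graph_of id \<union> graph_of \<tau>"
      then have "b = a \<or> b = \<tau> a" by auto
      then show "(a, b) \<in> conn (graph_of \<tau>)" using conn_graph_step conn_refl by metis
    qed
    show "conn (graph_of \<tau>) \<subseteq> conn (graph_of id \<union> graph_of \<tau>)"
      by (rule conn_mono) simp
  qed
  then show ?thesis by (simp add: comps_def num_cycles_eq_classes[OF assms] num_classes_def)
qed

text \<open>Induction on the number of moved points: cutting \<open>a\<close> from
  \<open>\<sigma> a\<close> makes \<open>a\<close> a fixed point. The cut either gains a cycle and
  loses at most one face, or gains a cycle, a face and a component, which adds 2 to both sides; so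
  the bound after the cut implies the bound before it. For the identity, both the faces and the
  components are the cycles of \<tau>.\<close>

theorem genus_nonneg:
  assumes "finite S" "\<sigma> permutes S" "\<tau> permutes S"
  shows "num_cycles S \<sigma> + num_cycles S (inv \<sigma> \<circ> \<tau>) + num_cycles S \<tau> \<le> card S + 2 * comps S \<sigma> \<tau>"
  using assms(2)
proof (induction "card {x. \<sigma> x \<noteq> x}" arbitrary: \<sigma> rule: less_induct)
  case less
  show ?case
  proof (cases "\<sigma> = id")
    case True
    then show ?thesis
      using assms by (simp add: num_cycles_id comps_id)
  next
    case False
    then obtain a where a: "\<sigma> a \<noteq> a" by (auto simp: fun_eq_iff)
    define \<sigma>0 where "\<sigma>0 = transpose a (\<sigma> a) \<circ> \<sigma>"
    have S: "a \<in> S" "\<sigma> a \<in> S"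
      using a less.prems permutes_not_in permutes_in_image by metis+
    have p0: "\<sigma>0 permutes S"
      unfolding \<sigma>0_def by (intro permutes_transpose_comp less.prems S)
    have inj: "inj \<sigma>" using less.prems by (rule permutes_inj)
    have "{x. \<sigma>0 x \<noteq> x} \<subset> {x. \<sigma> x \<noteq> x}"
    proof
      show "{x. \<sigma>0 x \<noteq> x} \<subseteq> {x. \<sigma> x \<noteq> x}"
      proof (intro subsetI CollectI notI)
        fix x assume x: "x \<in> {x. \<sigma>0 x \<noteq> x}" "\<sigma> x = x"
        then have "x \<noteq> a" "x \<noteq> \<sigma> a" using a inj by (auto simp: inj_eq)
        then show False using x by (simp add: \<sigma>0_def)
      qed
      have "\<sigma>0 a = a" by (simp add: \<sigma>0_def)
      then show "{x. \<sigma>0 x \<noteq> x} \<noteq> {x. \<sigma> x \<noteq> x}" using a by blast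
    qed
    moreover have "finite {x. \<sigma> x \<noteq> x}"
      using less.prems assms(1) by (metis (mono_tags, lifting) finite_subset mem_Collect_eq permutes_not_in subsetI)
    ultimately have "card {x. \<sigma>0 x \<noteq> x} < card {x. \<sigma> x \<noteq> x}"
      by (intro psubset_card_mono)
    note IH = less.hyps[OF this p0]
    have ne: "a \<noteq> \<sigma> a" using a by simp
    note c = assms(1) less.prems assms(3) S ne conn_graph_step[of a \<sigma>]
    show ?thesis
      using IH num_cycles_cut[OF c] comps_cut[OF c] faces_cut[OF c]
      unfolding \<sigma>0_def by (cases "(a, \<sigma> a) \<in> linked (transpose a (\<sigma> a) \<circ> \<sigma>) \<tau>") simp_all
  qed
qed

section \<open>Surgery on planar pairs of permutations\<close>

lemma planar_cut:
  assumes "finite S" "\<sigma> permutes S" "\<tau> permutes S" "u \<in> S" "v \<in> S" "u \<noteq> v"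
    and "(u, v) \<in> conn (graph_of \<sigma>)" and "planar S \<sigma> \<tau>"
  shows "planar S (transpose u v \<circ> \<sigma>) \<tau>"
  \<comment> \<open>If the cut does not disconnect, the left side of the planarity equation cannot
    decrease, and the inequality keeps it from increasing. If it disconnects, both sides grow by
    2.\<close>
  using genus_nonneg[OF assms(1) permutes_transpose_comp[OF assms(2,4,5)] assms(3)] assms(8)
    num_cycles_cut[OF assms(1-7)] comps_cut[OF assms(1-7)] faces_cut[OF assms(1-7)]
  unfolding planar_def by (cases "(u, v) \<in> linked (transpose u v \<circ> \<sigma>) \<tau>") simp_all

text \<open>The cut formulas read backwards: the joined permutation has \<open>u\<close> and
  \<open>v\<close> on one cycle, and cutting it again gives back \<sigma>, for which they are not
  linked.\<close>

lemma planar_join: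
  assumes fin: "finite S" and p: "\<sigma> permutes S" "\<tau> permutes S" and uv: "u \<in> S" "v \<in> S" "u \<noteq> v"
    and nl: "(u, v) \<notin> linked \<sigma> \<tau>" and "planar S \<sigma> \<tau>"
  shows "planar S (transpose u v \<circ> \<sigma>) \<tau>"
    and "comps S \<sigma> \<tau> = comps S (transpose u v \<circ> \<sigma>) \<tau> + 1"
proof -
  have "(u, v) \<in> conn (graph_of (transpose u v \<circ> \<sigma>))"
    using transpose_connects_or[OF fin p(1) uv] nl linked_mono1 by metis
  note c = fin permutes_transpose_comp[OF p(1) uv(1,2), of] p(2) uv this
  show "comps S \<sigma> \<tau> = comps S (transpose u v \<circ> \<sigma>) \<tau> + 1"
    using comps_cut[OF c] nl by (simp add: transpose_twice)
  then show "planar S (transpose u v \<circ> \<sigma>) \<tau>"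
    using num_cycles_cut[OF c] faces_cut(2)[OF c] nl \<open>planar S \<sigma> \<tau>\<close>
    unfolding planar_def transpose_twice by simp
qed

text \<open>Both permutations gain a cycle while the faces stay the same, so the left side of the
  genus inequality grows by 2. Equality held before, so the number of components has to grow: a cut
  between two points of one boundary separates a planar surface.\<close>

lemma planar_split:
  assumes fin: "finite S" and p: "\<sigma> permutes S" "\<tau> permutes S" and uv: "u \<in> S" "v \<in> S" "u \<noteq> v"
    and c: "(u, v) \<in> conn (graph_of \<sigma>)" "(u, v) \<in> conn (graph_of \<tau>)"
    and "planar S \<sigma> \<tau>"
  shows "planar S (transpose u v \<circ> \<sigma>) (transpose u v \<circ> \<tau>)"
    and "comps S (transpose u v \<circ> \<sigma>) (transpose u v \<circ> \<tau>) = comps S \<sigma> \<tau> + 1"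
    and "(u, v) \<notin> linked (transpose u v \<circ> \<sigma>) (transpose u v \<circ> \<tau>)"
proof -
  note p0 = permutes_transpose_comp[OF p(1) uv(1,2)] permutes_transpose_comp[OF p(2) uv(1,2)]
  note n = num_cycles_transpose(1)[OF fin p(1) uv c(1)] num_cycles_transpose(1)[OF fin p(2) uv c(2)]
  note g = genus_nonneg[OF fin p0] inv_transpose_comp_both[OF p(1), of u v \<tau>]
  note k = comps_transpose[OF fin uv(1,2) linked_mono1[OF c(1)] linked_transpose_both, of \<tau>]
  show nl: "(u, v) \<notin> linked (transpose u v \<circ> \<sigma>) (transpose u v \<circ> \<tau>)"
    using n g k \<open>planar S \<sigma> \<tau>\<close> unfolding planar_def by (auto split: if_splits)
  show "comps S (transpose u v \<circ> \<sigma>) (transpose u v \<circ> \<tau>) = comps S \<sigma> \<tau> + 1"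
    using k nl by simp
  then show "planar S (transpose u v \<circ> \<sigma>) (transpose u v \<circ> \<tau>)"
    using n g(2) \<open>planar S \<sigma> \<tau>\<close> unfolding planar_def by simp
qed

text \<open>The inverse of \<open>planar_split\<close>: two components are joined, and \<sigma> and
  \<tau> lose one cycle each while the faces stay the same.\<close>

lemma planar_unsplit:
  assumes fin: "finite S" and p: "\<sigma> permutes S" "\<tau> permutes S" and uv: "u \<in> S" "v \<in> S" "u \<noteq> v"
    and nl: "(u, v) \<notin> linked \<sigma> \<tau>" and "planar S \<sigma> \<tau>"
  shows "planar S (transpose u v \<circ> \<sigma>) (transpose u v \<circ> \<tau>)"
    and "comps S \<sigma> \<tau> = comps S (transpose u v \<circ> \<sigma>) (transpose u v \<circ> \<tau>) + 1"
proof -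
  have nc: "(u, v) \<notin> conn (graph_of \<sigma>)" "(u, v) \<notin> conn (graph_of \<tau>)"
    using nl linked_mono1 linked_mono2 by metis+
  then have c: "(u, v) \<in> conn (graph_of (transpose u v \<circ> \<sigma>))"
    using transpose_connects_or[OF fin p(1) uv] by metis
  note n = num_cycles_transpose(2)[OF fin p(1) uv nc(1)] num_cycles_transpose(2)[OF fin p(2) uv nc(2)]
  show k: "comps S \<sigma> \<tau> = comps S (transpose u v \<circ> \<sigma>) (transpose u v \<circ> \<tau>) + 1"
    using comps_transpose[OF fin uv(1,2) linked_mono1[OF c] linked_transpose_both[symmetric]] nl
    by simp
  show "planar S (transpose u v \<circ> \<sigma>) (transpose u v \<circ> \<tau>)"
    using n k inv_transpose_comp_both[OF p(1), of u v \<tau>] \<open>planar S \<sigma> \<tau>\<close> unfolding planar_def by simp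
qed

text \<open>Here \<open>u\<close> and \<open>v\<close> lie on one cycle of \<sigma> but on different
  boundaries. The transposition gives \<sigma> one cycle more and \<tau> one less, with the same
  faces and components, so the planarity equation is unaffected.\<close>

lemma planar_merge:
  assumes fin: "finite S" and p: "\<sigma> permutes S" "\<tau> permutes S" and uv: "u \<in> S" "v \<in> S" "u \<noteq> v"
    and c: "(u, v) \<in> conn (graph_of \<sigma>)" "(u, v) \<notin> conn (graph_of \<tau>)"
  shows "planar S (transpose u v \<circ> \<sigma>) (transpose u v \<circ> \<tau>) \<longleftrightarrow> planar S \<sigma> \<tau>"
    and "comps S (transpose u v \<circ> \<sigma>) (transpose u v \<circ> \<tau>) = comps S \<sigma> \<tau>"
proof -
  note n = num_cycles_transpose(1)[OF fin p(1) uv c(1)] num_cycles_transpose(2)[OF fin p(2) uv c(2)]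
  have "(u, v) \<in> linked (transpose u v \<circ> \<sigma>) (transpose u v \<circ> \<tau>)"
    using transpose_connects_or[OF fin p(2) uv] c(2) linked_mono2 by metis
  then show k: "comps S (transpose u v \<circ> \<sigma>) (transpose u v \<circ> \<tau>) = comps S \<sigma> \<tau>"
    using comps_transpose[OF fin uv(1,2) linked_mono1[OF c(1)] linked_transpose_both, of \<tau>] by simp
  show "planar S (transpose u v \<circ> \<sigma>) (transpose u v \<circ> \<tau>) \<longleftrightarrow> planar S \<sigma> \<tau>"
    using n k inv_transpose_comp_both[OF p(1), of u v \<tau>] unfolding planar_def by simp
qed

section \<open>Permutations with disjoint supports\<close>

lemma orbit_comp_disjoint:
  assumes "f permutes S" "g permutes T" "S \<inter> T = {}" "x \<in> S"
  shows "orbit (f \<circ> g) x = orbit f x"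
proof (rule orbit_cong0[OF assms(4)])
  have "g y = y" if "y \<in> S" for y
    using that assms by (metis disjoint_iff permutes_not_in)
  then show "f \<circ> g \<in> S \<rightarrow> S" "\<And>y. y \<in> S \<Longrightarrow> (f \<circ> g) y = f y"
    using permutes_in_image[OF assms(1)] by auto
qed

lemma comp_disjoint_commute:
  assumes "f permutes S" "g permutes T" "S \<inter> T = {}"
  shows "f \<circ> g = g \<circ> f"
proof
  fix x
  show "(f \<circ> g) x = (g \<circ> f) x"
    using assms permutes_in_image[OF assms(1), of x] permutes_in_image[OF assms(2), of x]
      permutes_not_in[OF assms(1), of x] permutes_not_in[OF assms(2), of x]
      permutes_not_in[OF assms(1), of "g x"] permutes_not_in[OF assms(2), of "f x"]
    by (cases "x \<in> S"; cases "x \<in> T") (auto simp: disjoint_iff)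
qed

lemma cycle_supports_Un:
  assumes "f permutes S" "g permutes T" "S \<inter> T = {}"
  shows "cycle_supports (S \<union> T) (f \<circ> g) = cycle_supports S f \<union> cycle_supports T g"
proof -
  have "orbit (f \<circ> g) ` S = orbit f ` S"
    by (intro image_cong refl orbit_comp_disjoint[OF assms])
  moreover have "orbit (f \<circ> g) ` T = orbit g ` T"
    unfolding comp_disjoint_commute[OF assms]
    using assms by (intro image_cong refl orbit_comp_disjoint[of g T f S]) auto
  ultimately show ?thesis
    by (simp add: cycle_supports_def image_Un)
qed

lemma cycle_supports_subset:
  assumes "f permutes S" "C \<in> cycle_supports S f"
  shows "C \<subseteq> S" "C \<noteq> {}"
  using assms permutes_orbit_subset orbit_nonempty by (force simp: cycle_supports_def)+

lemma cycle_supports_disjoint: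
  assumes "f permutes S" "g permutes T" "S \<inter> T = {}"
  shows "cycle_supports S f \<inter> cycle_supports T g = {}"
proof (rule ccontr)
  assume "cycle_supports S f \<inter> cycle_supports T g \<noteq> {}"
  then obtain C where "C \<in> cycle_supports S f" "C \<in> cycle_supports T g" by auto
  then have "C \<subseteq> S \<inter> T" "C \<noteq> {}"
    using cycle_supports_subset[OF assms(1), of C] cycle_supports_subset[OF assms(2), of C] by auto
  then show False using assms(3) by simp
qed

lemma finite_cycle_supports: "finite S \<Longrightarrow> finite (cycle_supports S f)"
  by (simp add: cycle_supports_def)

lemma num_cycles_Un:
  assumes "finite S" "finite T" "f permutes S" "g permutes T" "S \<inter> T = {}"
  shows "num_cycles (S \<union> T) (f \<circ> g) = num_cycles S f + num_cycles T g"
  unfolding num_cycles_def cycle_supports_Un[OF assms(3-5)]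
  using assms by (intro card_Un_disjoint finite_cycle_supports cycle_supports_disjoint)

lemma comps_Un:
  assumes fin: "finite S" "finite T" and s: "\<sigma> permutes S" "\<sigma>' permutes T"
    and t: "\<tau> permutes S" "\<tau>' permutes T" and disj: "S \<inter> T = {}"
  shows "comps (S \<union> T) (\<sigma> \<circ> \<sigma>') (\<tau> \<circ> \<tau>') = comps S \<sigma> \<tau> + comps T \<sigma>' \<tau>'"
    and "x \<in> S \<Longrightarrow> y \<in> T \<Longrightarrow> (x, y) \<notin> linked (\<sigma> \<circ> \<sigma>') (\<tau> \<circ> \<tau>')"
proof -
  let ?r = "graph_of (\<sigma> \<circ> \<sigma>') \<union> graph_of (\<tau> \<circ> \<tau>')"
  have S: "(f \<circ> g) x = f x" if "x \<in> S" "f permutes S" "g permutes T" for f g x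
  proof -
    have "x \<notin> T" using that disj by auto
    then show ?thesis using permutes_not_in[OF that(3)] by simp
  qed
  have T: "(f \<circ> g) x = g x" if "x \<in> T" "f permutes S" "g permutes T" for f g x
  proof -
    have "g x \<notin> S" using permutes_in_image[OF that(3), of x] that(1) disj by auto
    then show ?thesis using permutes_not_in[OF that(2)] by simp
  qed
  have out: "(f \<circ> g) x = x" if "x \<notin> S" "x \<notin> T" "f permutes S" "g permutes T" for f g x
    using permutes_not_in[OF that(3,1)] permutes_not_in[OF that(4,2)] by simp
  have inS: "(f \<circ> g) x \<in> S \<longleftrightarrow> x \<in> S" if "f permutes S" "g permutes T" for f g x
    using S[OF _ that, of x] T[OF _ that, of x] out[OF _ _ that, of x] disj
      permutes_in_image[OF that(1), of x] permutes_in_image[OF that(2), of x]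
    by (cases "x \<in> S"; cases "x \<in> T") (auto simp del: o_apply)
  have inT: "(f \<circ> g) x \<in> T \<longleftrightarrow> x \<in> T" if "f permutes S" "g permutes T" for f g x
    using S[OF _ that, of x] T[OF _ that, of x] out[OF _ _ that, of x] disj
      permutes_in_image[OF that(1), of x] permutes_in_image[OF that(2), of x]
    by (cases "x \<in> S"; cases "x \<in> T") (auto simp del: o_apply)
  have rS: "a \<in> S \<longleftrightarrow> b \<in> S" if "(a, b) \<in> ?r" for a b
    using that inS[OF s] inS[OF t] by auto
  have rT: "a \<in> T \<longleftrightarrow> b \<in> T" if "(a, b) \<in> ?r" for a b
    using that inT[OF s] inT[OF t] by auto
  show "(x, y) \<notin> linked (\<sigma> \<circ> \<sigma>') (\<tau> \<circ> \<tau>')" if "x \<in> S" "y \<in> T"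
  proof
    assume "(x, y) \<in> linked (\<sigma> \<circ> \<sigma>') (\<tau> \<circ> \<tau>')"
    from conn_closed[OF this, of S] rS have "y \<in> S" using that by simp
    then show False using that disj by auto
  qed
  have "conn ?r `` {x} = linked \<sigma> \<tau> `` {x}" if "x \<in> S" for x
  proof (rule conn_class_cong[where A = S, OF _ _ _ _ that])
    fix a b
    show "(a, b) \<in> ?r \<Longrightarrow> a \<in> S \<longleftrightarrow> b \<in> S" by (rule rS)
    show "(a, b) \<in> graph_of \<sigma> \<union> graph_of \<tau> \<Longrightarrow> a \<in> S \<longleftrightarrow> b \<in> S"
      using permutes_in_image[OF s(1), of a] permutes_in_image[OF t(1), of a] by auto
    assume "a \<in> S"
    note e = S[OF this s] S[OF this t]
    show "(a, b) \<in> ?r \<Longrightarrow> (a, b) \<in> graph_of \<sigma> \<union> graph_of \<tau>" "(a, b) \<in> graph_of \<sigma> \<union> graph_of \<tau> \<Longrightarrow> (a, b) \<in> ?r"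
      using e by (auto simp del: o_apply)
  qed
  then have "num_classes S ?r = comps S \<sigma> \<tau>"
    unfolding comps_def by (rule num_classes_cong)
  moreover have "conn ?r `` {x} = linked \<sigma>' \<tau>' `` {x}" if "x \<in> T" for x
  proof (rule conn_class_cong[where A = T, OF _ _ _ _ that])
    fix a b
    show "(a, b) \<in> ?r \<Longrightarrow> a \<in> T \<longleftrightarrow> b \<in> T" by (rule rT)
    show "(a, b) \<in> graph_of \<sigma>' \<union> graph_of \<tau>' \<Longrightarrow> a \<in> T \<longleftrightarrow> b \<in> T"
      using permutes_in_image[OF s(2), of a] permutes_in_image[OF t(2), of a] by auto
    assume "a \<in> T"
    note e = T[OF this s] T[OF this t]
    show "(a, b) \<in> ?r \<Longrightarrow> (a, b) \<in> graph_of \<sigma>' \<union> graph_of \<tau>'" "(a, b) \<in> graph_of \<sigma>' \<union> graph_of \<tau>' \<Longrightarrow> (a, b) \<in> ?r"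
      using e by (auto simp del: o_apply)
  qed
  then have "num_classes T ?r = comps T \<sigma>' \<tau>'"
    unfolding comps_def by (rule num_classes_cong)
  ultimately show "comps (S \<union> T) (\<sigma> \<circ> \<sigma>') (\<tau> \<circ> \<tau>') = comps S \<sigma> \<tau> + comps T \<sigma>' \<tau>'"
    using num_classes_Un[OF fin disj, of ?r] rS by (simp add: comps_def)
qed

text \<open>All counts are additive over disjoint supports. The genus inequality holds on each part,
  so equality for the sum forces equality on both.\<close>

lemma planar_Un:
  assumes fin: "finite S" "finite T" and s: "\<sigma> permutes S" "\<sigma>' permutes T"
    and t: "\<tau> permutes S" "\<tau>' permutes T" and disj: "S \<inter> T = {}"
  shows "planar (S \<union> T) (\<sigma> \<circ> \<sigma>') (\<tau> \<circ> \<tau>') \<longleftrightarrow> planar S \<sigma> \<tau> \<and> planar T \<sigma>' \<tau>'"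
proof -
  have "inv (\<sigma> \<circ> \<sigma>') \<circ> (\<tau> \<circ> \<tau>') = inv \<sigma>' \<circ> (inv \<sigma> \<circ> \<tau>) \<circ> \<tau>'"
    using permutes_bij[OF s(1)] permutes_bij[OF s(2)] by (simp add: o_inv_distrib o_assoc)
  also have "inv \<sigma>' \<circ> (inv \<sigma> \<circ> \<tau>) = (inv \<sigma> \<circ> \<tau>) \<circ> inv \<sigma>'"
    using disj by (intro comp_disjoint_commute[of _ T _ S] permutes_inv permutes_compose s t) auto
  finally have "inv (\<sigma> \<circ> \<sigma>') \<circ> (\<tau> \<circ> \<tau>') = (inv \<sigma> \<circ> \<tau>) \<circ> (inv \<sigma>' \<circ> \<tau>')"
    by (simp only: o_assoc)
  then have "num_cycles (S \<union> T) (inv (\<sigma> \<circ> \<sigma>') \<circ> (\<tau> \<circ> \<tau>')) =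
      num_cycles S (inv \<sigma> \<circ> \<tau>) + num_cycles T (inv \<sigma>' \<circ> \<tau>')"
    by (simp only:) (intro num_cycles_Un fin disj permutes_compose permutes_inv s t)
  then show ?thesis
    using num_cycles_Un[OF fin s disj] num_cycles_Un[OF fin t disj]
      comps_Un(1)[OF fin s t disj] card_Un_disjoint[OF fin disj]
      genus_nonneg[OF fin(1) s(1) t(1)] genus_nonneg[OF fin(2) s(2) t(2)]
    unfolding planar_def by linarith
qed

text \<open>An injection that maps the finite set \<open>S\<close> into itself permutes it, and
  hence also preserves the rest \<open>T\<close>.\<close>

lemma permutes_Un_decompose:
  assumes "finite S" "\<sigma> permutes S \<union> T" "S \<inter> T = {}" "\<And>x. x \<in> S \<Longrightarrow> \<sigma> x \<in> S"
  obtains \<sigma>1 \<sigma>2 where "\<sigma>1 permutes S" "\<sigma>2 permutes T" "\<sigma> = \<sigma>1 \<circ> \<sigma>2"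
proof -
  define \<sigma>1 where "\<sigma>1 = (\<lambda>x. if x \<in> S then \<sigma> x else x)"
  define \<sigma>2 where "\<sigma>2 = (\<lambda>x. if x \<in> T then \<sigma> x else x)"
  have inj: "inj \<sigma>" using assms(2) by (rule permutes_inj)
  have imS: "\<sigma> ` S = S"
    using assms(1,4) inj by (metis card_image card_subset_eq image_subsetI inj_on_subset subset_UNIV)
  have T: "\<sigma> x \<in> T" if "x \<in> T" for x
  proof -
    have "\<sigma> x \<notin> S" using that imS inj assms(3) by (metis disjoint_iff inj_image_mem_iff)
    then show ?thesis using permutes_in_image[OF assms(2), of x] that by blast
  qed
  have imT: "\<sigma> ` T = T"
  proof
    show "T \<subseteq> \<sigma> ` T"
    proof
      fix y assume y: "y \<in> T"
      then have "y \<in> \<sigma> ` (S \<union> T)"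
        unfolding permutes_image[OF assms(2)] by simp
      then obtain x where x: "x \<in> S \<union> T" "y = \<sigma> x" by (rule imageE) auto
      have "x \<notin> S" using y assms(3) assms(4)[of x] x(2) by auto
      then show "y \<in> \<sigma> ` T" using x by auto
    qed
    show "\<sigma> ` T \<subseteq> T" using T by auto
  qed
  have 1: "\<sigma>1 permutes S"
  proof (rule bij_imp_permutes)
    have "bij_betw \<sigma> S S"
      unfolding bij_betw_def using inj_on_subset[OF inj] imS by simp
    then show "bij_betw \<sigma>1 S S"
      by (rule bij_betw_cong[THEN iffD1, rotated]) (simp add: \<sigma>1_def)
  qed (simp add: \<sigma>1_def)
  have 2: "\<sigma>2 permutes T"
  proof (rule bij_imp_permutes)
    have "bij_betw \<sigma> T T"
      unfolding bij_betw_def using inj_on_subset[OF inj] imT by simp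
    then show "bij_betw \<sigma>2 T T"
      by (rule bij_betw_cong[THEN iffD1, rotated]) (simp add: \<sigma>2_def)
  qed (simp add: \<sigma>2_def)
  have "\<sigma> = \<sigma>1 \<circ> \<sigma>2"
  proof
    fix x
    show "\<sigma> x = (\<sigma>1 \<circ> \<sigma>2) x"
      using T[of x] assms(3) permutes_not_in[OF assms(2), of x]
      by (cases "x \<in> T"; cases "x \<in> S") (auto simp: \<sigma>1_def \<sigma>2_def)
  qed
  with 1 2 show ?thesis by (rule that)
qed

lemma planar_id_singleton: "planar {a} id id" "comps {a} id id = 1"
  using comps_id[of "{a}" id] num_cycles_id[of "{a}"] by (simp_all add: planar_def)

text \<open>An isolated point adds 3 to the left side of the planarity equation, as a cycle, a face
  and a boundary, and 1 + 2 to the right side.\<close>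

lemma planar_remove:
  assumes "finite S" "a \<notin> S" "\<sigma> permutes S" "\<tau> permutes S"
  shows "planar (insert a S) \<sigma> \<tau> \<longleftrightarrow> planar S \<sigma> \<tau>"
    and "comps (insert a S) \<sigma> \<tau> = comps S \<sigma> \<tau> + 1"
proof -
  have *: "finite {a}" "finite S" "id permutes {a}" "\<sigma> permutes S" "id permutes {a}" "\<tau> permutes S"
    "{a} \<inter> S = {}" using assms by auto
  show "planar (insert a S) \<sigma> \<tau> \<longleftrightarrow> planar S \<sigma> \<tau>"
    using planar_Un[OF *] planar_id_singleton by simp
  show "comps (insert a S) \<sigma> \<tau> = comps S \<sigma> \<tau> + 1"
    using comps_Un(1)[OF *] planar_id_singleton by simp
qed

lemma linked_isolated:
  assumes "inj \<sigma>" "inj \<tau>" "\<sigma> a = a" "\<tau> a = a" "(a, b) \<in> linked \<sigma> \<tau>"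
  shows "b = a"
proof -
  have "x \<in> {a} \<longleftrightarrow> y \<in> {a}" if "(x, y) \<in> graph_of \<sigma> \<union> graph_of \<tau>" for x y
  proof -
    have "y = \<sigma> x \<or> y = \<tau> x" using that by auto
    then show ?thesis using assms(1-4) by (metis injD singleton_iff)
  qed
  from conn_closed[OF assms(5), of "{a}", OF this] show ?thesis by simp
qed

text \<open>Isolating a fixed point \<open>a\<close> of \<sigma> from its boundary also makes
  \<open>a\<close> a face of its own. One boundary, one face and one component are gained, that is,
  2 on each side.\<close>

lemma planar_fix:
  assumes fin: "finite S" and p: "\<sigma> permutes S" "\<tau> permutes S" and a: "a \<in> S" "\<sigma> a = a" "\<tau> a \<noteq> a"
  shows "planar S \<sigma> (transpose a (\<tau> a) \<circ> \<tau>) \<longleftrightarrow> planar S \<sigma> \<tau>"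
    and "comps S \<sigma> (transpose a (\<tau> a) \<circ> \<tau>) = comps S \<sigma> \<tau> + 1"
proof -
  define b where "b = \<tau> a"
  have b: "b \<in> S" "a \<noteq> b" using a permutes_in_image[OF p(2)] by (auto simp: b_def)
  have cab: "(a, b) \<in> conn (graph_of \<tau>)" unfolding b_def by (rule conn_graph_step)
  have p1: "transpose a b \<circ> \<tau> permutes S" by (intro permutes_transpose_comp p a b)
  have fixa: "(transpose a b \<circ> \<tau>) a = a" by (simp add: b_def)
  have "(a, b) \<notin> linked \<sigma> (transpose a b \<circ> \<tau>)"
    using linked_isolated[OF permutes_inj[OF p(1)] permutes_inj[OF p1] a(2) fixa] b by blast
  moreover have "conn (insert (a, b) (graph_of \<sigma> \<union> graph_of (transpose a b \<circ> \<tau>))) =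
      conn (insert (a, b) (graph_of \<sigma> \<union> graph_of \<tau>))"
    using conn_insert_swap[of a b \<tau> "graph_of \<sigma>"] by (simp add: Un_commute)
  ultimately show k: "comps S \<sigma> (transpose a (\<tau> a) \<circ> \<tau>) = comps S \<sigma> \<tau> + 1"
    using comps_transpose[OF fin a(1) b(1) linked_mono2[OF cab, of \<sigma>], of \<sigma> "transpose a b \<circ> \<tau>"]
    by (simp add: b_def)
  have n: "num_cycles S (transpose a b \<circ> \<tau>) = num_cycles S \<tau> + 1"
    by (rule num_cycles_transpose(1)[OF fin p(2) a(1) b cab])
  have \<phi>p: "inv \<sigma> \<circ> \<tau> permutes S" by (intro permutes_compose permutes_inv p)
  have inva: "inv \<sigma> a = a" using a(2) p(1) by (metis permutes_inv_eq)
  define c where "c = inv \<sigma> b"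
  have c: "c \<in> S" "a \<noteq> c"
    using b permutes_in_image[OF permutes_inv[OF p(1)]] inva
      permutes_inj[OF permutes_inv[OF p(1)]] by (auto simp: c_def dest: injD)
  have "inv \<sigma> \<circ> (transpose a b \<circ> \<tau>) = transpose a c \<circ> (inv \<sigma> \<circ> \<tau>)"
    using comp_transpose[OF permutes_inj[OF permutes_inv[OF p(1)]], of a b]
    by (simp add: o_assoc inva c_def)
  moreover have "(a, c) \<in> conn (graph_of (inv \<sigma> \<circ> \<tau>))"
    using conn_graph_step[of a "inv \<sigma> \<circ> \<tau>"] by (simp add: c_def b_def)
  ultimately have "num_cycles S (inv \<sigma> \<circ> (transpose a b \<circ> \<tau>)) = num_cycles S (inv \<sigma> \<circ> \<tau>) + 1"
    using num_cycles_transpose(1)[OF fin \<phi>p a(1) c] by simp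
  then show "planar S \<sigma> (transpose a (\<tau> a) \<circ> \<tau>) \<longleftrightarrow> planar S \<sigma> \<tau>"
    using n k unfolding planar_def b_def by simp
qed

section \<open>Planar permutations of a disc and of an annulus\<close>

abbreviation cyc :: "nat list \<Rightarrow> nat \<Rightarrow> nat" where
  "cyc \<equiv> cycle_of_list"

text \<open>The boundary is a list rather than an interval because the recursions pass to arcs of it
  and to merged boundaries.\<close>

definition disc_perms :: "nat list \<Rightarrow> (nat \<Rightarrow> nat) set" where
  "disc_perms xs = {\<sigma>. \<sigma> permutes set xs \<and> planar (set xs) \<sigma> (cyc xs)}"

text \<open>Connectedness stands in for the existence of a through cycle; the two agree by
  \<open>comps_eq_1_iff_through\<close>. The conditions on empty lists keep the disc permutations of
  \<open>ys\<close> from appearing as annular ones for \<open>xs = []\<close>.\<close>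

definition annular_perms :: "nat list \<Rightarrow> nat list \<Rightarrow> (nat \<Rightarrow> nat) set" where
  "annular_perms xs ys =
     {\<sigma>. xs \<noteq> [] \<and> ys \<noteq> [] \<and> \<sigma> permutes set xs \<union> set ys \<and>
          planar (set xs \<union> set ys) \<sigma> (cyc xs \<circ> cyc ys) \<and>
          comps (set xs \<union> set ys) \<sigma> (cyc xs \<circ> cyc ys) = 1}"

lemma cyc_conn:
  assumes "distinct xs" "x \<in> set xs" "y \<in> set xs"
  shows "(x, y) \<in> conn (graph_of (cyc xs))"
proof -
  have "(hd xs, y) \<in> conn (graph_of (cyc xs))" if "y \<in> set xs" for y
    using assms(1) that
  proof (induction xs arbitrary: y rule: cycle_of_list.induct)
    case (1 i j cs)
    let ?f = "cyc (j # cs)"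
    have ij: "i \<noteq> j" "?f i = i" using 1 by (auto simp: id_outside_supp)
    have perm: "?f permutes set (i # j # cs)"
      by (rule permutes_subset[OF cycle_permutes]) auto
    have "(i, j) \<notin> conn (graph_of ?f)"
      using linked_isolated[of ?f ?f i j] permutes_inj[OF perm] ij by auto
    then have con: "(i, j) \<in> conn (graph_of (transpose i j \<circ> ?f))"
      using transpose_connects_or[OF _ perm] ij by auto
    show ?case
    proof (cases "y = i")
      case False
      then have "(j, y) \<in> conn (graph_of ?f)" using 1 by auto
      then have "(j, y) \<in> conn (insert (i, j) (graph_of ?f))" by (rule conn_mono') auto
      then have "(j, y) \<in> conn (insert (i, j) (graph_of (transpose i j \<circ> ?f)))"
        using conn_insert_swap[of i j ?f "{}"] by simp
      then have "(j, y) \<in> conn (graph_of (transpose i j \<circ> ?f))"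
        using con unfolding conn_insert by (metis conn_sym conn_trans)
      then have "(i, y) \<in> conn (graph_of (transpose i j \<circ> ?f))"
        using con conn_trans by metis
      then show ?thesis by (simp only: cycle_of_list.simps list.sel)
    qed simp
  qed auto
  from this[OF assms(2)] this[OF assms(3)] show ?thesis by (metis conn_sym conn_trans)
qed

lemma cyc_conn_left:
  assumes "distinct xs" "x \<in> set xs" "y \<in> set xs" "f permutes T" "finite T" "set xs \<inter> T = {}"
  shows "(x, y) \<in> conn (graph_of (cyc xs \<circ> f))"
proof -
  have "cyc xs \<circ> f permutes set xs \<union> T"
    by (intro permutes_compose permutes_subset[OF assms(4)] permutes_subset[OF cycle_permutes]) auto
  then have p: "permutation (cyc xs \<circ> f)"
    using assms(5) by (intro permutes_permutation[of "set xs \<union> T"]) auto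
  have "y \<in> orbit (cyc xs) x"
    unfolding orbit_eq_conn[OF permutation_of_cycle] using cyc_conn[OF assms(1-3)] by simp
  then have "y \<in> orbit (cyc xs \<circ> f) x"
    using orbit_comp_disjoint[OF cycle_permutes assms(4,6,2)] by simp
  then show ?thesis using orbit_eq_conn[OF p] by simp
qed

lemma cyc_permutes: "set xs = S \<Longrightarrow> cyc xs permutes S"
  using cycle_permutes by blast

lemma num_cycles_cyc:
  assumes "distinct xs" "xs \<noteq> []"
  shows "num_cycles (set xs) (cyc xs) = 1"
proof -
  have "hd xs \<in> set xs" using assms(2) by simp
  then show ?thesis
    using cyc_conn[OF assms(1)] num_classes_eq_1_iff[of "set xs" "hd xs" "graph_of (cyc xs)"]
      num_cycles_eq_classes[OF _ cycle_permutes, of xs] by simp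
qed

lemma comps_cyc:
  assumes "distinct xs" "xs \<noteq> []"
  shows "comps (set xs) \<sigma> (cyc xs) = 1"
proof -
  have "hd xs \<in> set xs" using assms(2) by simp
  then show ?thesis
    unfolding comps_def
    using cyc_conn[OF assms(1)] linked_mono2 num_classes_eq_1_iff[of "set xs" "hd xs"] by blast
qed

text \<open>Read backwards: multiplying the boundary by (a c) cuts it into the arcs that start at
  \<open>a\<close> and at \<open>c\<close>. The induction step rests on (a c)(a b) = (a b)(b
  c).\<close>

lemma cyc_append:
  assumes "distinct (a # g @ c # r)"
  shows "transpose a c \<circ> (cyc (a # g) \<circ> cyc (c # r)) = cyc (a # g @ c # r)"
  using assms
proof (induction g arbitrary: a)
  case (Cons b g)
  have "transpose a c \<circ> transpose a b = transpose a b \<circ> transpose b c"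
    using Cons.prems by (auto simp: fun_eq_iff transpose_def)
  then have "transpose a c \<circ> (cyc (a # b # g) \<circ> cyc (c # r)) =
      transpose a b \<circ> (transpose b c \<circ> (cyc (b # g) \<circ> cyc (c # r)))"
    by (simp only: cycle_of_list.simps o_assoc)
  also have "transpose b c \<circ> (cyc (b # g) \<circ> cyc (c # r)) = cyc (b # g @ c # r)"
    using Cons.prems by (intro Cons.IH) auto
  also have "transpose a b \<circ> cyc (b # g @ c # r) = cyc (a # (b # g) @ c # r)"
    by simp
  finally show ?case .
qed simp

lemma cyc_rotate: "distinct (xs @ ys) \<Longrightarrow> cyc (xs @ ys) = cyc (ys @ xs)"
  using cycle_of_list_rotate_independent[of "xs @ ys" "length xs"] by (simp add: rotate_append)

lemma disc_perms_rotate: "distinct (xs @ ys) \<Longrightarrow> disc_perms (xs @ ys) = disc_perms (ys @ xs)"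
  by (simp add: disc_perms_def cyc_rotate[of xs ys] Un_commute)

section \<open>Removing, splitting and merging at a marked point\<close>

lemma permutes_insert_fix:
  assumes "a \<notin> S"
  shows "\<sigma> permutes insert a S \<and> \<sigma> a = a \<longleftrightarrow> \<sigma> permutes S"
proof
  assume "\<sigma> permutes insert a S \<and> \<sigma> a = a"
  then have p: "\<sigma> permutes insert a S" "\<sigma> a = a" by simp_all
  show "\<sigma> permutes S"
    by (rule permutes_superset[OF p(1)]) (use p(2) in auto)
next
  assume "\<sigma> permutes S"
  then show "\<sigma> permutes insert a S \<and> \<sigma> a = a"
    using permutes_subset[of \<sigma> S "insert a S"] permutes_not_in[of \<sigma> S a] assms by blast
qed

lemma planar_fix_remove:
  assumes fin: "finite S" and a: "a \<notin> S" and p: "\<sigma> permutes S" "\<tau> permutes insert a S"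
    and "\<tau> a \<noteq> a"
  shows "planar (insert a S) \<sigma> \<tau> \<longleftrightarrow> planar S \<sigma> (transpose a (\<tau> a) \<circ> \<tau>)"
    and "comps (insert a S) \<sigma> \<tau> = comps S \<sigma> (transpose a (\<tau> a) \<circ> \<tau>)"
proof -
  let ?\<tau> = "transpose a (\<tau> a) \<circ> \<tau>"
  have p1: "\<sigma> permutes insert a S" "\<sigma> a = a" using permutes_insert_fix[OF a] p(1) by auto
  have "?\<tau> permutes insert a S"
    using permutes_in_image[OF p(2)] by (intro permutes_transpose_comp p(2)) auto
  moreover have "?\<tau> a = a" by simp
  ultimately have p2: "?\<tau> permutes S" using permutes_insert_fix[OF a] by blast
  note f = planar_fix[OF _ p1(1) p(2) _ p1(2) assms(5)] planar_remove[OF fin a p(1) p2]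
  show "planar (insert a S) \<sigma> \<tau> \<longleftrightarrow> planar S \<sigma> ?\<tau>"
    and "comps (insert a S) \<sigma> \<tau> = comps S \<sigma> ?\<tau>"
    using f fin by simp_all
qed

lemma transpose_cyc_Cons2: "transpose a b \<circ> (cyc (a # b # g) \<circ> f) = cyc (b # g) \<circ> f"
  by (simp add: fun_eq_iff)

lemma cyc_Cons2_apply: "distinct (a # b # g) \<Longrightarrow> cyc (a # b # g) a = b"
  by (auto simp: id_outside_supp)

lemma disc_perms_fix:
  assumes "distinct (a # g)"
  shows "{\<sigma> \<in> disc_perms (a # g). \<sigma> a = a} = disc_perms g"
proof -
  have a: "a \<notin> set g" using assms by simp
  have "planar (insert a (set g)) \<sigma> (cyc (a # g)) \<longleftrightarrow> planar (set g) \<sigma> (cyc g)"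
    if "\<sigma> permutes set g" for \<sigma>
  proof (cases g)
    case Nil
    then have "\<sigma> = id" using that by simp
    then show ?thesis
      using Nil planar_id_singleton planar_remove(1)[of "{}" a id id] by simp
  next
    case (Cons b g')
    then have "cyc (a # g) a = b" using assms cyc_Cons2_apply by metis
    moreover have "b \<noteq> a" using assms Cons by auto
    moreover have "transpose a b \<circ> cyc (a # g) = cyc g"
      using transpose_cyc_Cons2[of a b g' id] Cons by simp
    ultimately show ?thesis
      using planar_fix_remove(1)[OF _ a that, of "cyc (a # g)"] by (simp add: cyc_permutes)
  qed
  then show ?thesis
    using permutes_insert_fix[OF a] unfolding disc_perms_def by auto
qed

lemma annular_perms_fix:
  assumes "distinct (a # g @ ys)"
  shows "{\<sigma> \<in> annular_perms (a # g) ys. \<sigma> a = a} = annular_perms g ys"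
proof -
  have a: "a \<notin> set g \<union> set ys" using assms by simp
  have cya: "cyc ys a = a" using a by (intro id_outside_supp) auto
  show ?thesis
  proof (cases g)
    case Nil
    \<comment> \<open>A first boundary that consists only of the fixed point \<open>a\<close> would
      be a component of its own, against connectedness.\<close>
    have False if \<sigma>: "\<sigma> \<in> annular_perms [a] ys" "\<sigma> a = a" for \<sigma>
    proof -
      obtain y where y: "y \<in> set ys" using \<sigma> by (cases ys) (auto simp: annular_perms_def)
      have p: "\<sigma> permutes insert a (set ys)" "cyc ys permutes insert a (set ys)"
        using \<sigma> by (auto simp: annular_perms_def intro: permutes_subset[OF cycle_permutes])
      have "comps (insert a (set ys)) \<sigma> (cyc ys) = 1" using \<sigma> by (simp add: annular_perms_def)
      then have "(a, y) \<in> linked \<sigma> (cyc ys)"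
        using num_classes_eq_1_iff[of "insert a (set ys)" a] y by (simp add: comps_def)
      then have "y = a"
        using linked_isolated[OF permutes_inj[OF p(1)] permutes_inj[OF p(2)] \<sigma>(2) cya] by simp
      then show False using y a by simp
    qed
    then show ?thesis using Nil by (auto simp: annular_perms_def)
  next
    case (Cons b g')
    let ?\<tau> = "cyc (a # g) \<circ> cyc ys"
    have "cyc (a # g) a = b" using assms Cons cyc_Cons2_apply[of a b g'] by simp
    then have "?\<tau> a = b" using cya by simp
    moreover have "b \<noteq> a" using assms Cons by auto
    moreover have "transpose a b \<circ> ?\<tau> = cyc g \<circ> cyc ys"
      using transpose_cyc_Cons2[of a b g' "cyc ys"] Cons by simp
    moreover have "?\<tau> permutes insert a (set g \<union> set ys)"
      by (intro permutes_compose permutes_subset[OF cycle_permutes]) auto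
    ultimately have "(planar (insert a (set g \<union> set ys)) \<sigma> ?\<tau> \<longleftrightarrow> planar (set g \<union> set ys) \<sigma> (cyc g \<circ> cyc ys)) \<and>
        comps (insert a (set g \<union> set ys)) \<sigma> ?\<tau> = comps (set g \<union> set ys) \<sigma> (cyc g \<circ> cyc ys)"
      if "\<sigma> permutes set g \<union> set ys" for \<sigma>
      using planar_fix_remove[OF _ a that, of ?\<tau>] by simp
    note e = this
    have "\<sigma> \<in> annular_perms (a # g) ys \<and> \<sigma> a = a \<longleftrightarrow> \<sigma> \<in> annular_perms g ys" for \<sigma>
    proof (cases "\<sigma> permutes set g \<union> set ys")
      case True
      then show ?thesis
        using e[OF True] permutes_insert_fix[OF a, of \<sigma>] Cons unfolding annular_perms_def by (simp del: o_apply cycle_of_list.simps)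
    next
      case False
      then show ?thesis
        using permutes_insert_fix[OF a, of \<sigma>] by (simp add: annular_perms_def del: cycle_of_list.simps)
    qed
    then show ?thesis by blast
  qed
qed

lemma comp_disjoint_inj:
  assumes "f permutes S" "f' permutes S" "g permutes T" "g' permutes T" "S \<inter> T = {}"
    and "f \<circ> g = f' \<circ> g'"
  shows "f = f'" "g = g'"
proof -
  have "f x = f' x" for x
  proof (cases "x \<in> S")
    case True
    then have "g x = x" "g' x = x" using assms by (auto intro: permutes_not_in)
    then show ?thesis using fun_cong[OF assms(6), of x] by simp
  qed (use assms permutes_not_in in metis)
  then show "f = f'" by auto
  then show "g = g'"
    using assms(6) permutes_inj[OF assms(1)] by (metis comp_apply ext injD)
qed

lemma transpose_comp_cancel: "transpose a c \<circ> f = transpose a c \<circ> g \<Longrightarrow> f = g"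
  by (metis transpose_twice)

lemma inj_on_glue:
  assumes "\<And>\<sigma>. \<sigma> \<in> A \<Longrightarrow> \<sigma> permutes S" "\<And>\<sigma>. \<sigma> \<in> B \<Longrightarrow> \<sigma> permutes T" "S \<inter> T = {}"
  shows "inj_on (\<lambda>(\<sigma>1, \<sigma>2). transpose a c \<circ> (\<sigma>1 \<circ> \<sigma>2)) (A \<times> B)"
proof (rule inj_onI, clarify)
  fix f g f' g'
  assume m: "f \<in> A" "g \<in> B" "f' \<in> A" "g' \<in> B"
    and eq: "transpose a c \<circ> (f \<circ> g) = transpose a c \<circ> (f' \<circ> g')"
  from transpose_comp_cancel[OF eq]
  show "f = f' \<and> g = g'"
    using comp_disjoint_inj[OF assms(1)[OF m(1)] assms(1)[OF m(3)] assms(2)[OF m(2)] assms(2)[OF m(4)] assms(3)]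
    by simp
qed

text \<open>Every arrow of \<sigma> stays inside a component, and \<open>S\<close> and
  \<open>T\<close> lie in different components, those of \<open>a\<close> and of
  \<open>c\<close>.\<close>

lemma cut_preserves:
  assumes "finite S" "\<sigma> permutes S \<union> T" "S \<inter> T = {}"
    and "\<And>x. x \<in> S \<Longrightarrow> (a, x) \<in> linked \<sigma> \<tau>" "\<And>x. x \<in> T \<Longrightarrow> (c, x) \<in> linked \<sigma> \<tau>"
    and "(a, c) \<notin> linked \<sigma> \<tau>"
  obtains \<sigma>1 \<sigma>2 where "\<sigma>1 permutes S" "\<sigma>2 permutes T" "\<sigma> = \<sigma>1 \<circ> \<sigma>2"
proof (rule permutes_Un_decompose[OF assms(1-3)])
  fix x assume x: "x \<in> S"
  have "(a, \<sigma> x) \<in> linked \<sigma> \<tau>" using assms(4)[OF x] linked_step1 conn_trans by metis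
  then have "\<sigma> x \<notin> T" using assms(5,6) conn_trans conn_sym by metis
  then show "\<sigma> x \<in> S" using permutes_in_image[OF assms(2), of x] x by auto
qed

text \<open>By \<open>planar_split\<close> the arrow from \<open>a\<close> to \<open>c\<close> cuts
  the disc into two discs; in the first one \<open>a\<close> has become a fixed point and is dropped
  by \<open>disc_perms_fix\<close>. Conversely, \<open>planar_unsplit\<close> glues any two such
  pieces.\<close>

lemma disc_perms_split:
  assumes d: "distinct (a # g @ c # r)"
  shows "{\<sigma> \<in> disc_perms (a # g @ c # r). \<sigma> a = c} =
    (\<lambda>(\<sigma>1, \<sigma>2). transpose a c \<circ> (\<sigma>1 \<circ> \<sigma>2)) ` (disc_perms g \<times> disc_perms (c # r))"
    (is "?L = ?\<Phi> ` _")
proof -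
  define S1 S2 where "S1 = set (a # g)" and "S2 = set (c # r)"
  have S: "set (a # g @ c # r) = S1 \<union> S2" "S1 \<inter> S2 = {}" "finite S1" "finite S2"
    using d by (auto simp: S1_def S2_def)
  have ac: "a \<in> S1 \<union> S2" "c \<in> S1 \<union> S2" "a \<noteq> c" "a \<in> S1" "c \<in> S2" using d by (auto simp: S1_def S2_def)
  let ?\<tau> = "cyc (a # g @ c # r)" and ?\<tau>1 = "cyc (a # g)" and ?\<tau>2 = "cyc (c # r)"
  have t: "?\<tau>1 permutes S1" "?\<tau>2 permutes S2"
    unfolding S1_def S2_def by (rule cycle_permutes)+
  have t: "?\<tau>1 permutes S1" "?\<tau>2 permutes S2" "?\<tau> permutes S1 \<union> S2"
    using t cycle_permutes[of "a # g @ c # r"] unfolding S(1) by simp_all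
  have dd: "distinct (a # g)" "distinct (c # r)" using d by auto
  have \<tau>0: "transpose a c \<circ> ?\<tau> = ?\<tau>1 \<circ> ?\<tau>2"
    using cyc_append[OF d] transpose_twice by metis
  have \<tau>: "transpose a c \<circ> (?\<tau>1 \<circ> ?\<tau>2) = ?\<tau>" by (rule cyc_append[OF d])
  show ?thesis
  proof (intro equalityI subsetI)
    fix \<sigma> assume "\<sigma> \<in> ?L"
    then have \<sigma>: "\<sigma> permutes S1 \<union> S2" "planar (S1 \<union> S2) \<sigma> ?\<tau>" "\<sigma> a = c"
      using S(1) by (auto simp: disc_perms_def)
    define \<sigma>0 where "\<sigma>0 = transpose a c \<circ> \<sigma>"
    have c1: "(a, c) \<in> conn (graph_of \<sigma>)" using conn_graph_step[of a \<sigma>] \<sigma>(3) by simp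
    have c2: "(a, c) \<in> conn (graph_of ?\<tau>)" by (rule cyc_conn[OF d]) auto
    note sp = planar_split[OF _ \<sigma>(1) t(3) ac(1-3) c1 c2 \<sigma>(2), folded \<sigma>0_def, unfolded \<tau>0]
    have p0: "\<sigma>0 permutes S1 \<union> S2" unfolding \<sigma>0_def by (intro permutes_transpose_comp \<sigma> ac)
    have l1: "(a, x) \<in> linked \<sigma>0 (?\<tau>1 \<circ> ?\<tau>2)" if "x \<in> S1" for x
      using cyc_conn_left[OF dd(1) _ _ t(2), of a x] S that by (intro linked_mono2) (auto simp: S1_def)
    have l2: "(c, x) \<in> linked \<sigma>0 (?\<tau>1 \<circ> ?\<tau>2)" if "x \<in> S2" for x
      unfolding comp_disjoint_commute[OF t(1,2) S(2)]
      using cyc_conn_left[OF dd(2) _ _ t(1), of c x] S that by (intro linked_mono2) (auto simp: S2_def)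
    obtain \<sigma>1 \<sigma>2 where s: "\<sigma>1 permutes S1" "\<sigma>2 permutes S2" "\<sigma>0 = \<sigma>1 \<circ> \<sigma>2"
      using cut_preserves[OF S(3) p0 S(2) l1 l2 sp(3)] S by auto
    have "\<sigma>2 a = a" using permutes_not_in[OF s(2)] S ac by blast
    then have fa: "\<sigma>1 a = a" using s(3) \<sigma>(3) by (metis \<sigma>0_def comp_apply transpose_apply_second)
    have "planar S1 \<sigma>1 ?\<tau>1" "planar S2 \<sigma>2 ?\<tau>2"
      using sp(1) S planar_Un[OF S(3,4) s(1,2) t(1,2) S(2)] by (simp_all add: s(3))
    then have "\<sigma>1 \<in> disc_perms g" "\<sigma>2 \<in> disc_perms (c # r)"
      using s(1,2) fa disc_perms_fix[OF dd(1)] by (auto simp: disc_perms_def S1_def S2_def)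
    moreover have "\<sigma> = ?\<Phi> (\<sigma>1, \<sigma>2)"
      using s(3) by (simp add: \<sigma>0_def) (metis transpose_twice)
    ultimately show "\<sigma> \<in> ?\<Phi> ` (disc_perms g \<times> disc_perms (c # r))" by blast
  next
    fix \<sigma> assume "\<sigma> \<in> ?\<Phi> ` (disc_perms g \<times> disc_perms (c # r))"
    then obtain \<sigma>1 \<sigma>2 where s: "\<sigma>1 \<in> disc_perms g" "\<sigma>2 \<in> disc_perms (c # r)"
      "\<sigma> = transpose a c \<circ> (\<sigma>1 \<circ> \<sigma>2)" by auto
    then have "\<sigma>1 \<in> disc_perms (a # g)" and fa: "\<sigma>1 a = a" using disc_perms_fix[OF dd(1)] by auto
    with s have p: "\<sigma>1 permutes S1" "\<sigma>2 permutes S2" "planar S1 \<sigma>1 ?\<tau>1" "planar S2 \<sigma>2 ?\<tau>2"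
      by (auto simp: disc_perms_def S1_def S2_def)
    have P: "planar (S1 \<union> S2) (\<sigma>1 \<circ> \<sigma>2) (?\<tau>1 \<circ> ?\<tau>2)"
      using planar_Un[OF S(3,4) p(1,2) t(1,2) S(2)] p by simp
    have nl: "(a, c) \<notin> linked (\<sigma>1 \<circ> \<sigma>2) (?\<tau>1 \<circ> ?\<tau>2)"
      using comps_Un(2)[OF S(3,4) p(1,2) t(1,2) S(2)] ac by blast
    have p12: "\<sigma>1 \<circ> \<sigma>2 permutes S1 \<union> S2" "?\<tau>1 \<circ> ?\<tau>2 permutes S1 \<union> S2"
      using p t by (auto intro!: permutes_compose intro: permutes_subset)
    have "planar (S1 \<union> S2) \<sigma> ?\<tau>"
      using planar_unsplit(1)[OF _ p12 ac(1-3) nl P] S(3,4) unfolding s(3) \<tau> by simp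
    moreover have "\<sigma> permutes S1 \<union> S2"
      unfolding s(3) by (intro permutes_transpose_comp p12 ac)
    moreover have "\<sigma>2 a = a" using permutes_not_in[OF p(2)] S ac by blast
    ultimately show "\<sigma> \<in> ?L"
      unfolding disc_perms_def S(1) using fa by (simp add: s(3))
  qed
qed

lemma disc_perms_permutes: "\<sigma> \<in> disc_perms xs \<Longrightarrow> \<sigma> permutes set xs"
  by (simp add: disc_perms_def)

lemma annular_perms_permutes: "\<sigma> \<in> annular_perms xs ys \<Longrightarrow> \<sigma> permutes set xs \<union> set ys"
  by (simp add: annular_perms_def)

lemma cyc_conn_comp:
  assumes "distinct xs" "x \<in> set xs" "y \<in> set xs" "f permutes T" "finite T" "set xs \<inter> T = {}"
  shows "(x, y) \<in> linked \<sigma> (cyc xs \<circ> f)" "(x, y) \<in> linked \<sigma> (f \<circ> cyc xs)"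
  using linked_mono2[OF cyc_conn_left[OF assms], of \<sigma>]
  unfolding comp_disjoint_commute[OF cycle_permutes assms(4,6)] by simp_all

text \<open>As for the disc, but the second boundary stays attached to one of the two pieces: to
  that of \<open>c\<close> in the first image, to that of \<open>a\<close> in the second.\<close>

lemma annular_perms_split:
  assumes d: "distinct (a # g @ c # r @ ys)"
  shows "{\<sigma> \<in> annular_perms (a # g @ c # r) ys. \<sigma> a = c} =
    (\<lambda>(\<sigma>1, \<sigma>2). transpose a c \<circ> (\<sigma>1 \<circ> \<sigma>2)) ` (disc_perms g \<times> annular_perms (c # r) ys) \<union>
    (\<lambda>(\<sigma>1, \<sigma>2). transpose a c \<circ> (\<sigma>1 \<circ> \<sigma>2)) ` (annular_perms g ys \<times> disc_perms (c # r))"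
    (is "?L = ?\<Phi> ` ?A \<union> _ ` ?B")
proof -
  define S1 S2 Y where "S1 = set (a # g)" and "S2 = set (c # r)" and "Y = set ys"
  have S: "set (a # g @ c # r) \<union> set ys = S1 \<union> S2 \<union> Y" "S1 \<inter> S2 = {}" "S1 \<inter> Y = {}" "S2 \<inter> Y = {}"
    "finite S1" "finite S2" "finite Y"
    using d by (auto simp: S1_def S2_def Y_def)
  have D: "S1 \<inter> (S2 \<union> Y) = {}" "(S1 \<union> Y) \<inter> S2 = {}" "finite (S2 \<union> Y)" "finite (S1 \<union> Y)"
    "finite (S1 \<union> S2 \<union> Y)" "S1 \<union> (S2 \<union> Y) = S1 \<union> S2 \<union> Y" "(S1 \<union> Y) \<union> S2 = S1 \<union> S2 \<union> Y"
    using S by auto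
  have ac: "a \<in> S1 \<union> S2 \<union> Y" "c \<in> S1 \<union> S2 \<union> Y" "a \<noteq> c" "a \<in> S1" "c \<in> S2"
    using d by (auto simp: S1_def S2_def)
  define t t1 t2 ty where "t = cyc (a # g @ c # r)" and "t1 = cyc (a # g)" and "t2 = cyc (c # r)"
    and "ty = cyc ys"
  have p: "t1 permutes S1" "t2 permutes S2" "ty permutes Y"
    unfolding S1_def S2_def Y_def t1_def t2_def ty_def by (rule cycle_permutes)+
  have pt: "t permutes S1 \<union> S2"
    using cycle_permutes[of "a # g @ c # r"] by (simp add: t_def S1_def S2_def Un_insert_left Un_insert_right insert_commute)
  have P: "t1 \<circ> ty permutes S1 \<union> Y" "t2 \<circ> ty permutes S2 \<union> Y" "t \<circ> ty permutes S1 \<union> S2 \<union> Y"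
    by (intro permutes_compose permutes_subset[OF p(1)] permutes_subset[OF p(2)]
        permutes_subset[OF p(3)] permutes_subset[OF pt]; auto)+
  have dd: "distinct (a # g)" "distinct (c # r)" "distinct ys" "distinct (a # g @ c # r)"
    "distinct (a # g @ ys)" using d by auto
  have \<tau>: "transpose a c \<circ> (t1 \<circ> (t2 \<circ> ty)) = t \<circ> ty"
    using cyc_append[OF dd(4)] unfolding t1_def t2_def t_def by (metis o_assoc)
  have comm: "t1 \<circ> (t2 \<circ> ty) = (t1 \<circ> ty) \<circ> t2"
    using comp_disjoint_commute[OF p(2,3) S(4)] by (simp add: o_assoc)
  have \<tau>0: "transpose a c \<circ> (t \<circ> ty) = t1 \<circ> (t2 \<circ> ty)"
    unfolding \<tau>[symmetric] by (rule transpose_twice)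
  have in1: "\<sigma> \<in> annular_perms (a # g @ c # r) ys \<longleftrightarrow> ys \<noteq> [] \<and> \<sigma> permutes S1 \<union> S2 \<union> Y \<and>
      planar (S1 \<union> S2 \<union> Y) \<sigma> (t \<circ> ty) \<and> comps (S1 \<union> S2 \<union> Y) \<sigma> (t \<circ> ty) = 1" for \<sigma>
    unfolding annular_perms_def S(1) t_def ty_def by simp
  have in2: "\<sigma> \<in> annular_perms (c # r) ys \<longleftrightarrow> ys \<noteq> [] \<and> \<sigma> permutes S2 \<union> Y \<and>
      planar (S2 \<union> Y) \<sigma> (t2 \<circ> ty) \<and> comps (S2 \<union> Y) \<sigma> (t2 \<circ> ty) = 1" for \<sigma>
    unfolding annular_perms_def S2_def Y_def t2_def ty_def by simp
  have in3: "\<sigma> \<in> annular_perms g ys \<longleftrightarrow> ys \<noteq> [] \<and> \<sigma> permutes S1 \<union> Y \<and>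
      planar (S1 \<union> Y) \<sigma> (t1 \<circ> ty) \<and> comps (S1 \<union> Y) \<sigma> (t1 \<circ> ty) = 1 \<and> \<sigma> a = a" for \<sigma>
    unfolding annular_perms_fix[OF dd(5), symmetric]
    unfolding annular_perms_def S1_def Y_def t1_def ty_def by auto
  have in4: "\<sigma> \<in> disc_perms g \<longleftrightarrow> \<sigma> permutes S1 \<and> planar S1 \<sigma> t1 \<and> \<sigma> a = a" for \<sigma>
    unfolding disc_perms_fix[OF dd(1), symmetric] unfolding disc_perms_def S1_def t1_def by auto
  have in5: "\<sigma> \<in> disc_perms (c # r) \<longleftrightarrow> \<sigma> permutes S2 \<and> planar S2 \<sigma> t2" for \<sigma>
    unfolding disc_perms_def S2_def t2_def by auto
  have k: "comps S1 \<sigma> t1 = 1" "comps S2 \<sigma> t2 = 1" for \<sigma>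
    unfolding S1_def S2_def t1_def t2_def by (intro comps_cyc dd; simp)+
  have an: "a \<notin> S2" "a \<notin> Y" "a \<notin> S2 \<union> Y" using S(2,3) ac(4) by auto
  have fixa: "\<sigma> a = a" if "\<sigma> permutes S2 \<union> Y" for \<sigma>
    by (rule permutes_not_in[OF that an(3)])
  have fixa': "\<sigma> a = a" if "\<sigma> permutes S2" for \<sigma>
    by (rule permutes_not_in[OF that an(1)])
  show ?thesis
  proof (intro equalityI subsetI)
    fix \<sigma> assume "\<sigma> \<in> ?L"
    then have \<sigma>: "ys \<noteq> []" "\<sigma> permutes S1 \<union> S2 \<union> Y" "planar (S1 \<union> S2 \<union> Y) \<sigma> (t \<circ> ty)"
      "comps (S1 \<union> S2 \<union> Y) \<sigma> (t \<circ> ty) = 1" "\<sigma> a = c"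
      using in1 by auto
    define \<sigma>0 where "\<sigma>0 = transpose a c \<circ> \<sigma>"
    define y where "y = hd ys"
    have y: "y \<in> Y" using \<sigma>(1) by (simp add: y_def Y_def)
    let ?t0 = "t1 \<circ> (t2 \<circ> ty)"
    have fa0: "\<sigma>0 a = a" using \<sigma>(5) by (simp add: \<sigma>0_def)
    have c1: "(a, c) \<in> conn (graph_of \<sigma>)" using conn_graph_step[of a \<sigma>] \<sigma>(5) by simp
    have c2: "(a, c) \<in> conn (graph_of (t \<circ> ty))"
      unfolding t_def
      by (rule cyc_conn_left[OF dd(4) _ _ p(3)]) (use S d in \<open>auto simp: Y_def\<close>)
    note sp = planar_split[OF D(5) \<sigma>(2) P(3) ac(1-3) c1 c2 \<sigma>(3), folded \<sigma>0_def, unfolded \<tau>0]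
    have p0: "\<sigma>0 permutes S1 \<union> S2 \<union> Y" unfolding \<sigma>0_def by (intro permutes_transpose_comp \<sigma> ac)
    have \<sigma>eq: "\<sigma> = transpose a c \<circ> \<sigma>0" by (simp add: \<sigma>0_def transpose_twice)
    have l1: "(a, x) \<in> linked \<sigma>0 ?t0" if "x \<in> S1" for x
      using cyc_conn_comp(1)[OF dd(1) _ _ P(2) D(3), of a x \<sigma>0] that D
      by (auto simp: S1_def t1_def)
    have l2: "(c, x) \<in> linked \<sigma>0 ?t0" if "x \<in> S2" for x
      using cyc_conn_comp(2)[OF dd(2) _ _ P(1) D(4), of c x \<sigma>0] that D
      unfolding comm by (auto simp: S2_def t2_def)
    have l3: "(y, x) \<in> linked \<sigma>0 ?t0" if "x \<in> Y" for x
    proof -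
      have "t1 \<circ> t2 permutes S1 \<union> S2"
        by (intro permutes_compose permutes_subset[OF p(1)] permutes_subset[OF p(2)]) auto
      from cyc_conn_comp(2)[OF dd(3) _ _ this, of y x \<sigma>0] show ?thesis
        using that S y by (auto simp: Y_def ty_def o_assoc)
    qed
    \<comment> \<open>Before the cut \<open>a\<close> is linked to the second boundary, and adding
      the edge (a, c) makes the relations before and after the cut equal. So after the cut the
      second boundary hangs on \<open>a\<close> or on \<open>c\<close>.\<close>
    have "(a, y) \<in> linked \<sigma> (t \<circ> ty)"
      using \<sigma>(4) num_classes_eq_1_iff[OF D(5) ac(1)] y by (simp add: comps_def)
    then have "(a, y) \<in> conn (insert (a, c) (graph_of \<sigma> \<union> graph_of (t \<circ> ty)))"
      by (rule conn_mono') auto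
    then have "(a, y) \<in> conn (insert (a, c) (graph_of \<sigma>0 \<union> graph_of ?t0))"
      unfolding \<sigma>0_def \<tau>0[symmetric] linked_transpose_both .
    then consider "(a, y) \<in> linked \<sigma>0 ?t0" | "(c, y) \<in> linked \<sigma>0 ?t0"
      using sp(3) unfolding conn_insert by blast
    then show "\<sigma> \<in> ?\<Phi> ` ?A \<union> ?\<Phi> ` ?B"
    proof cases
      case 1
      have l1': "(a, x) \<in> linked \<sigma>0 ?t0" if "x \<in> S1 \<union> Y" for x
        using that l1 l3 1 conn_trans by (metis UnE)
      obtain \<sigma>1 \<sigma>2 where s: "\<sigma>1 permutes S1 \<union> Y" "\<sigma>2 permutes S2" "\<sigma>0 = \<sigma>1 \<circ> \<sigma>2"
        using cut_preserves[OF D(4) p0[folded D(7)] D(2) l1' l2 sp(3)] by auto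
      have pl: "planar (S1 \<union> Y) \<sigma>1 (t1 \<circ> ty)" "planar S2 \<sigma>2 t2"
        using sp(1) planar_Un[OF D(4) S(6) s(1,2) P(1) p(2) D(2)] by (simp_all add: s(3) comm D(7))
      have "comps (S1 \<union> Y) \<sigma>1 (t1 \<circ> ty) = 1"
        using sp(2) comps_Un(1)[OF D(4) S(6) s(1,2) P(1) p(2) D(2)] k(2)[of \<sigma>2] \<sigma>(4)
        by (simp add: s(3) comm D(7))
      moreover have "\<sigma>1 a = a" using fa0 fixa'[OF s(2)] by (simp add: s(3))
      ultimately have "\<sigma>1 \<in> annular_perms g ys" "\<sigma>2 \<in> disc_perms (c # r)"
        using s pl \<sigma>(1) in3 in5 by auto
      then have "(\<sigma>1, \<sigma>2) \<in> ?B" by simp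
      then show ?thesis using \<sigma>eq s(3) by (intro UnI2 image_eqI[of _ _ "(\<sigma>1, \<sigma>2)"]) auto
    next
      case 2
      have l2': "(c, x) \<in> linked \<sigma>0 ?t0" if "x \<in> S2 \<union> Y" for x
        using that l2 l3 2 conn_trans by (metis UnE)
      obtain \<sigma>1 \<sigma>2 where s: "\<sigma>1 permutes S1" "\<sigma>2 permutes S2 \<union> Y" "\<sigma>0 = \<sigma>1 \<circ> \<sigma>2"
        using cut_preserves[OF S(5) p0[folded D(6)] D(1) l1 l2' sp(3)] by auto
      have pl: "planar S1 \<sigma>1 t1" "planar (S2 \<union> Y) \<sigma>2 (t2 \<circ> ty)"
        using sp(1) planar_Un[OF S(5) D(3) s(1,2) p(1) P(2) D(1)] by (simp_all add: s(3) D(6))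
      have "comps (S2 \<union> Y) \<sigma>2 (t2 \<circ> ty) = 1"
        using sp(2) comps_Un(1)[OF S(5) D(3) s(1,2) p(1) P(2) D(1)] k(1)[of \<sigma>1] \<sigma>(4)
        by (simp add: s(3) D(6))
      moreover have "\<sigma>1 a = a" using fa0 fixa[OF s(2)] by (simp add: s(3))
      ultimately have "\<sigma>1 \<in> disc_perms g" "\<sigma>2 \<in> annular_perms (c # r) ys"
        using s pl \<sigma>(1) in2 in4 by auto
      then have "(\<sigma>1, \<sigma>2) \<in> ?A" by simp
      then show ?thesis using \<sigma>eq s(3) by (intro UnI1 image_eqI[of _ _ "(\<sigma>1, \<sigma>2)"]) auto
    qed
  next
    fix \<sigma> assume "\<sigma> \<in> ?\<Phi> ` ?A \<union> ?\<Phi> ` ?B"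
    then obtain \<sigma>1 \<sigma>2 where s: "\<sigma> = transpose a c \<circ> (\<sigma>1 \<circ> \<sigma>2)"
      and AB: "(\<sigma>1, \<sigma>2) \<in> ?A \<or> (\<sigma>1, \<sigma>2) \<in> ?B" by auto
    have p0: "t1 \<circ> (t2 \<circ> ty) permutes S1 \<union> S2 \<union> Y"
      by (intro permutes_compose permutes_subset[OF p(1)] permutes_subset[OF p(2)]
          permutes_subset[OF p(3)]) auto
    have "ys \<noteq> [] \<and> \<sigma>1 \<circ> \<sigma>2 permutes S1 \<union> S2 \<union> Y \<and> planar (S1 \<union> S2 \<union> Y) (\<sigma>1 \<circ> \<sigma>2) (t1 \<circ> (t2 \<circ> ty)) \<and>
      comps (S1 \<union> S2 \<union> Y) (\<sigma>1 \<circ> \<sigma>2) (t1 \<circ> (t2 \<circ> ty)) = 2 \<and>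
      (a, c) \<notin> linked (\<sigma>1 \<circ> \<sigma>2) (t1 \<circ> (t2 \<circ> ty)) \<and> \<sigma>1 a = a \<and> \<sigma>2 a = a"
      using AB
    proof
      assume "(\<sigma>1, \<sigma>2) \<in> ?A"
      then have m: "\<sigma>1 permutes S1" "planar S1 \<sigma>1 t1" "\<sigma>1 a = a" "ys \<noteq> []" "\<sigma>2 permutes S2 \<union> Y"
        "planar (S2 \<union> Y) \<sigma>2 (t2 \<circ> ty)" "comps (S2 \<union> Y) \<sigma>2 (t2 \<circ> ty) = 1"
        using in2 in4 by auto
      have "\<sigma>1 \<circ> \<sigma>2 permutes S1 \<union> S2 \<union> Y"
        by (intro permutes_compose permutes_subset[OF m(1)] permutes_subset[OF m(5)]) auto
      then show ?thesis
        using planar_Un[OF S(5) D(3) m(1,5) p(1) P(2) D(1)] m comps_Un[OF S(5) D(3) m(1,5) p(1) P(2) D(1)]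
          k(1)[of \<sigma>1] fixa[OF m(5)] ac by (auto simp: D(6))
    next
      assume "(\<sigma>1, \<sigma>2) \<in> ?B"
      then have m: "\<sigma>1 permutes S1 \<union> Y" "planar (S1 \<union> Y) \<sigma>1 (t1 \<circ> ty)" "\<sigma>1 a = a" "ys \<noteq> []"
        "\<sigma>2 permutes S2" "planar S2 \<sigma>2 t2" "comps (S1 \<union> Y) \<sigma>1 (t1 \<circ> ty) = 1"
        using in3 in5 by auto
      have "\<sigma>1 \<circ> \<sigma>2 permutes S1 \<union> S2 \<union> Y"
        by (intro permutes_compose permutes_subset[OF m(1)] permutes_subset[OF m(5)]) auto
      then show ?thesis
        using planar_Un[OF D(4) S(6) m(1,5) P(1) p(2) D(2)] m comps_Un[OF D(4) S(6) m(1,5) P(1) p(2) D(2)]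
          k(2)[of \<sigma>2] fixa'[OF m(5)] ac unfolding comm by (auto simp: D(7))
    qed
    then have m: "ys \<noteq> []" "\<sigma>1 \<circ> \<sigma>2 permutes S1 \<union> S2 \<union> Y"
      "planar (S1 \<union> S2 \<union> Y) (\<sigma>1 \<circ> \<sigma>2) (t1 \<circ> (t2 \<circ> ty))"
      "comps (S1 \<union> S2 \<union> Y) (\<sigma>1 \<circ> \<sigma>2) (t1 \<circ> (t2 \<circ> ty)) = 2"
      "(a, c) \<notin> linked (\<sigma>1 \<circ> \<sigma>2) (t1 \<circ> (t2 \<circ> ty))" "\<sigma>1 a = a" "\<sigma>2 a = a" by blast+
    note u = planar_unsplit[OF D(5) m(2) p0 ac(1-3) m(5,3), folded s, unfolded \<tau>]
    have "\<sigma> permutes S1 \<union> S2 \<union> Y" unfolding s by (intro permutes_transpose_comp m ac)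
    moreover have "\<sigma> a = c" using m by (simp add: s)
    ultimately show "\<sigma> \<in> ?L" using in1 m u by simp
  qed
qed

text \<open>In the first image the factor on \<open>c # r\<close> and \<open>ys\<close> is
  connected. If the permutation also lay in the second image, this factor would preserve
  \<open>c # r\<close>, and its surface would fall apart into two discs.\<close>

lemma annular_perms_split_disjoint:
  assumes d: "distinct (a # g @ c # r @ ys)"
  shows "(\<lambda>(\<sigma>1, \<sigma>2). transpose a c \<circ> (\<sigma>1 \<circ> \<sigma>2)) ` (disc_perms g \<times> annular_perms (c # r) ys) \<inter>
    (\<lambda>(\<sigma>1, \<sigma>2). transpose a c \<circ> (\<sigma>1 \<circ> \<sigma>2)) ` (annular_perms g ys \<times> disc_perms (c # r)) = {}"
proof (rule ccontr)
  assume "\<not> ?thesis"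
  then obtain f g' f' h where m: "f \<in> disc_perms g" "g' \<in> annular_perms (c # r) ys"
    "f' \<in> annular_perms g ys" "h \<in> disc_perms (c # r)"
    and eq: "transpose a c \<circ> (f \<circ> g') = transpose a c \<circ> (f' \<circ> h)" by auto
  have d': "set g \<inter> set (c # r) = {}" "set g \<inter> set ys = {}" "set (c # r) \<inter> set ys = {}" "distinct (c # r)"
    "distinct ys" "set (c # r) \<inter> set ys = {}"
    using d by auto
  have fg: "f \<circ> g' = f' \<circ> h" using eq by (rule transpose_comp_cancel)
  have pf: "f permutes set g" "h permutes set (c # r)" "g' permutes set (c # r) \<union> set ys" "f' permutes set g \<union> set ys"
    using m disc_perms_permutes annular_perms_permutes by blast+
  have "g' x \<in> set (c # r)" if x: "x \<in> set (c # r)" for x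
  proof -
    have "g' x \<in> set (c # r) \<union> set ys" using permutes_in_image[OF pf(3)] x by blast
    then have "g' x \<notin> set g" using d' by blast
    then have "f (g' x) = g' x" using permutes_not_in[OF pf(1)] by blast
    then have "g' x = f' (h x)" using fun_cong[OF fg, of x] by simp
    moreover have hx: "h x \<in> set (c # r)" using permutes_in_image[OF pf(2)] x by blast
    then have "h x \<notin> set g \<union> set ys" using d' by blast
    then have "f' (h x) = h x" using permutes_not_in[OF pf(4)] by blast
    ultimately show ?thesis using hx by simp
  qed
  then obtain g1 g2 where gg: "g1 permutes set (c # r)" "g2 permutes set ys" "g' = g1 \<circ> g2"
    using permutes_Un_decompose[OF _ pf(3) d'(3)] by auto
  have ys: "ys \<noteq> []" "comps (set (c # r) \<union> set ys) g' (cyc (c # r) \<circ> cyc ys) = 1"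
    using m(2) by (simp_all add: annular_perms_def)
  have "comps (set (c # r) \<union> set ys) g' (cyc (c # r) \<circ> cyc ys) = comps (set (c # r)) g1 (cyc (c # r)) + comps (set ys) g2 (cyc ys)"
    unfolding gg(3) by (intro comps_Un(1) gg cycle_permutes d') auto
  also have "\<dots> = 2" using comps_cyc[OF d'(4)] comps_cyc[OF d'(5) ys(1)] by simp
  finally show False using ys by simp
qed

text \<open>Since \<open>a\<close> and \<open>c\<close> lie on different boundaries, (a c) merges
  these into the single boundary of a disc. There \<open>a\<close> is a fixed point and drops out,
  which leaves the second boundary read from \<open>c\<close> on, followed by \<open>zs\<close>. As
  \<open>planar_merge\<close> is an equivalence, every disc permutation of this boundary
  occurs.\<close>

lemma annular_perms_merge:
  assumes d: "distinct (a # zs @ p @ c # q)"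
  shows "{\<sigma> \<in> annular_perms (a # zs) (p @ c # q). \<sigma> a = c} =
    (\<lambda>\<sigma>. transpose a c \<circ> \<sigma>) ` disc_perms (c # q @ p @ zs)"
proof -
  define S where "S = set (a # zs) \<union> set (p @ c # q)"
  have S: "set (a # zs) \<union> set (c # q @ p) = S" "finite S" "set (a # zs @ c # q @ p) = S" by (auto simp: S_def)
  have dq: "distinct (p @ c # q)" "distinct (a # zs @ c # q @ p)" "distinct ((c # q @ p) @ zs)" "distinct (a # zs)" "distinct (c # q @ p)"
    using d by auto
  define t where "t = cyc (a # zs) \<circ> cyc (p @ c # q)"
  have t: "t = cyc (a # zs) \<circ> cyc (c # q @ p)" using cyc_rotate[OF dq(1)] by (simp add: t_def)
  define X where "X = a # zs @ c # q @ p"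
  have \<tau>: "transpose a c \<circ> t = cyc X" unfolding t X_def by (rule cyc_append[OF dq(2)])
  have ac: "a \<in> S" "c \<in> S" "a \<noteq> c" using d by (auto simp: S_def)
  have pt: "t permutes S" unfolding t_def S_def
    by (intro permutes_compose permutes_subset[OF cycle_permutes]) auto
  have nc: "(a, c) \<notin> conn (graph_of t)"
  proof
    assume "(a, c) \<in> conn (graph_of t)"
    then have "(a, c) \<in> linked id t" by (rule linked_mono2)
    moreover have "(a, c) \<notin> linked (id \<circ> id) (cyc (a # zs) \<circ> cyc (p @ c # q))"
      using d by (intro comps_Un(2)[of "set (a # zs)" "set (p @ c # q)"] cycle_permutes permutes_id) auto
    ultimately show False by (simp add: t_def)
  qed
  have rot: "disc_perms (c # q @ p @ zs) = {\<sigma> \<in> disc_perms X. \<sigma> a = a}"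
    unfolding X_def disc_perms_fix[OF dq(2)] using disc_perms_rotate[OF dq(3)] by simp
  have in1: "\<sigma> \<in> annular_perms (a # zs) (p @ c # q) \<longleftrightarrow> \<sigma> permutes S \<and> planar S \<sigma> t \<and> comps S \<sigma> t = 1" for \<sigma>
    by (simp add: annular_perms_def t_def S_def del: cycle_of_list.simps)
  have X: "set X = S" "distinct X" "X \<noteq> []" using S dq by (simp_all add: X_def)
  have eq: "\<sigma> \<in> annular_perms (a # zs) (p @ c # q) \<longleftrightarrow> transpose a c \<circ> \<sigma> \<in> disc_perms X"
    if "\<sigma> permutes S" "\<sigma> a = c" for \<sigma>
  proof -
    have "(a, c) \<in> conn (graph_of \<sigma>)" using conn_graph_step[of a \<sigma>] that(2) by simp
    note m = planar_merge[OF S(2) that(1) pt ac this nc, unfolded \<tau>]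
    moreover have "comps S (transpose a c \<circ> \<sigma>) (cyc X) = 1" using comps_cyc[OF X(2,3)] X by simp
    moreover have "transpose a c \<circ> \<sigma> permutes S" by (intro permutes_transpose_comp that ac)
    ultimately show ?thesis using that in1 X(1) by (simp add: disc_perms_def)
  qed
  show ?thesis
  proof (intro equalityI subsetI)
    fix \<sigma> assume "\<sigma> \<in> {\<sigma> \<in> annular_perms (a # zs) (p @ c # q). \<sigma> a = c}"
    then have \<sigma>: "\<sigma> \<in> annular_perms (a # zs) (p @ c # q)" "\<sigma> a = c" by auto
    then have "transpose a c \<circ> \<sigma> \<in> disc_perms X" using eq in1 by blast
    then have "transpose a c \<circ> \<sigma> \<in> disc_perms (c # q @ p @ zs)" using \<sigma> rot by simp
    then show "\<sigma> \<in> (\<lambda>\<sigma>. transpose a c \<circ> \<sigma>) ` disc_perms (c # q @ p @ zs)"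
      using transpose_twice[of a c \<sigma>] by (metis image_eqI)
  next
    fix \<sigma> assume "\<sigma> \<in> (\<lambda>\<sigma>. transpose a c \<circ> \<sigma>) ` disc_perms (c # q @ p @ zs)"
    then obtain \<rho> where \<rho>: "\<rho> \<in> disc_perms X" "\<rho> a = a" "\<sigma> = transpose a c \<circ> \<rho>" using rot by auto
    have "\<rho> permutes S" using \<rho>(1) X(1) by (auto simp: disc_perms_def)
    then have "\<sigma> permutes S" unfolding \<rho>(3) by (intro permutes_transpose_comp ac)
    moreover have "\<sigma> a = c" using \<rho> by simp
    moreover have "transpose a c \<circ> \<sigma> \<in> disc_perms X" using \<rho> by (simp add: transpose_twice)
    ultimately show "\<sigma> \<in> {\<sigma> \<in> annular_perms (a # zs) (p @ c # q). \<sigma> a = c}" using eq by simp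
  qed
qed

section \<open>Weighted enumeration of planar permutations\<close>

definition cycle_weight :: "(nat set \<Rightarrow> 'a::comm_monoid_mult) \<Rightarrow> nat set \<Rightarrow> (nat \<Rightarrow> nat) \<Rightarrow> 'a" where
  "cycle_weight g S \<sigma> = (\<Prod>V\<in>cycle_supports S \<sigma>. g V)"

definition rooted :: "(nat \<Rightarrow> 'a) \<Rightarrow> (nat \<Rightarrow> 'a) \<Rightarrow> nat \<Rightarrow> nat set \<Rightarrow> 'a" where
  "rooted \<kappa> w a V = (if a \<in> V then w (card V) else \<kappa> (card V))"

abbreviation (input) unrooted :: "(nat \<Rightarrow> 'a) \<Rightarrow> nat set \<Rightarrow> 'a" where
  "unrooted \<kappa> \<equiv> (\<lambda>V. \<kappa> (card V))"

lemma rooted_same: "rooted \<kappa> \<kappa> a = unrooted \<kappa>"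
  by (simp add: rooted_def fun_eq_iff)

lemma cycle_weight_Un:
  assumes "finite S" "finite T" "f permutes S" "g permutes T" "S \<inter> T = {}"
  shows "cycle_weight h (S \<union> T) (f \<circ> g) = cycle_weight h S f * cycle_weight h T g"
  unfolding cycle_weight_def cycle_supports_Un[OF assms(3-5)]
  using assms by (intro prod.union_disjoint finite_cycle_supports cycle_supports_disjoint)

lemma cycle_weight_fix:
  assumes "finite S" "a \<notin> S" "\<sigma> permutes S"
  shows "cycle_weight h (insert a S) \<sigma> = h {a} * cycle_weight h S \<sigma>"
proof -
  have "cycle_supports {a} id = {{a}}"
    using orbit_eq_singleton_iff[of id a] by (simp add: cycle_supports_def)
  then show ?thesis
    using cycle_weight_Un[of "{a}" S id \<sigma> h] assms by (simp add: cycle_weight_def)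
qed

lemma cycle_weight_cong:
  assumes "\<sigma> permutes S" "\<And>V. V \<subseteq> S \<Longrightarrow> g V = h V"
  shows "cycle_weight g S \<sigma> = cycle_weight h S \<sigma>"
  unfolding cycle_weight_def
  using cycle_supports_subset(1)[OF assms(1)] assms(2) by (intro prod.cong refl) auto

lemma cycle_weight_unrooted:
  assumes "\<sigma> permutes S" "a \<notin> S"
  shows "cycle_weight (rooted \<kappa> w a) S \<sigma> = cycle_weight (unrooted \<kappa>) S \<sigma>"
  by (rule cycle_weight_cong[OF assms(1)]) (use assms(2) in \<open>auto simp: rooted_def\<close>)

lemma orbit_join:
  assumes "finite S" "\<sigma> permutes S" "u \<in> S" "v \<in> S" "u \<noteq> v" "v \<notin> orbit \<sigma> u"
  shows "orbit (transpose u v \<circ> \<sigma>) x =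
    (if x \<in> orbit \<sigma> u \<union> orbit \<sigma> v then orbit \<sigma> u \<union> orbit \<sigma> v else orbit \<sigma> x)"
proof -
  let ?r = "graph_of \<sigma>"
  have p: "permutation \<sigma>" "permutation (transpose u v \<circ> \<sigma>)"
    using permutes_permutation[OF assms(1)] permutes_transpose_comp[OF assms(2-4)] assms(2) by blast+
  have O: "y \<in> orbit \<sigma> x \<longleftrightarrow> (x, y) \<in> conn ?r" for x y
    by (simp add: orbit_eq_conn[OF p(1)])
  have "(u, v) \<notin> conn ?r" using assms(6) O by simp
  then have con: "(u, v) \<in> conn (graph_of (transpose u v \<circ> \<sigma>))"
    using transpose_connects_or[OF assms(1-5)] by blast
  have c1: "(x, y) \<in> conn (graph_of (transpose u v \<circ> \<sigma>)) \<longleftrightarrow>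
      (x, y) \<in> conn (insert (u, v) (graph_of (transpose u v \<circ> \<sigma>)))" for y
    using con unfolding conn_insert by (metis conn_sym conn_trans)
  have c2: "conn (insert (u, v) (graph_of (transpose u v \<circ> \<sigma>))) = conn (insert (u, v) ?r)"
    using conn_insert_swap[of u v \<sigma> "{}"] by simp
  have "y \<in> orbit (transpose u v \<circ> \<sigma>) x \<longleftrightarrow>
      (x, y) \<in> conn ?r \<or> (x, u) \<in> conn ?r \<and> (v, y) \<in> conn ?r \<or> (x, v) \<in> conn ?r \<and> (u, y) \<in> conn ?r" for y
    unfolding orbit_eq_conn[OF p(2)] Image_singleton_iff c1 c2 conn_insert ..
  moreover define K where "K z = conn ?r `` {z}" for z
  have e: "(z, z') \<in> conn ?r \<longleftrightarrow> K z = K z'" for z z'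
    unfolding K_def by (rule conn_class_eq)
  have "y \<in> (if x \<in> orbit \<sigma> u \<union> orbit \<sigma> v then orbit \<sigma> u \<union> orbit \<sigma> v else orbit \<sigma> x) \<longleftrightarrow>
      (x, y) \<in> conn ?r \<or> (x, u) \<in> conn ?r \<and> (v, y) \<in> conn ?r \<or> (x, v) \<in> conn ?r \<and> (u, y) \<in> conn ?r" for y
  proof (cases "x \<in> orbit \<sigma> u \<union> orbit \<sigma> v")
    case True
    then have "K u = K x \<or> K v = K x" unfolding Un_iff O e .
    then have "(K u = K y \<or> K v = K y) \<longleftrightarrow>
        (K x = K y \<or> K x = K u \<and> K v = K y \<or> K x = K v \<and> K u = K y)" by metis
    then show ?thesis
      unfolding if_P[OF True] unfolding Un_iff O e .
  next
    case False
    then have "K u \<noteq> K x" "K v \<noteq> K x" unfolding Un_iff O e by auto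
    then have "K x = K y \<longleftrightarrow> (K x = K y \<or> K x = K u \<and> K v = K y \<or> K x = K v \<and> K u = K y)" by metis
    then show ?thesis
      unfolding if_not_P[OF False] unfolding O e .
  qed
  ultimately show ?thesis by (intro set_eqI) simp
qed

lemma orbit_eq_iff:
  assumes "permutation \<sigma>"
  shows "orbit \<sigma> x = orbit \<sigma> y \<longleftrightarrow> y \<in> orbit \<sigma> x"
proof -
  have "orbit \<sigma> x = orbit \<sigma> y \<longleftrightarrow> (x, y) \<in> conn (graph_of \<sigma>)"
    unfolding orbit_eq_conn[OF assms] conn_class_eq ..
  then show ?thesis by (simp add: orbit_eq_conn[OF assms])
qed

lemma cycle_supports_join:
  assumes "finite S" "\<sigma> permutes S" "u \<in> S" "v \<in> S" "u \<noteq> v" "v \<notin> orbit \<sigma> u"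
  shows "cycle_supports S (transpose u v \<circ> \<sigma>) =
    insert (orbit \<sigma> u \<union> orbit \<sigma> v) (cycle_supports S \<sigma> - {orbit \<sigma> u, orbit \<sigma> v})"
proof -
  note p = permutes_permutation[OF assms(1,2)]
  have mem: "x \<in> orbit \<sigma> y \<longleftrightarrow> orbit \<sigma> x = orbit \<sigma> y" for x y
    using orbit_eq_iff[OF p, of y x] by metis
  have J: "orbit (transpose u v \<circ> \<sigma>) x = (if orbit \<sigma> x = orbit \<sigma> u \<or> orbit \<sigma> x = orbit \<sigma> v
      then orbit \<sigma> u \<union> orbit \<sigma> v else orbit \<sigma> x)" for x
    unfolding orbit_join[OF assms] Un_iff mem ..
  show ?thesis
    unfolding cycle_supports_def J using assms(3) by auto
qed

text \<open>The fixed point \<open>a\<close> is inserted into the cycle of \<open>c\<close>. This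
  cycle carries the root weight and is one point longer than before, hence the shift;
  \<open>c\<close> takes over as the mark once \<open>a\<close> is removed.\<close>

lemma cycle_weight_join:
  assumes "finite S" "a \<notin> S" "\<sigma> permutes S" "c \<in> S"
  shows "cycle_weight (rooted \<kappa> w a) (insert a S) (transpose a c \<circ> \<sigma>) =
    cycle_weight (rooted \<kappa> (\<lambda>k. w (Suc k)) c) S \<sigma>"
proof -
  have p: "\<sigma> permutes insert a S" "\<sigma> a = a" using permutes_insert_fix[OF assms(2)] assms(3) by auto
  have perm: "permutation \<sigma>" by (rule permutes_permutation[OF assms(1,3)])
  have Oa: "orbit \<sigma> a = {a}" using p(2) orbit_eq_singleton_iff by metis
  define C R where "C = orbit \<sigma> c" and "R = cycle_supports S \<sigma> - {C}"
  have CS: "cycle_supports S \<sigma> = insert C R" "C \<notin> R" "finite R"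
    using assms(1,4) by (auto simp: R_def C_def cycle_supports_def)
  have sub: "V \<subseteq> S" if "V \<in> insert C R" for V
    using cycle_supports_subset(1)[OF assms(3)] that CS by blast
  have cC: "c \<in> C" by (simp add: C_def permutation_self_in_orbit[OF perm])
  have cR: "c \<notin> V" if "V \<in> R" for V
  proof
    assume "c \<in> V"
    from that obtain x where "V = orbit \<sigma> x" "V \<noteq> C" by (auto simp: R_def cycle_supports_def)
    then show False using \<open>c \<in> V\<close> orbit_eq_iff[OF perm, of x c] by (simp add: C_def)
  qed
  have "cycle_supports (insert a S) \<sigma> = insert {a} (insert C R)"
    using CS(1) Oa by (simp add: cycle_supports_def)
  moreover have "{a} \<noteq> C" "{a} \<notin> R" using sub assms(2) by auto
  moreover have "cycle_supports (insert a S) (transpose a c \<circ> \<sigma>) =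
      insert ({a} \<union> C) (cycle_supports (insert a S) \<sigma> - {{a}, C})"
    using cycle_supports_join[of "insert a S" \<sigma> a c] assms p Oa by (auto simp: C_def)
  ultimately have "cycle_supports (insert a S) (transpose a c \<circ> \<sigma>) = insert (insert a C) R"
    using CS(2) by auto
  moreover have "insert a C \<notin> R" using sub assms(2) by blast
  moreover have "finite C" "a \<notin> C" using sub[of C] assms(1,2) finite_subset by auto
  ultimately have "cycle_weight (rooted \<kappa> w a) (insert a S) (transpose a c \<circ> \<sigma>) =
      w (Suc (card C)) * (\<Prod>V\<in>R. rooted \<kappa> w a V)"
    using CS(3) by (simp add: cycle_weight_def rooted_def)
  also have "(\<Prod>V\<in>R. rooted \<kappa> w a V) = (\<Prod>V\<in>R. rooted \<kappa> (\<lambda>k. w (Suc k)) c V)"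
  proof (rule prod.cong[OF refl])
    fix V assume "V \<in> R"
    then have "a \<notin> V" "c \<notin> V" using sub[of V] cR assms(2) by auto
    then show "rooted \<kappa> w a V = rooted \<kappa> (\<lambda>k. w (Suc k)) c V" by (simp add: rooted_def)
  qed
  also have "w (Suc (card C)) * \<dots> = cycle_weight (rooted \<kappa> (\<lambda>k. w (Suc k)) c) S \<sigma>"
    using CS cC by (simp add: cycle_weight_def rooted_def)
  finally show ?thesis .
qed

lemma cycle_weight_glue:
  assumes "finite S" "finite T" "\<sigma>1 permutes S" "\<sigma>2 permutes T" "S \<inter> T = {}" "a \<notin> S \<union> T" "c \<in> T"
  shows "cycle_weight (rooted \<kappa> w a) (insert a (S \<union> T)) (transpose a c \<circ> (\<sigma>1 \<circ> \<sigma>2)) =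
    cycle_weight (unrooted \<kappa>) S \<sigma>1 * cycle_weight (rooted \<kappa> (\<lambda>k. w (Suc k)) c) T \<sigma>2"
proof -
  have "\<sigma>1 \<circ> \<sigma>2 permutes S \<union> T"
    by (intro permutes_compose permutes_subset[OF assms(3)] permutes_subset[OF assms(4)]) auto
  then have "cycle_weight (rooted \<kappa> w a) (insert a (S \<union> T)) (transpose a c \<circ> (\<sigma>1 \<circ> \<sigma>2)) =
      cycle_weight (rooted \<kappa> (\<lambda>k. w (Suc k)) c) (S \<union> T) (\<sigma>1 \<circ> \<sigma>2)"
    using assms by (intro cycle_weight_join) auto
  also have "\<dots> = cycle_weight (rooted \<kappa> (\<lambda>k. w (Suc k)) c) S \<sigma>1 * cycle_weight (rooted \<kappa> (\<lambda>k. w (Suc k)) c) T \<sigma>2"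
    by (rule cycle_weight_Un[OF assms(1-5)])
  also have "cycle_weight (rooted \<kappa> (\<lambda>k. w (Suc k)) c) S \<sigma>1 = cycle_weight (unrooted \<kappa>) S \<sigma>1"
    using assms by (intro cycle_weight_unrooted) auto
  finally show ?thesis .
qed

lemma finite_disc_perms: "finite (disc_perms xs)"
  by (rule finite_subset[OF _ finite_permutations[of "set xs"]]) (auto simp: disc_perms_def)

lemma finite_annular_perms: "finite (annular_perms xs ys)"
  by (rule finite_subset[OF _ finite_permutations[of "set xs \<union> set ys"]]) (auto simp: annular_perms_def)

lemma sum_by_image:
  assumes "finite A" "\<And>\<sigma>. \<sigma> \<in> A \<Longrightarrow> \<sigma> permutes set xs" "distinct xs" "a \<in> set xs"
  shows "(\<Sum>\<sigma>\<in>A. F \<sigma>) = (\<Sum>k<length xs. \<Sum>\<sigma>\<in>{\<sigma> \<in> A. \<sigma> a = xs ! k}. (F \<sigma> :: 'a::comm_monoid_add))"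
proof -
  have "(\<lambda>\<sigma>. \<sigma> a) ` A \<subseteq> set xs"
    using permutes_in_image[OF assms(2)] assms(4) by auto
  then have "(\<Sum>\<sigma>\<in>A. F \<sigma>) = (\<Sum>y\<in>set xs. \<Sum>\<sigma>\<in>{\<sigma> \<in> A. \<sigma> a = y}. F \<sigma>)"
    using sum.group[OF assms(1) finite_set, of "\<lambda>\<sigma>. \<sigma> a" xs F] by simp
  also have "\<dots> = (\<Sum>k<length xs. \<Sum>\<sigma>\<in>{\<sigma> \<in> A. \<sigma> a = xs ! k}. F \<sigma>)"
    by (rule sum.reindex_bij_betw[symmetric]) (use assms(3) in \<open>auto intro: bij_betw_nth\<close>)
  finally show ?thesis .
qed

lemma sum_glue:
  fixes F :: "(nat \<Rightarrow> nat) \<Rightarrow> 'a::comm_semiring_1"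
  assumes "\<And>\<sigma>. \<sigma> \<in> A \<Longrightarrow> \<sigma> permutes S" "\<And>\<sigma>. \<sigma> \<in> B \<Longrightarrow> \<sigma> permutes T" "S \<inter> T = {}"
    and "\<And>\<sigma>1 \<sigma>2. \<sigma>1 \<in> A \<Longrightarrow> \<sigma>2 \<in> B \<Longrightarrow> F (transpose a c \<circ> (\<sigma>1 \<circ> \<sigma>2)) = G \<sigma>1 * H \<sigma>2"
  shows "(\<Sum>\<sigma>\<in>(\<lambda>(\<sigma>1, \<sigma>2). transpose a c \<circ> (\<sigma>1 \<circ> \<sigma>2)) ` (A \<times> B). F \<sigma>) = (\<Sum>\<sigma>\<in>A. G \<sigma>) * (\<Sum>\<sigma>\<in>B. H \<sigma>)"
proof -
  have "(\<Sum>\<sigma>\<in>(\<lambda>(\<sigma>1, \<sigma>2). transpose a c \<circ> (\<sigma>1 \<circ> \<sigma>2)) ` (A \<times> B). F \<sigma>) =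
      (\<Sum>(\<sigma>1, \<sigma>2)\<in>A \<times> B. F (transpose a c \<circ> (\<sigma>1 \<circ> \<sigma>2)))"
    by (subst sum.reindex[OF inj_on_glue[OF assms(1-3)]]) (auto simp: case_prod_unfold intro: sum.cong)
  also have "\<dots> = (\<Sum>(\<sigma>1, \<sigma>2)\<in>A \<times> B. G \<sigma>1 * H \<sigma>2)"
    by (intro sum.cong) (auto simp: assms(4))
  also have "\<dots> = (\<Sum>\<sigma>\<in>A. G \<sigma>) * (\<Sum>\<sigma>\<in>B. H \<sigma>)"
    by (simp add: sum_product sum.cartesian_product)
  finally show ?thesis .
qed

abbreviation (input) shift_weight :: "(nat \<Rightarrow> 'a) \<Rightarrow> nat \<Rightarrow> 'a" where
  "shift_weight w \<equiv> (\<lambda>k. w (Suc k))"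

text \<open>\<open>D w n\<close> and \<open>T w n j\<close> enumerate the planar permutations of a disc with \<open>n\<close> and of an annulus
  with \<open>n\<close> and \<open>j\<close> boundary points, where the cycle of a marked point of the first boundary carries
  the weights \<open>w\<close> instead of \<open>\<kappa>\<close>. The recursion removes the marked point \<open>a\<close> and marks \<open>\<sigma> a\<close>.\<close>

locale planar_counts =
  fixes \<kappa> :: "nat \<Rightarrow> 'a::comm_ring_1" and m :: "nat \<Rightarrow> 'a"
    and D :: "(nat \<Rightarrow> 'a) \<Rightarrow> nat \<Rightarrow> 'a" and T :: "(nat \<Rightarrow> 'a) \<Rightarrow> nat \<Rightarrow> nat \<Rightarrow> 'a"
  assumes D_0: "D w 0 = w 0"
    and D_Suc: "D w (Suc n) = (\<Sum>k\<le>n. m k * D (shift_weight w) (n - k))"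
    and m_0: "m 0 = 1" and m_Suc: "m (Suc n) = D \<kappa> (Suc n)"
    and T_0: "T w 0 j = 0"
    and T_Suc: "T w (Suc n) j = (\<Sum>k\<le>n. m k * T (shift_weight w) (n - k) j +
        T \<kappa> k j * D (shift_weight w) (n - k)) + of_nat j * D (shift_weight w) (n + j)"
begin

text \<open>The permutations are sorted by \<open>\<sigma> a\<close>. If this is
  \<open>zs ! k\<close>, the arc in between has \<open>k\<close> points and contributes
  \<open>m k\<close>, while the remaining disc is marked at \<open>\<sigma> a\<close>.\<close>

lemma sum_disc_rooted:
  assumes "distinct (a # zs)"
  shows "(\<Sum>\<sigma>\<in>disc_perms (a # zs). cycle_weight (rooted \<kappa> w a) (set (a # zs)) \<sigma>) = D w (Suc (length zs))"
  using assms
proof (induction zs arbitrary: a w rule: length_induct)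
  case (1 zs)
  let ?F = "\<lambda>\<sigma>. cycle_weight (rooted \<kappa> w a) (set (a # zs)) \<sigma>"
  have IH: "(\<Sum>\<sigma>\<in>disc_perms (a' # zs'). cycle_weight (rooted \<kappa> w' a') (set (a' # zs')) \<sigma>) = D w' (Suc (length zs'))"
    if "length zs' < length zs" "distinct (a' # zs')" for a' zs' w'
    using "1.IH" that by blast
  have IH_m: "(\<Sum>\<sigma>\<in>disc_perms xs. cycle_weight (unrooted \<kappa>) (set xs) \<sigma>) = m (length xs)"
    if "length xs \<le> length zs" "distinct xs" for xs
  proof (cases xs)
    case Nil
    have "disc_perms [] = {id}"
      by (auto simp: disc_perms_def planar_def num_cycles_def cycle_supports_def comps_def num_classes_def)
    then show ?thesis using Nil by (simp add: cycle_weight_def cycle_supports_def m_0)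
  next
    case (Cons b ys)
    then show ?thesis using IH[of ys b \<kappa>] that by (simp add: rooted_same m_Suc)
  qed
  have a: "a \<notin> set zs" "distinct zs" using "1.prems" by auto
  \<comment> \<open>The convention \<open>D w 0 = w 0\<close> makes
    \<open>D (shift_weight w) 0\<close> equal to \<open>w 1\<close>, the weight of the block {a}. So
    the permutations fixing \<open>a\<close> supply the last term of the recursion.\<close>
  have fix0: "(\<Sum>\<sigma>\<in>{\<sigma> \<in> disc_perms (a # zs). \<sigma> a = a}. ?F \<sigma>) = m (length zs) * D (shift_weight w) 0"
  proof -
    have "?F \<sigma> = w 1 * cycle_weight (unrooted \<kappa>) (set zs) \<sigma>" if "\<sigma> \<in> disc_perms zs" for \<sigma>
      using cycle_weight_fix[OF _ a(1) disc_perms_permutes[OF that], of "rooted \<kappa> w a"]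
        cycle_weight_unrooted[OF disc_perms_permutes[OF that] a(1), of \<kappa> w]
      by (simp add: rooted_def)
    then show ?thesis
      unfolding disc_perms_fix[OF "1.prems"] using IH_m[of zs] a(2)
      by (simp add: sum_distrib_left[symmetric] D_0 mult.commute)
  qed
  have step: "(\<Sum>\<sigma>\<in>{\<sigma> \<in> disc_perms (a # zs). \<sigma> a = zs ! k}. ?F \<sigma>) =
      m k * D (shift_weight w) (length zs - k)" if k: "k < length zs" for k
  proof -
    define g c r where "g = take k zs" and "c = zs ! k" and "r = drop (Suc k) zs"
    have zs: "zs = g @ c # r" using id_take_nth_drop[OF k] by (simp add: g_def c_def r_def)
    have d: "distinct (a # g @ c # r)" using "1.prems" zs by simp
    have S: "set (a # zs) = insert a (set g \<union> set (c # r))" unfolding zs by auto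
    have len: "length g = k" "Suc (length r) = length zs - k" using k by (simp_all add: g_def r_def)
    have disj: "set g \<inter> set (c # r) = {}" "a \<notin> set g \<union> set (c # r)" using d by auto
    have "?F (transpose a c \<circ> (\<sigma>1 \<circ> \<sigma>2)) = cycle_weight (unrooted \<kappa>) (set g) \<sigma>1 *
        cycle_weight (rooted \<kappa> (shift_weight w) c) (set (c # r)) \<sigma>2"
      if "\<sigma>1 \<in> disc_perms g" "\<sigma>2 \<in> disc_perms (c # r)" for \<sigma>1 \<sigma>2
      unfolding S by (rule cycle_weight_glue) (use that disj in \<open>auto intro: disc_perms_permutes dest: disc_perms_permutes\<close>)
    then have "(\<Sum>\<sigma>\<in>{\<sigma> \<in> disc_perms (a # zs). \<sigma> a = c}. ?F \<sigma>) =
        (\<Sum>\<sigma>\<in>disc_perms g. cycle_weight (unrooted \<kappa>) (set g) \<sigma>) *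
        (\<Sum>\<sigma>\<in>disc_perms (c # r). cycle_weight (rooted \<kappa> (shift_weight w) c) (set (c # r)) \<sigma>)"
      unfolding disc_perms_split[OF d, folded zs]
      by (intro sum_glue[OF _ _ disj(1)] disc_perms_permutes)
    also have "\<dots> = m k * D (shift_weight w) (length zs - k)"
      using IH_m[of g] IH[of r c "shift_weight w"] k d len by simp
    finally show ?thesis by (simp add: c_def)
  qed
  have "(\<Sum>\<sigma>\<in>disc_perms (a # zs). ?F \<sigma>) =
      (\<Sum>k<length (a # zs). \<Sum>\<sigma>\<in>{\<sigma> \<in> disc_perms (a # zs). \<sigma> a = (a # zs) ! k}. ?F \<sigma>)"
    by (rule sum_by_image[OF finite_disc_perms disc_perms_permutes "1.prems"]) auto
  also have "\<dots> = (\<Sum>\<sigma>\<in>{\<sigma> \<in> disc_perms (a # zs). \<sigma> a = a}. ?F \<sigma>) +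
      (\<Sum>k<length zs. \<Sum>\<sigma>\<in>{\<sigma> \<in> disc_perms (a # zs). \<sigma> a = zs ! k}. ?F \<sigma>)"
    by (simp add: sum.lessThan_Suc_shift del: sum.lessThan_Suc)
  also have "\<dots> = D w (Suc (length zs))"
    using fix0 step by (simp add: D_Suc lessThan_Suc_atMost[symmetric] add.commute)
  finally show ?case .
qed

lemma sum_disc:
  assumes "distinct xs"
  shows "(\<Sum>\<sigma>\<in>disc_perms xs. cycle_weight (unrooted \<kappa>) (set xs) \<sigma>) = m (length xs)"
proof (cases xs)
  case Nil
  have "disc_perms [] = {id}"
    by (auto simp: disc_perms_def planar_def num_cycles_def cycle_supports_def comps_def num_classes_def)
  then show ?thesis using Nil by (simp add: cycle_weight_def cycle_supports_def m_0)
next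
  case (Cons b ys)
  then show ?thesis using sum_disc_rooted[of b ys \<kappa>] assms by (simp add: rooted_same m_Suc)
qed

text \<open>Again sorted by \<open>\<sigma> a\<close>: if this is another point of the first
  boundary, the annulus splits in one of two ways; if it lies on the second boundary, the annulus is
  opened to a disc.\<close>

lemma sum_annular_rooted:
  assumes "distinct (a # zs @ ys)" "ys \<noteq> []"
  shows "(\<Sum>\<sigma>\<in>annular_perms (a # zs) ys. cycle_weight (rooted \<kappa> w a) (set (a # zs) \<union> set ys) \<sigma>) =
    T w (Suc (length zs)) (length ys)"
  using assms
proof (induction zs arbitrary: a w rule: length_induct)
  case (1 zs)
  let ?F = "\<lambda>\<sigma>. cycle_weight (rooted \<kappa> w a) (set (a # zs) \<union> set ys) \<sigma>"
  let ?n = "length zs" and ?j = "length ys"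
  have IH: "(\<Sum>\<sigma>\<in>annular_perms (a' # zs') ys. cycle_weight (rooted \<kappa> w' a') (set (a' # zs') \<union> set ys) \<sigma>) =
      T w' (Suc (length zs')) ?j"
    if "length zs' < length zs" "distinct (a' # zs' @ ys)" for a' zs' w'
    using "1.IH" that assms(2) by blast
  have IH_u: "(\<Sum>\<sigma>\<in>annular_perms xs ys. cycle_weight (unrooted \<kappa>) (set xs \<union> set ys) \<sigma>) = T \<kappa> (length xs) ?j"
    if "length xs \<le> length zs" "distinct (xs @ ys)" for xs
  proof (cases xs)
    case Nil
    then show ?thesis by (simp add: annular_perms_def T_0)
  next
    case (Cons b zs')
    then show ?thesis using IH[of zs' b \<kappa>] that by (simp add: rooted_same)
  qed
  have a: "a \<notin> set zs \<union> set ys" "distinct (zs @ ys)" using "1.prems" by auto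
  \<comment> \<open>In the last term of the recursion the other summand vanishes by
    \<open>T_0\<close>: there is no annulus with an empty first boundary.\<close>
  have fix0: "(\<Sum>\<sigma>\<in>{\<sigma> \<in> annular_perms (a # zs) ys. \<sigma> a = a}. ?F \<sigma>) = T \<kappa> ?n ?j * D (shift_weight w) 0"
  proof -
    have "?F \<sigma> = w 1 * cycle_weight (unrooted \<kappa>) (set zs \<union> set ys) \<sigma>" if "\<sigma> \<in> annular_perms zs ys" for \<sigma>
      using cycle_weight_fix[OF _ a(1) annular_perms_permutes[OF that], of "rooted \<kappa> w a"]
        cycle_weight_unrooted[OF annular_perms_permutes[OF that] a(1), of \<kappa> w]
      by (simp add: rooted_def)
    then show ?thesis
      unfolding annular_perms_fix[OF "1.prems"(1)] using IH_u[of zs] a(2)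
      by (simp add: sum_distrib_left[symmetric] D_0 mult.commute)
  qed
  have step: "(\<Sum>\<sigma>\<in>{\<sigma> \<in> annular_perms (a # zs) ys. \<sigma> a = zs ! k}. ?F \<sigma>) =
      m k * T (shift_weight w) (?n - k) ?j + T \<kappa> k ?j * D (shift_weight w) (?n - k)" if k: "k < ?n" for k
  proof -
    define g c r where "g = take k zs" and "c = zs ! k" and "r = drop (Suc k) zs"
    have zs: "zs = g @ c # r" using id_take_nth_drop[OF k] by (simp add: g_def c_def r_def)
    have d: "distinct (a # g @ c # r @ ys)" using "1.prems" zs by simp
    have S: "set (a # zs) \<union> set ys = insert a (set g \<union> (set (c # r) \<union> set ys))"
      "set (a # zs) \<union> set ys = insert a ((set g \<union> set ys) \<union> set (c # r))" unfolding zs by auto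
    have len: "length g = k" "Suc (length r) = ?n - k" using k by (simp_all add: g_def r_def)
    have disj: "set g \<inter> (set (c # r) \<union> set ys) = {}" "(set g \<union> set ys) \<inter> set (c # r) = {}"
      "a \<notin> set g \<union> (set (c # r) \<union> set ys)" "a \<notin> (set g \<union> set ys) \<union> set (c # r)"
      "distinct (c # r @ ys)" "distinct (g @ ys)" "distinct (c # r)" "distinct g" using d by auto
    let ?\<Phi> = "\<lambda>(\<sigma>1, \<sigma>2). transpose a c \<circ> (\<sigma>1 \<circ> \<sigma>2)"
    let ?A = "disc_perms g \<times> annular_perms (c # r) ys" and ?B = "annular_perms g ys \<times> disc_perms (c # r)"
    have "?F (transpose a c \<circ> (\<sigma>1 \<circ> \<sigma>2)) = cycle_weight (unrooted \<kappa>) (set g) \<sigma>1 *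
        cycle_weight (rooted \<kappa> (shift_weight w) c) (set (c # r) \<union> set ys) \<sigma>2"
      if "\<sigma>1 \<in> disc_perms g" "\<sigma>2 \<in> annular_perms (c # r) ys" for \<sigma>1 \<sigma>2
      unfolding S(1)
      by (rule cycle_weight_glue[OF _ _ disc_perms_permutes[OF that(1)] annular_perms_permutes[OF that(2)] disj(1,3)]) auto
    then have A: "(\<Sum>\<sigma>\<in>?\<Phi> ` ?A. ?F \<sigma>) =
        (\<Sum>\<sigma>\<in>disc_perms g. cycle_weight (unrooted \<kappa>) (set g) \<sigma>) *
        (\<Sum>\<sigma>\<in>annular_perms (c # r) ys. cycle_weight (rooted \<kappa> (shift_weight w) c) (set (c # r) \<union> set ys) \<sigma>)"
      by (intro sum_glue[OF disc_perms_permutes annular_perms_permutes disj(1)])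
    have "?F (transpose a c \<circ> (\<sigma>1 \<circ> \<sigma>2)) = cycle_weight (unrooted \<kappa>) (set g \<union> set ys) \<sigma>1 *
        cycle_weight (rooted \<kappa> (shift_weight w) c) (set (c # r)) \<sigma>2"
      if "\<sigma>1 \<in> annular_perms g ys" "\<sigma>2 \<in> disc_perms (c # r)" for \<sigma>1 \<sigma>2
      unfolding S(2)
      by (rule cycle_weight_glue[OF _ _ annular_perms_permutes[OF that(1)] disc_perms_permutes[OF that(2)] disj(2,4)]) auto
    then have B: "(\<Sum>\<sigma>\<in>?\<Phi> ` ?B. ?F \<sigma>) =
        (\<Sum>\<sigma>\<in>annular_perms g ys. cycle_weight (unrooted \<kappa>) (set g \<union> set ys) \<sigma>) *
        (\<Sum>\<sigma>\<in>disc_perms (c # r). cycle_weight (rooted \<kappa> (shift_weight w) c) (set (c # r)) \<sigma>)"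
      by (intro sum_glue[OF annular_perms_permutes disc_perms_permutes disj(2)])
    have "(\<Sum>\<sigma>\<in>{\<sigma> \<in> annular_perms (a # zs) ys. \<sigma> a = c}. ?F \<sigma>) = (\<Sum>\<sigma>\<in>?\<Phi> ` ?A. ?F \<sigma>) + (\<Sum>\<sigma>\<in>?\<Phi> ` ?B. ?F \<sigma>)"
      unfolding annular_perms_split[OF d, folded zs]
      by (intro sum.union_disjoint annular_perms_split_disjoint[OF d] finite_imageI finite_cartesian_product
          finite_disc_perms finite_annular_perms)
    also have "\<dots> = m k * T (shift_weight w) (?n - k) ?j + T \<kappa> k ?j * D (shift_weight w) (?n - k)"
      unfolding A B
      using sum_disc[OF disj(8)] IH[of r c "shift_weight w"] IH_u[of g] sum_disc_rooted[OF disj(7), of "shift_weight w"]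
        k disj(5,6) len by simp
    finally show ?thesis by (simp add: c_def)
  qed
  \<comment> \<open>The count on the resulting disc, with all points except \<open>a\<close>, does
    not depend on the chosen point of the second boundary. This produces the factor
    \<open>of_nat j\<close>.\<close>
  have merge: "(\<Sum>\<sigma>\<in>{\<sigma> \<in> annular_perms (a # zs) ys. \<sigma> a = ys ! k}. ?F \<sigma>) = D (shift_weight w) (?n + ?j)"
    if k: "k < ?j" for k
  proof -
    define p c q where "p = take k ys" and "c = ys ! k" and "q = drop (Suc k) ys"
    have ys: "ys = p @ c # q" using id_take_nth_drop[OF k] by (simp add: p_def c_def q_def)
    have d: "distinct (a # zs @ p @ c # q)" using "1.prems" ys by simp
    let ?S = "set (c # q @ p @ zs)"
    have S: "set (a # zs) \<union> set ys = insert a ?S" unfolding ys by auto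
    have d': "distinct (c # q @ p @ zs)" "a \<notin> ?S" "finite ?S" "c \<in> ?S" using d by auto
    have len: "length (q @ p @ zs) = ?n + ?j - 1" using ys by simp
    have "(\<Sum>\<sigma>\<in>{\<sigma> \<in> annular_perms (a # zs) ys. \<sigma> a = c}. ?F \<sigma>) =
        (\<Sum>\<sigma>\<in>disc_perms (c # q @ p @ zs). ?F (transpose a c \<circ> \<sigma>))"
      unfolding annular_perms_merge[OF d, folded ys]
      by (subst sum.reindex) (auto intro: inj_onI transpose_comp_cancel)
    also have "\<dots> = (\<Sum>\<sigma>\<in>disc_perms (c # q @ p @ zs). cycle_weight (rooted \<kappa> (shift_weight w) c) ?S \<sigma>)"
      unfolding S by (intro sum.cong refl cycle_weight_join d' disc_perms_permutes)
    also have "\<dots> = D (shift_weight w) (?n + ?j)"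
      unfolding sum_disc_rooted[OF d'(1)] len using k by (cases ?j) simp_all
    finally show ?thesis by (simp add: c_def)
  qed
  have "(\<Sum>\<sigma>\<in>annular_perms (a # zs) ys. ?F \<sigma>) =
      (\<Sum>k<length (a # zs @ ys). \<Sum>\<sigma>\<in>{\<sigma> \<in> annular_perms (a # zs) ys. \<sigma> a = (a # zs @ ys) ! k}. ?F \<sigma>)"
  proof (rule sum_by_image[OF finite_annular_perms _ "1.prems"(1)])
    show "\<sigma> permutes set (a # zs @ ys)" if "\<sigma> \<in> annular_perms (a # zs) ys" for \<sigma>
      using annular_perms_permutes[OF that] by simp
  qed simp
  also have "\<dots> = (\<Sum>\<sigma>\<in>{\<sigma> \<in> annular_perms (a # zs) ys. \<sigma> a = a}. ?F \<sigma>) +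
      (\<Sum>k<?n + ?j. \<Sum>\<sigma>\<in>{\<sigma> \<in> annular_perms (a # zs) ys. \<sigma> a = (zs @ ys) ! k}. ?F \<sigma>)"
    by (simp add: sum.lessThan_Suc_shift del: sum.lessThan_Suc)
  also have "(\<Sum>k<?n + ?j. \<Sum>\<sigma>\<in>{\<sigma> \<in> annular_perms (a # zs) ys. \<sigma> a = (zs @ ys) ! k}. ?F \<sigma>) =
      (\<Sum>k<?n. \<Sum>\<sigma>\<in>{\<sigma> \<in> annular_perms (a # zs) ys. \<sigma> a = zs ! k}. ?F \<sigma>) +
      (\<Sum>k<?j. \<Sum>\<sigma>\<in>{\<sigma> \<in> annular_perms (a # zs) ys. \<sigma> a = ys ! k}. ?F \<sigma>)"
    using sum.nat_group[of "\<lambda>_. 0"] sum.atLeastLessThan_concat[of 0 ?n "?n + ?j"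
        "\<lambda>k. \<Sum>\<sigma>\<in>{\<sigma> \<in> annular_perms (a # zs) ys. \<sigma> a = (zs @ ys) ! k}. ?F \<sigma>"]
      sum.shift_bounds_nat_ivl[of "\<lambda>k. \<Sum>\<sigma>\<in>{\<sigma> \<in> annular_perms (a # zs) ys. \<sigma> a = (zs @ ys) ! k}. ?F \<sigma>" 0 ?n ?j]
    by (simp add: lessThan_atLeast0 nth_append add.commute)
  also have "(\<Sum>k<?j. \<Sum>\<sigma>\<in>{\<sigma> \<in> annular_perms (a # zs) ys. \<sigma> a = ys ! k}. ?F \<sigma>) =
      of_nat ?j * D (shift_weight w) (?n + ?j)"
    using merge by simp
  also have "(\<Sum>k<?n. \<Sum>\<sigma>\<in>{\<sigma> \<in> annular_perms (a # zs) ys. \<sigma> a = zs ! k}. ?F \<sigma>) =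
      (\<Sum>k<?n. m k * T (shift_weight w) (?n - k) ?j + T \<kappa> k ?j * D (shift_weight w) (?n - k))"
    using step by (intro sum.cong) auto
  finally show ?case
    using fix0 by (simp add: T_Suc T_0 lessThan_Suc_atMost[symmetric] add_ac)
qed

lemma sum_annular:
  assumes "distinct (xs @ ys)" "xs \<noteq> []" "ys \<noteq> []"
  shows "(\<Sum>\<sigma>\<in>annular_perms xs ys. cycle_weight (unrooted \<kappa>) (set xs \<union> set ys) \<sigma>) = T \<kappa> (length xs) (length ys)"
  using assms sum_annular_rooted[of "hd xs" "tl xs" ys \<kappa>] by (cases xs) (simp_all add: rooted_same)

end

section \<open>From permutations to partitions\<close>

lemma cycle_supports_orbit:
  assumes "permutation \<sigma>" "V \<in> cycle_supports S \<sigma>" "x \<in> V"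
  shows "V = orbit \<sigma> x"
proof -
  obtain z where "V = orbit \<sigma> z" using assms(2) by (auto simp: cycle_supports_def)
  then show ?thesis using assms(3) orbit_eq_iff[OF assms(1), of z x] by simp
qed

lemma cycle_supports_meet:
  assumes "permutation \<sigma>" "V \<in> cycle_supports S \<sigma>" "W \<in> cycle_supports S \<sigma>" "x \<in> V" "x \<in> W"
  shows "V = W"
  using cycle_supports_orbit[OF assms(1,2,4)] cycle_supports_orbit[OF assms(1,3,5)] by simp

lemma orbit_in_cycle_supports: "x \<in> S \<Longrightarrow> orbit \<sigma> x \<in> cycle_supports S \<sigma>"
  by (simp add: cycle_supports_def)

lemma orbit_conn_iff: "permutation \<sigma> \<Longrightarrow> y \<in> orbit \<sigma> x \<longleftrightarrow> (x, y) \<in> conn (graph_of \<sigma>)"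
  by (simp add: orbit_eq_conn)

lemma Union_cycle_supports:
  assumes "finite S" "\<sigma> permutes S"
  shows "\<Union>(cycle_supports S \<sigma>) = S"
proof
  show "\<Union>(cycle_supports S \<sigma>) \<subseteq> S" using cycle_supports_subset(1)[OF assms(2)] by auto
  show "S \<subseteq> \<Union>(cycle_supports S \<sigma>)"
  proof
    fix x assume "x \<in> S"
    then show "x \<in> \<Union>(cycle_supports S \<sigma>)"
      using permutation_self_in_orbit[OF permutes_permutation[OF assms], of x]
      by (auto simp: cycle_supports_def)
  qed
qed

lemma sum_card_cycle_supports:
  assumes "finite S" "\<sigma> permutes S"
  shows "(\<Sum>V\<in>cycle_supports S \<sigma>. card V) = card S"
proof -
  have "card (\<Union>(cycle_supports S \<sigma>)) = (\<Sum>V\<in>cycle_supports S \<sigma>. card V)"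
  proof (rule card_Union_disjoint)
    show "pairwise disjnt (cycle_supports S \<sigma>)"
      using cycle_supports_meet[OF permutes_permutation[OF assms]]
      unfolding pairwise_def disjnt_def by blast
    show "finite V" if "V \<in> cycle_supports S \<sigma>" for V
      using cycle_supports_subset(1)[OF assms(2) that] assms(1) finite_subset by auto
  qed
  then show ?thesis unfolding Union_cycle_supports[OF assms] by simp
qed

lemma two_le_card_cycle:
  assumes "finite S" "\<sigma> permutes S" "\<And>x. x \<in> S \<Longrightarrow> \<sigma> x \<noteq> x" "V \<in> cycle_supports S \<sigma>"
  shows "2 \<le> card V"
proof -
  obtain x where x: "x \<in> S" "V = orbit \<sigma> x" using assms(4) by (auto simp: cycle_supports_def)
  have "{x, \<sigma> x} \<subseteq> V"
    using permutation_self_in_orbit[OF permutes_permutation[OF assms(1,2)], of x] orbit.base[of \<sigma> x] x by auto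
  moreover have "finite V"
    using cycle_supports_subset(1)[OF assms(2,4)] assms(1) finite_subset by auto
  ultimately have "card {x, \<sigma> x} \<le> card V" by (intro card_mono)
  then show ?thesis using assms(3)[OF x(1)] by simp
qed

lemma num_cycles_no_fixpoint:
  assumes "finite S" "\<sigma> permutes S" "\<And>x. x \<in> S \<Longrightarrow> \<sigma> x \<noteq> x"
  shows "2 * num_cycles S \<sigma> \<le> card S"
    and "2 * num_cycles S \<sigma> = card S \<Longrightarrow> V \<in> cycle_supports S \<sigma> \<Longrightarrow> card V = 2"
proof -
  have two: "2 \<le> card W" if "W \<in> cycle_supports S \<sigma>" for W
    by (rule two_le_card_cycle[OF assms(1,2) _ that]) (rule assms(3))
  have fin: "finite (cycle_supports S \<sigma>)" by (rule finite_cycle_supports[OF assms(1)])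
  have 2: "2 * num_cycles S \<sigma> = (\<Sum>V\<in>cycle_supports S \<sigma>. 2)" by (simp add: num_cycles_def)
  show "2 * num_cycles S \<sigma> \<le> card S"
    unfolding 2 sum_card_cycle_supports[OF assms(1,2), symmetric] by (intro sum_mono two)
  assume "2 * num_cycles S \<sigma> = card S" and V: "V \<in> cycle_supports S \<sigma>"
  then have eq: "(\<Sum>V\<in>cycle_supports S \<sigma>. 2) = (\<Sum>V\<in>cycle_supports S \<sigma>. card V)"
    unfolding sum_card_cycle_supports[OF assms(1,2)] 2 by simp
  show "card V = 2"
  proof (rule ccontr)
    assume "card V \<noteq> 2"
    then have "2 < card V" using two[OF V] by simp
    then have "(\<Sum>V\<in>cycle_supports S \<sigma>. 2) < (\<Sum>V\<in>cycle_supports S \<sigma>. card V)"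
      by (intro sum_strict_mono_ex1[OF fin]) (use two V in auto)
    then show False using eq by simp
  qed
qed

lemma cycle_supports_fix:
  assumes "finite S" "a \<notin> S" "\<sigma> permutes S"
  shows "cycle_supports (insert a S) \<sigma> = insert {a} (cycle_supports S \<sigma>)"
proof -
  have "orbit \<sigma> a = {a}" using permutes_not_in[OF assms(3,2)] orbit_eq_singleton_iff by metis
  then show ?thesis by (simp add: cycle_supports_def)
qed

lemma cycle_supports_insert:
  assumes "finite S" "a \<notin> S" "\<sigma> permutes S" "c \<in> S"
  shows "cycle_supports (insert a S) (transpose a c \<circ> \<sigma>) =
    insert (insert a (orbit \<sigma> c)) (cycle_supports S \<sigma> - {orbit \<sigma> c})"
proof -
  have p: "\<sigma> permutes insert a S" "\<sigma> a = a" using permutes_insert_fix[OF assms(2)] assms(3) by auto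
  have Oa: "orbit \<sigma> a = {a}" using p(2) orbit_eq_singleton_iff by metis
  have "{a} \<notin> cycle_supports S \<sigma>"
    using cycle_supports_subset(1)[OF assms(3), of "{a}"] assms(2) by auto
  moreover have "cycle_supports (insert a S) (transpose a c \<circ> \<sigma>) =
      insert ({a} \<union> orbit \<sigma> c) (cycle_supports (insert a S) \<sigma> - {{a}, orbit \<sigma> c})"
    using cycle_supports_join[of "insert a S" \<sigma> a c] assms p Oa by auto
  ultimately show ?thesis
    unfolding cycle_supports_fix[OF assms(1-3)] by auto
qed

text \<open>Deletes the point \<open>a\<close> from a partition, including the block {a} if there is
  one. Applied to the supports of two permutations, it carries their equality over to the reduced
  permutations.\<close>

definition shrink :: "nat \<Rightarrow> nat set set \<Rightarrow> nat set set" where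
  "shrink a P = (\<lambda>W. W - {a}) ` P - {{}}"

lemma image_Diff_id: "(\<And>V. V \<in> P \<Longrightarrow> a \<notin> V) \<Longrightarrow> (\<lambda>W. W - {a}) ` P = P"
  by (metis (no_types, lifting) Diff_empty Diff_insert0 image_cong image_ident)

lemma shrink_fix:
  assumes "finite S" "a \<notin> S" "\<sigma> permutes S"
  shows "shrink a (cycle_supports (insert a S) \<sigma>) = cycle_supports S \<sigma>"
proof -
  have "a \<notin> V \<and> V \<noteq> {}" if "V \<in> cycle_supports S \<sigma>" for V
    using cycle_supports_subset[OF assms(3) that] assms(2) by auto
  then show ?thesis
    unfolding shrink_def cycle_supports_fix[OF assms] image_insert
    by (subst image_Diff_id) auto
qed

lemma shrink_insert:
  assumes "finite S" "a \<notin> S" "\<sigma> permutes S" "c \<in> S"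
  shows "shrink a (cycle_supports (insert a S) (transpose a c \<circ> \<sigma>)) = cycle_supports S \<sigma>"
proof -
  have V: "a \<notin> V \<and> V \<noteq> {}" if "V \<in> cycle_supports S \<sigma>" for V
    using cycle_supports_subset[OF assms(3) that] assms(2) by auto
  have c: "orbit \<sigma> c \<in> cycle_supports S \<sigma>" by (rule orbit_in_cycle_supports[OF assms(4)])
  then have "insert a (orbit \<sigma> c) - {a} = orbit \<sigma> c" using V by auto
  then show ?thesis
    unfolding shrink_def cycle_supports_insert[OF assms] image_insert
    using V c by (subst image_Diff_id) auto
qed

section \<open>Through blocks and connectedness of the annulus\<close>

definition through :: "nat list \<Rightarrow> nat list \<Rightarrow> nat set \<Rightarrow> bool" where
  "through xs ys V \<longleftrightarrow> V \<inter> set xs \<noteq> {} \<and> V \<inter> set ys \<noteq> {}"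

definition two_through :: "nat list \<Rightarrow> nat list \<Rightarrow> nat set set \<Rightarrow> bool" where
  "two_through xs ys P \<longleftrightarrow> (\<exists>V\<in>P. \<exists>W\<in>P. V \<noteq> W \<and> through xs ys V \<and> through xs ys W)"

lemma through_commute: "through xs ys V \<longleftrightarrow> through ys xs V"
  by (auto simp: through_def)

lemma two_through_commute: "two_through xs ys P \<longleftrightarrow> two_through ys xs P"
  by (simp add: two_through_def through_commute[of xs ys])

lemma two_through_cong: "set xs = set xs' \<Longrightarrow> two_through xs ys P \<longleftrightarrow> two_through xs' ys P"
  by (simp add: two_through_def through_def)

lemma annular_perms_commute:
  assumes "distinct (xs @ ys)"
  shows "annular_perms xs ys = annular_perms ys xs"
proof -
  have "cyc xs \<circ> cyc ys = cyc ys \<circ> cyc xs"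
    using assms by (intro comp_disjoint_commute[OF cycle_permutes cycle_permutes]) auto
  then show ?thesis by (auto simp: annular_perms_def Un_commute)
qed

lemma annular_perms_rotate:
  assumes "distinct (p @ q)"
  shows "annular_perms (p @ q) ys = annular_perms (q @ p) ys"
  using cyc_rotate[OF assms] by (auto simp: annular_perms_def Un_commute Un_left_commute)

text \<open>Without a through cycle \<sigma> preserves each boundary, and the surface falls apart
  into two discs. A through cycle links the two boundaries, each of which is linked in
  itself.\<close>

lemma comps_eq_1_iff_through:
  assumes d: "distinct (xs @ ys)" and ne: "xs \<noteq> []" "ys \<noteq> []" and \<sigma>: "\<sigma> permutes set xs \<union> set ys"
  shows "comps (set xs \<union> set ys) \<sigma> (cyc xs \<circ> cyc ys) = 1 \<longleftrightarrow>
    (\<exists>C\<in>cycle_supports (set xs \<union> set ys) \<sigma>. through xs ys C)"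
proof -
  let ?S = "set xs \<union> set ys" and ?\<tau> = "cyc xs \<circ> cyc ys"
  have disj: "set xs \<inter> set ys = {}" and dd: "distinct xs" "distinct ys" using d by auto
  have perm: "permutation \<sigma>" using permutes_permutation[OF _ \<sigma>] by simp
  show ?thesis
  proof
    assume k: "comps ?S \<sigma> ?\<tau> = 1"
    show "\<exists>C\<in>cycle_supports ?S \<sigma>. through xs ys C"
    proof (rule ccontr)
      assume neg: "\<not> ?thesis"
      have "\<sigma> x \<in> set xs" if x: "x \<in> set xs" for x
      proof -
        have "\<not> through xs ys (orbit \<sigma> x)" using neg orbit_in_cycle_supports[of x ?S] x by auto
        moreover have "x \<in> orbit \<sigma> x" by (rule permutation_self_in_orbit[OF perm])
        ultimately have "\<sigma> x \<notin> set ys" using x orbit.base[of \<sigma> x] by (auto simp: through_def)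
        then show ?thesis using permutes_in_image[OF \<sigma>, of x] x by auto
      qed
      then obtain \<sigma>1 \<sigma>2 where s: "\<sigma>1 permutes set xs" "\<sigma>2 permutes set ys" "\<sigma> = \<sigma>1 \<circ> \<sigma>2"
        using permutes_Un_decompose[OF _ \<sigma> disj] by auto
      have "comps ?S \<sigma> ?\<tau> = comps (set xs) \<sigma>1 (cyc xs) + comps (set ys) \<sigma>2 (cyc ys)"
        unfolding s(3) by (intro comps_Un(1) s cycle_permutes disj) auto
      then show False using k comps_cyc[OF dd(1) ne(1)] comps_cyc[OF dd(2) ne(2)] by simp
    qed
  next
    assume "\<exists>C\<in>cycle_supports ?S \<sigma>. through xs ys C"
    then obtain C p q where C: "C \<in> cycle_supports ?S \<sigma>" "p \<in> C" "q \<in> C" "p \<in> set xs" "q \<in> set ys"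
      by (auto simp: through_def)
    have "C = orbit \<sigma> p" by (rule cycle_supports_orbit[OF perm C(1,2)])
    then have pq: "(p, q) \<in> linked \<sigma> ?\<tau>"
      using C(3) orbit_conn_iff[OF perm] linked_mono1 by blast
    have "(p, x) \<in> linked \<sigma> ?\<tau>" if "x \<in> ?S" for x
    proof (cases "x \<in> set xs")
      case True
      then show ?thesis using cyc_conn_comp(1)[OF dd(1) C(4) True cycle_permutes _ disj] by simp
    next
      case False
      then have "x \<in> set ys" using that by simp
      then have "(q, x) \<in> linked \<sigma> ?\<tau>"
        using cyc_conn_comp(2)[OF dd(2) C(5) _ cycle_permutes] disj by (simp add: Int_commute)
      then show ?thesis using pq conn_trans by metis
    qed
    then show "comps ?S \<sigma> ?\<tau> = 1"
      using num_classes_eq_1_iff[of ?S p] C(4) by (simp add: comps_def)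
  qed
qed

lemma num_cycles_cyc2:
  assumes "distinct (xs @ ys)" "xs \<noteq> []" "ys \<noteq> []"
  shows "num_cycles (set xs \<union> set ys) (cyc xs \<circ> cyc ys) = 2"
proof -
  have "num_cycles (set xs \<union> set ys) (cyc xs \<circ> cyc ys) = num_cycles (set xs) (cyc xs) + num_cycles (set ys) (cyc ys)"
    using assms by (intro num_cycles_Un cycle_permutes) auto
  then show ?thesis using num_cycles_cyc assms by simp
qed

lemma annular_perms_iff:
  assumes d: "distinct (xs @ ys)" and ne: "xs \<noteq> []" "ys \<noteq> []"
  shows "\<sigma> \<in> annular_perms xs ys \<longleftrightarrow> \<sigma> permutes set xs \<union> set ys \<and>
    (\<exists>C\<in>cycle_supports (set xs \<union> set ys) \<sigma>. through xs ys C) \<and>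
    num_cycles (set xs \<union> set ys) \<sigma> + num_cycles (set xs \<union> set ys) (inv \<sigma> \<circ> (cyc xs \<circ> cyc ys)) =
      card (set xs \<union> set ys)"
  using comps_eq_1_iff_through[OF assms, of \<sigma>] num_cycles_cyc2[OF assms] ne
  unfolding annular_perms_def planar_def by auto

lemma disc_perms_iff:
  assumes "distinct xs" "xs \<noteq> []"
  shows "\<sigma> \<in> disc_perms xs \<longleftrightarrow> \<sigma> permutes set xs \<and>
    num_cycles (set xs) \<sigma> + num_cycles (set xs) (inv \<sigma> \<circ> cyc xs) = card (set xs) + 1"
  using comps_cyc[OF assms, of \<sigma>] num_cycles_cyc[OF assms]
  unfolding disc_perms_def planar_def by auto

text \<open>Cutting the cycle between \<open>a\<close> and \<open>\<tau> a\<close> disconnects the surface, so \<open>a\<close> must become isolated.\<close>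

lemma adjacent_step:
  assumes fin: "finite S" and p: "\<sigma> permutes S" "\<tau> permutes S" and "planar S \<sigma> \<tau>"
    and ab: "a \<in> S" "b \<in> S" "a \<noteq> b" "(a, b) \<in> conn (graph_of \<sigma>)" "(a, b) \<in> conn (graph_of \<tau>)"
    and link: "\<And>x. x \<in> S \<Longrightarrow> x \<noteq> a \<Longrightarrow> (b, x) \<in> linked (transpose a b \<circ> \<sigma>) (transpose a b \<circ> \<tau>)"
  shows "\<sigma> a = b"
proof (rule ccontr)
  assume ne: "\<sigma> a \<noteq> b"
  let ?\<sigma> = "transpose a b \<circ> \<sigma>" and ?\<tau> = "transpose a b \<circ> \<tau>"
  have nl: "(a, b) \<notin> linked ?\<sigma> ?\<tau>"
    by (rule planar_split(3)[OF fin p ab(1-3) ab(4,5) assms(4)])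
  have "?\<sigma> a \<noteq> a"
    using ne ab(3) by (auto simp: transpose_eq_iff)
  moreover have "?\<sigma> a \<in> S"
    using permutes_in_image[OF permutes_transpose_comp[OF p(1) ab(1,2)]] ab(1) by blast
  ultimately have "(b, ?\<sigma> a) \<in> linked ?\<sigma> ?\<tau>" by (intro link)
  moreover have "(a, ?\<sigma> a) \<in> linked ?\<sigma> ?\<tau>" by (rule linked_step1)
  ultimately show False using nl conn_sym conn_trans by metis
qed

text \<open>After the cut the remaining boundary \<open>c # r\<close> links all points but
  \<open>a\<close>, as \<open>adjacent_step\<close> demands. Thus \<sigma> is known at
  \<open>a\<close> as soon as \<open>a\<close> and its boundary successor share a block.\<close>

lemma disc_adjacent:
  assumes d: "distinct (a # c # r)" and \<sigma>: "\<sigma> \<in> disc_perms (a # c # r)" and "c \<in> orbit \<sigma> a"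
  shows "\<sigma> a = c"
proof -
  have p: "\<sigma> permutes set (a # c # r)" "planar (set (a # c # r)) \<sigma> (cyc (a # c # r))"
    using \<sigma> by (auto simp: disc_perms_def)
  have perm: "permutation \<sigma>" by (rule permutes_permutation[OF _ p(1)]) simp
  have T: "transpose a c \<circ> cyc (a # c # r) = cyc (c # r)"
    by (simp add: transpose_twice)
  show ?thesis
  proof (rule adjacent_step[OF _ p(1) cycle_permutes p(2)])
    show "(a, c) \<in> conn (graph_of \<sigma>)" using assms(3) orbit_conn_iff[OF perm] by simp
    show "(a, c) \<in> conn (graph_of (cyc (a # c # r)))" by (rule cyc_conn[OF d]) auto
    show "(c, x) \<in> linked (transpose a c \<circ> \<sigma>) (transpose a c \<circ> cyc (a # c # r))"
      if "x \<in> set (a # c # r)" "x \<noteq> a" for x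
      unfolding T using that d by (intro linked_mono2 cyc_conn) auto
  qed (use d in auto)
qed

text \<open>The cut must not detach the second boundary. The through block \<open>V\<close> avoids
  \<open>a\<close>, is therefore untouched by the cut, and keeps the rest of the first boundary
  linked to the second. When the only through block contains \<open>a\<close>, the conclusion can
  fail; this is the origin of the multiplicity r s.\<close>

lemma annular_adjacent:
  assumes d: "distinct (a # c # r @ ys)" and \<sigma>: "\<sigma> \<in> annular_perms (a # c # r) ys" and c: "c \<in> orbit \<sigma> a"
    and V: "V \<in> cycle_supports (set (a # c # r) \<union> set ys) \<sigma>" "through (a # c # r) ys V" "a \<notin> V"
  shows "\<sigma> a = c"
proof -
  define xs where "xs = a # c # r"
  let ?S = "set xs \<union> set ys" and ?\<tau> = "cyc xs \<circ> cyc ys"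
  have p: "\<sigma> permutes ?S" "planar ?S \<sigma> ?\<tau>"
    using \<sigma> by (auto simp: annular_perms_def xs_def)
  have p\<tau>: "?\<tau> permutes ?S" by (intro permutes_compose permutes_subset[OF cycle_permutes]) auto
  have perm: "permutation \<sigma>" by (rule permutes_permutation[OF _ p(1)]) simp
  have dd: "distinct xs" "set xs \<inter> set ys = {}" "distinct ys" "distinct (c # r)" "set (c # r) \<inter> set ys = {}"
    "a \<noteq> c" using d by (auto simp: xs_def)
  have mem: "a \<in> ?S" "c \<in> ?S" by (auto simp: xs_def)
  have T: "transpose a c \<circ> ?\<tau> = cyc (c # r) \<circ> cyc ys"
    unfolding xs_def by (rule transpose_cyc_Cons2)
  define \<sigma>0 where "\<sigma>0 = transpose a c \<circ> \<sigma>"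
  have p0: "\<sigma>0 permutes ?S" unfolding \<sigma>0_def by (intro permutes_transpose_comp p mem)
  have ac: "(a, c) \<in> conn (graph_of \<sigma>)" using c orbit_conn_iff[OF perm] by simp
  have perm0: "permutation \<sigma>0" by (rule permutes_permutation[OF _ p0]) simp
  have nc: "c \<notin> orbit \<sigma>0 a"
    using transpose_splits[OF _ p(1) mem dd(6) ac] orbit_conn_iff[OF perm0] by (simp add: \<sigma>0_def)
  obtain x y where xy: "x \<in> V" "x \<in> set xs" "y \<in> V" "y \<in> set ys"
    using V(2) by (auto simp: through_def xs_def)
  have Vx: "V = orbit \<sigma> x" by (rule cycle_supports_orbit[OF perm V(1) xy(1)])
  have "orbit (transpose a c \<circ> \<sigma>0) x = (if x \<in> orbit \<sigma>0 a \<union> orbit \<sigma>0 c then orbit \<sigma>0 a \<union> orbit \<sigma>0 c else orbit \<sigma>0 x)"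
    by (rule orbit_join[OF _ p0 mem dd(6) nc]) simp
  moreover have "transpose a c \<circ> \<sigma>0 = \<sigma>" by (simp add: \<sigma>0_def transpose_twice)
  moreover have "a \<in> orbit \<sigma>0 a" by (rule permutation_self_in_orbit[OF perm0])
  ultimately have "V = orbit \<sigma>0 x" using Vx V(3) by (auto split: if_splits)
  then have xy0: "(x, y) \<in> linked \<sigma>0 (cyc (c # r) \<circ> cyc ys)"
    using xy(3) orbit_conn_iff[OF perm0] linked_mono1 by blast
  have x: "x \<in> set (c # r)" using xy V(3) by (auto simp: xs_def)
  show ?thesis
  proof (rule adjacent_step[OF _ p(1) p\<tau> p(2) mem dd(6) ac])
    show "(a, c) \<in> conn (graph_of ?\<tau>)"
      by (rule cyc_conn_left[OF dd(1) _ _ cycle_permutes _ dd(2)]) (auto simp: xs_def)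
    show "(c, z) \<in> linked (transpose a c \<circ> \<sigma>) (transpose a c \<circ> ?\<tau>)" if z: "z \<in> ?S" "z \<noteq> a" for z
    proof -
      have l: "(c, z) \<in> linked \<sigma>0 (cyc (c # r) \<circ> cyc ys)" if "z \<in> set (c # r)" for z
        by (rule cyc_conn_comp(1)[OF dd(4) _ that cycle_permutes _ dd(5)]) auto
      have "(c, z) \<in> linked \<sigma>0 (cyc (c # r) \<circ> cyc ys)"
      proof (cases "z \<in> set (c # r)")
        case False
        then have "z \<in> set ys" using z by (auto simp: xs_def)
        then have "(y, z) \<in> linked \<sigma>0 (cyc (c # r) \<circ> cyc ys)"
          using cyc_conn_comp(2)[OF dd(3) xy(4) _ cycle_permutes] dd(5) by (simp add: Int_commute)
        then show ?thesis using l[OF x] xy0 conn_trans by metis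
      qed (rule l)
      then show ?thesis unfolding T \<sigma>0_def .
    qed
  qed simp
qed

text \<open>A fixed point \<open>x\<close> of \<open>inv \<sigma> \<circ> \<tau>\<close> satisfies
  \<open>\<tau> x = \<sigma> x\<close>, so it falls under one of the first two cases. In the last
  case, therefore, all cycles and all faces have at least two points.\<close>

lemma reducible_cases:
  assumes fin: "finite S" and p: "\<sigma> permutes S" "\<tau> permutes S"
  obtains (fixpoint) a where "a \<in> S" "\<sigma> a = a"
    | (adjacent) a where "a \<in> S" "\<tau> a \<noteq> a" "\<tau> a \<in> orbit \<sigma> a"
    | (free) "2 * num_cycles S \<sigma> \<le> card S" "2 * num_cycles S (inv \<sigma> \<circ> \<tau>) \<le> card S"
        "2 * num_cycles S \<sigma> = card S \<Longrightarrow> \<forall>V\<in>cycle_supports S \<sigma>. card V = 2"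
proof (cases "(\<exists>a\<in>S. \<sigma> a = a) \<or> (\<exists>a\<in>S. \<tau> a \<noteq> a \<and> \<tau> a \<in> orbit \<sigma> a)")
  case True
  then show ?thesis using fixpoint adjacent by blast
next
  case False
  have nf: "\<sigma> x \<noteq> x" if "x \<in> S" for x using False that by blast
  have nf': "(inv \<sigma> \<circ> \<tau>) x \<noteq> x" if x: "x \<in> S" for x
  proof
    assume "(inv \<sigma> \<circ> \<tau>) x = x"
    then have "\<tau> x = \<sigma> x" using permutes_inv_eq[OF p(1)] by (metis comp_apply)
    then show False using False nf[OF x] x orbit.base[of \<sigma> x] by metis
  qed
  have "inv \<sigma> \<circ> \<tau> permutes S" by (rule permutes_compose[OF p(2) permutes_inv[OF p(1)]])
  note 2 = num_cycles_no_fixpoint(1)[OF fin this nf'] num_cycles_no_fixpoint[OF fin p(1) nf]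
  show ?thesis
  proof (rule free)
    show "2 * num_cycles S \<sigma> \<le> card S" by (rule 2(2))
    show "2 * num_cycles S (inv \<sigma> \<circ> \<tau>) \<le> card S" by (rule 2(1))
    show "\<forall>V\<in>cycle_supports S \<sigma>. card V = 2" if "2 * num_cycles S \<sigma> = card S"
      using 2(3)[OF _ that] by blast
  qed
qed

section \<open>Reconstructing a permutation from its cycle supports\<close>

lemma fixpoint_iff_singleton:
  assumes "a \<in> S"
  shows "\<sigma> a = a \<longleftrightarrow> {a} \<in> cycle_supports S \<sigma>"
proof
  assume "\<sigma> a = a"
  then show "{a} \<in> cycle_supports S \<sigma>"
    using orbit_eq_singleton_iff[of \<sigma> a] assms by (auto simp: cycle_supports_def)
next
  assume "{a} \<in> cycle_supports S \<sigma>"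
  then obtain x where x: "orbit \<sigma> x = {a}" by (auto simp: cycle_supports_def)
  then have "\<sigma> x = a" using orbit.base[of \<sigma> x] by auto
  then have "\<sigma> a \<in> orbit \<sigma> x" using orbit.step orbit.base by metis
  then show "\<sigma> a = a" using x by simp
qed

lemma orbit_cong_supports:
  assumes "finite S" "\<sigma> permutes S" "\<rho> permutes S" "cycle_supports S \<sigma> = cycle_supports S \<rho>" "x \<in> S"
  shows "orbit \<sigma> x = orbit \<rho> x"
proof -
  have "orbit \<sigma> x \<in> cycle_supports S \<rho>" using orbit_in_cycle_supports[OF assms(5)] assms(4) by metis
  moreover have "x \<in> orbit \<sigma> x" by (rule permutation_self_in_orbit[OF permutes_permutation[OF assms(1,2)]])
  ultimately show ?thesis by (rule cycle_supports_orbit[OF permutes_permutation[OF assms(1,3)]])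
qed

lemma involution_unique:
  assumes "finite S" "\<sigma> permutes S" "\<rho> permutes S" "cycle_supports S \<sigma> = cycle_supports S \<rho>"
    and "\<forall>V\<in>cycle_supports S \<sigma>. card V = 2"
  shows "\<sigma> = \<rho>"
proof
  fix x
  show "\<sigma> x = \<rho> x"
  proof (cases "x \<in> S")
    case True
    have O: "orbit \<sigma> x = orbit \<rho> x" by (rule orbit_cong_supports[OF assms(1-4) True])
    have "card (orbit \<sigma> x) = 2" using assms(5) orbit_in_cycle_supports[OF True] by blast
    then obtain u v where uv: "orbit \<sigma> x = {u, v}" "u \<noteq> v" by (meson card_2_iff)
    have "\<sigma> x \<in> {u, v}" "\<rho> x \<in> {u, v}" "x \<in> {u, v}"
      using uv O orbit.base permutation_self_in_orbit[OF permutes_permutation[OF assms(1,2)]] by metis+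
    moreover have "\<sigma> x \<noteq> x" using uv orbit_eq_singleton_iff[of \<sigma> x] by auto
    moreover have "\<rho> x \<noteq> x" using uv O orbit_eq_singleton_iff[of \<rho> x] by auto
    ultimately show ?thesis by auto
  next
    case False
    then show ?thesis using permutes_not_in assms(2,3) by metis
  qed
qed

lemma rotate_to_front:
  assumes "a \<in> set xs"
  obtains p q where "xs = p @ a # q"
  using assms by (meson split_list)

lemma disc_perms_contract:
  assumes "distinct (a # c # r)" "\<sigma> \<in> disc_perms (a # c # r)" "\<sigma> a = c"
  obtains \<sigma>2 where "\<sigma> = transpose a c \<circ> \<sigma>2" "\<sigma>2 \<in> disc_perms (c # r)"
proof -
  have d: "distinct (a # [] @ c # r)" using assms(1) by simp
  have "\<sigma> \<in> {\<sigma> \<in> disc_perms (a # [] @ c # r). \<sigma> a = c}" using assms by simp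
  then obtain \<sigma>1 \<sigma>2 where s: "\<sigma> = transpose a c \<circ> (\<sigma>1 \<circ> \<sigma>2)" "\<sigma>1 \<in> disc_perms []" "\<sigma>2 \<in> disc_perms (c # r)"
    unfolding disc_perms_split[OF d] by auto
  then have "\<sigma>1 = id" by (simp add: disc_perms_def)
  then show ?thesis using that[of \<sigma>2] s by simp
qed

lemma annular_perms_contract:
  assumes "distinct (a # c # r @ ys)" "\<sigma> \<in> annular_perms (a # c # r) ys" "\<sigma> a = c"
  obtains \<sigma>2 where "\<sigma> = transpose a c \<circ> \<sigma>2" "\<sigma>2 \<in> annular_perms (c # r) ys"
proof -
  have "annular_perms [] ys = {}" by (simp add: annular_perms_def)
  moreover have d: "distinct (a # [] @ c # r @ ys)" using assms(1) by simp
  moreover have "\<sigma> \<in> {\<sigma> \<in> annular_perms (a # [] @ c # r) ys. \<sigma> a = c}" using assms by simp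
  ultimately obtain \<sigma>1 \<sigma>2 where s: "\<sigma> = transpose a c \<circ> (\<sigma>1 \<circ> \<sigma>2)" "\<sigma>1 \<in> disc_perms []" "\<sigma>2 \<in> annular_perms (c # r) ys"
    unfolding annular_perms_split[OF d] by auto
  then have "\<sigma>1 = id" by (simp add: disc_perms_def)
  then show ?thesis using that[of \<sigma>2] s by simp
qed

text \<open>Fixed points and adjacent pairs are visible in the supports, so they can be removed from
  both permutations at once; \<open>shrink\<close> transfers the hypothesis to the smaller
  disc.\<close>

theorem disc_perms_inj:
  assumes "distinct xs" "\<sigma> \<in> disc_perms xs" "\<rho> \<in> disc_perms xs"
    and "cycle_supports (set xs) \<sigma> = cycle_supports (set xs) \<rho>"
  shows "\<sigma> = \<rho>"
  using assms
proof (induction "length xs" arbitrary: xs \<sigma> \<rho> rule: less_induct)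
  case less
  note perms = disc_perms_permutes[OF less.prems(2)] disc_perms_permutes[OF less.prems(3)]
  show ?case
  proof (cases "xs = []")
    case True
    then show ?thesis using perms by simp
  next
    case False
    have fin: "finite (set xs)" by simp
    show ?thesis
      using fin perms(1) cycle_permutes[of xs]
    proof (cases rule: reducible_cases)
      case (fixpoint a)
      obtain p q where xs: "xs = p @ a # q" using rotate_to_front[OF fixpoint(1)] .
      define g where "g = q @ p"
      have d: "distinct (a # g)" "a \<notin> set g" and S: "set xs = insert a (set g)"
        using less.prems(1) by (auto simp: xs g_def)
      have "disc_perms xs = disc_perms (a # g)"
        using disc_perms_rotate[of p "a # q"] less.prems(1) by (simp add: xs g_def)
      moreover have "\<rho> a = a"
        using fixpoint less.prems(4) fixpoint_iff_singleton by metis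
      ultimately have m: "\<sigma> \<in> disc_perms g" "\<rho> \<in> disc_perms g"
        using less.prems(2,3) fixpoint(2) disc_perms_fix[OF d(1)] by auto
      have "cycle_supports (set g) \<sigma> = cycle_supports (set g) \<rho>"
        using shrink_fix[OF _ d(2) disc_perms_permutes[OF m(1)]] shrink_fix[OF _ d(2) disc_perms_permutes[OF m(2)]]
          less.prems(4) S by simp
      moreover have "length g < length xs" by (simp add: xs g_def)
      ultimately show ?thesis using less.hyps m d by simp
    next
      case (adjacent a)
      obtain p q where xs: "xs = p @ a # q" using rotate_to_front[OF adjacent(1)] .
      define g where "g = q @ p"
      have rot: "cyc xs = cyc (a # g)" using cyc_rotate[of p "a # q"] less.prems(1) by (simp add: xs g_def)
      have "g \<noteq> []" using adjacent(2) rot by auto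
      then obtain c r where g: "g = c # r" by (cases g) auto
      have "distinct (a # g)" "set xs = insert a (set g)"
        using less.prems(1) by (auto simp: xs g_def)
      then have d: "distinct (a # c # r)" "a \<notin> set (c # r)" and S: "set xs = insert a (set (c # r))"
        unfolding g by auto
      have c: "cyc xs a = c" unfolding rot g by (rule cyc_Cons2_apply[OF d(1)])
      have dp: "disc_perms xs = disc_perms (a # c # r)"
        using disc_perms_rotate[of p "a # q"] less.prems(1) unfolding g[symmetric] by (simp add: xs g_def)
      have "orbit \<sigma> a = orbit \<rho> a"
        by (rule orbit_cong_supports[OF _ perms less.prems(4) adjacent(1)]) simp
      then have "\<sigma> a = c" "\<rho> a = c"
        using disc_adjacent[OF d(1)] less.prems(2,3) adjacent(3) unfolding dp c by auto
      then obtain \<sigma>2 \<rho>2 where s: "\<sigma> = transpose a c \<circ> \<sigma>2" "\<rho> = transpose a c \<circ> \<rho>2"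
        "\<sigma>2 \<in> disc_perms (c # r)" "\<rho>2 \<in> disc_perms (c # r)"
        using disc_perms_contract[OF d(1), of \<sigma>] disc_perms_contract[OF d(1), of \<rho>] less.prems(2,3)
        unfolding dp by metis
      have "cycle_supports (set (c # r)) \<sigma>2 = cycle_supports (set (c # r)) \<rho>2"
        using shrink_insert[OF _ d(2) disc_perms_permutes[OF s(3)], of c]
          shrink_insert[OF _ d(2) disc_perms_permutes[OF s(4)], of c] less.prems(4) unfolding S s(1,2) by simp
      moreover have "length (c # r) < length xs" unfolding g[symmetric] by (simp add: xs g_def)
      ultimately have "\<sigma>2 = \<rho>2" using less.hyps[of "c # r" \<sigma>2 \<rho>2] s d by simp
      then show ?thesis using s by simp
    next
      \<comment> \<open>There would be at most n/2 cycles and at most n/2 faces, whereas a planar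
        disc with n points has n + 1 of them in total; so this case is void.\<close>
      case free
      then show ?thesis
        using less.prems(2) disc_perms_iff[OF less.prems(1) False] by simp
    qed
  qed
qed

text \<open>Through blocks that agree apart from \<open>a\<close> share a point of the second
  boundary, which does not contain \<open>a\<close>, and hence coincide. So deleting
  \<open>a\<close> keeps different through blocks different.\<close>

lemma two_through_shrink:
  assumes "two_through (a # g) ys P" "a \<notin> set ys"
    and "\<And>V W x. V \<in> P \<Longrightarrow> W \<in> P \<Longrightarrow> x \<in> V \<Longrightarrow> x \<in> W \<Longrightarrow> V = W"
    and "\<And>V. V \<in> P \<Longrightarrow> through (a # g) ys V \<Longrightarrow> V \<inter> set g \<noteq> {}" and "a \<notin> set g"
  shows "two_through g ys (shrink a P)"
proof -
  obtain V W where VW: "V \<in> P" "W \<in> P" "V \<noteq> W" "through (a # g) ys V" "through (a # g) ys W"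
    using assms(1) by (auto simp: two_through_def)
  have *: "U - {a} \<in> shrink a P \<and> through g ys (U - {a})" if "U \<in> P" "through (a # g) ys U" for U
  proof -
    have "U \<inter> set g \<noteq> {}" "U \<inter> set ys \<noteq> {}" using assms(4) that by (auto simp: through_def)
    then have t: "through g ys (U - {a})" using assms(2,5) by (auto simp: through_def)
    then have "U - {a} \<noteq> {}" by (auto simp: through_def)
    then show ?thesis using t that by (auto simp: shrink_def)
  qed
  have "V - {a} \<noteq> W - {a}"
  proof
    assume eq: "V - {a} = W - {a}"
    obtain y where "y \<in> V" "y \<in> set ys" using VW(4) by (auto simp: through_def)
    then have "y \<in> W" using eq assms(2) by auto
    then show False using assms(3)[OF VW(1,2) \<open>y \<in> V\<close>] VW(3) by simp
  qed
  then show ?thesis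
    unfolding two_through_def using *[OF VW(1,4)] *[OF VW(2,5)]
    by (intro bexI[of _ "V - {a}"] bexI[of _ "W - {a}"] conjI) simp_all
qed

text \<open>One reduction at a point of the first boundary, separated from the induction so that it
  also serves the second boundary after exchanging \<open>xs\<close> and \<open>ys\<close>.\<close>

lemma annular_inj_step:
  assumes IH: "\<And>zs \<sigma> \<rho>. length zs < length xs \<Longrightarrow> distinct (zs @ ys) \<Longrightarrow> \<sigma> \<in> annular_perms zs ys \<Longrightarrow>
      \<rho> \<in> annular_perms zs ys \<Longrightarrow> cycle_supports (set zs \<union> set ys) \<sigma> = cycle_supports (set zs \<union> set ys) \<rho> \<Longrightarrow>
      two_through zs ys (cycle_supports (set zs \<union> set ys) \<sigma>) \<Longrightarrow> \<sigma> = \<rho>"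
    and d: "distinct (xs @ ys)" and m: "\<sigma> \<in> annular_perms xs ys" "\<rho> \<in> annular_perms xs ys"
    and eq: "cycle_supports (set xs \<union> set ys) \<sigma> = cycle_supports (set xs \<union> set ys) \<rho>"
    and two: "two_through xs ys (cycle_supports (set xs \<union> set ys) \<sigma>)"
    and a: "a \<in> set xs"
    and cases: "\<sigma> a = a \<or> cyc xs a \<noteq> a \<and> cyc xs a \<in> orbit \<sigma> a"
  shows "\<sigma> = \<rho>"
proof -
  note perms = annular_perms_permutes[OF m(1)] annular_perms_permutes[OF m(2)]
  obtain p q where xs: "xs = p @ a # q" using rotate_to_front[OF a] .
  define g where "g = q @ p"
  have d': "distinct (a # g @ ys)" "a \<notin> set g \<union> set ys" "a \<notin> set g" "a \<notin> set ys" and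
    S: "set xs = set (a # g)" "set xs \<union> set ys = insert a (set g \<union> set ys)"
    using d by (auto simp: xs g_def)
  have perm: "permutation \<sigma>" by (rule permutes_permutation[OF _ perms(1)]) simp
  have dpq: "distinct (p @ a # q)" using d by (auto simp: xs)
  have rot: "annular_perms xs ys = annular_perms (a # g) ys" "cyc xs = cyc (a # g)"
    using annular_perms_rotate[OF dpq, of ys] cyc_rotate[OF dpq] by (simp_all add: xs g_def)
  have two': "two_through (a # g) ys (cycle_supports (set xs \<union> set ys) \<sigma>)"
    using two two_through_cong[OF S(1)] by simp
  have len: "length g < length xs" by (simp add: xs g_def)
  note meet = cycle_supports_meet[OF perm]
  show ?thesis
  proof (cases "\<sigma> a = a")
    case True
    have "a \<in> set xs \<union> set ys" using a by simp
    then have sing: "{a} \<in> cycle_supports (set xs \<union> set ys) \<sigma>" and "\<rho> a = a"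
      using True eq fixpoint_iff_singleton by metis+
    then have m': "\<sigma> \<in> annular_perms g ys" "\<rho> \<in> annular_perms g ys"
      using m True annular_perms_fix[OF d'(1)] by (auto simp: rot)
    note sh = shrink_fix[OF _ d'(2) annular_perms_permutes[OF m'(1)]]
      shrink_fix[OF _ d'(2) annular_perms_permutes[OF m'(2)]]
    have "two_through g ys (shrink a (cycle_supports (set xs \<union> set ys) \<sigma>))"
    proof (rule two_through_shrink[OF two' d'(4) meet _ d'(3)])
      fix V assume V: "V \<in> cycle_supports (set xs \<union> set ys) \<sigma>" "through (a # g) ys V"
      have "a \<notin> V" using meet[OF V(1) sing, of a] V(2) d' by (auto simp: through_def)
      then show "V \<inter> set g \<noteq> {}" using V(2) by (auto simp: through_def)
    qed
    then have "two_through g ys (cycle_supports (set g \<union> set ys) \<sigma>)"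
      using sh(1) unfolding S(2) by simp
    moreover have "cycle_supports (set g \<union> set ys) \<sigma> = cycle_supports (set g \<union> set ys) \<rho>"
      using sh eq unfolding S(2) by simp
    ultimately show ?thesis using IH[OF len _ m'] d'(1) by simp
  next
    case False
    then have ca: "cyc xs a \<noteq> a" "cyc xs a \<in> orbit \<sigma> a" using cases by auto
    have "g \<noteq> []" using ca(1) rot by auto
    then obtain c r where g: "g = c # r" by (cases g) auto
    have c: "cyc xs a = c" unfolding rot g using d'(1) g by (intro cyc_Cons2_apply) auto
    have co: "c \<in> orbit \<sigma> a" using ca(2) c by simp
    have "orbit \<sigma> a = orbit \<rho> a"
      by (rule orbit_cong_supports[OF _ perms eq]) (use a in auto)
    then have co': "c \<in> orbit \<rho> a" using co by simp
    \<comment> \<open>There are two different through blocks, and at most one of them contains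
      \<open>a\<close>.\<close>
    obtain V where V: "V \<in> cycle_supports (set xs \<union> set ys) \<sigma>" "through (a # g) ys V" "a \<notin> V"
      using two' meet unfolding two_through_def by blast
    have Sx: "set xs \<union> set ys = set (a # c # r) \<union> set ys" using S g by auto
    have "\<sigma> a = c"
      using annular_adjacent[of a c r ys \<sigma> V] d'(1) m(1) co V unfolding rot Sx g by simp
    moreover have "\<rho> a = c"
      using annular_adjacent[of a c r ys \<rho> V] d'(1) m(2) co' V(2,3) V(1)[unfolded eq] unfolding rot Sx g by simp
    moreover have "distinct (a # c # r @ ys)" using d'(1) g by simp
    ultimately obtain \<sigma>2 \<rho>2 where s: "\<sigma> = transpose a c \<circ> \<sigma>2" "\<rho> = transpose a c \<circ> \<rho>2"
      "\<sigma>2 \<in> annular_perms g ys" "\<rho>2 \<in> annular_perms g ys"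
      using annular_perms_contract[of a c r ys \<sigma>] annular_perms_contract[of a c r ys \<rho>] m
      unfolding rot g by metis
    have cg: "c \<in> set g \<union> set ys" using g by simp
    note sh = shrink_insert[OF _ d'(2) annular_perms_permutes[OF s(3)] cg, folded s(1), folded S(2)]
      shrink_insert[OF _ d'(2) annular_perms_permutes[OF s(4)] cg, folded s(2), folded S(2)]
    have "two_through g ys (shrink a (cycle_supports (set xs \<union> set ys) \<sigma>))"
    proof (rule two_through_shrink[OF two' d'(4) meet _ d'(3)])
      fix V assume V: "V \<in> cycle_supports (set xs \<union> set ys) \<sigma>" "through (a # g) ys V"
      show "V \<inter> set g \<noteq> {}"
      proof (cases "a \<in> V")
        case True
        then have "V = orbit \<sigma> a" by (rule cycle_supports_orbit[OF perm V(1)])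
        then have "c \<in> V" using co by simp
        then show ?thesis using g by auto
      next
        case False
        then show ?thesis using V(2) by (auto simp: through_def)
      qed
    qed
    then have "two_through g ys (cycle_supports (set g \<union> set ys) \<sigma>2)" using sh(1) by simp
    moreover have "cycle_supports (set g \<union> set ys) \<sigma>2 = cycle_supports (set g \<union> set ys) \<rho>2"
      using sh eq by simp
    ultimately have "\<sigma>2 = \<rho>2" using IH[OF len _ s(3,4)] d'(1) by simp
    then show ?thesis using s by simp
  qed
qed

text \<open>Fixed points and adjacent pairs \<open>\<sigma> a = \<tau> a\<close> are determined by the cycle supports and can be
  removed. If there are none, neither \<open>\<sigma>\<close> nor \<open>\<sigma>\<inverse>\<tau>\<close> has a fixed point, and \<open>l(\<sigma>) + l(\<sigma>\<inverse>\<tau>) = n\<close>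
  forces all cycles to have length two.\<close>

theorem annular_perms_inj:
  assumes "distinct (xs @ ys)" "\<sigma> \<in> annular_perms xs ys" "\<rho> \<in> annular_perms xs ys"
    and "cycle_supports (set xs \<union> set ys) \<sigma> = cycle_supports (set xs \<union> set ys) \<rho>"
    and "two_through xs ys (cycle_supports (set xs \<union> set ys) \<sigma>)"
  shows "\<sigma> = \<rho>"
  using assms
proof (induction "length xs + length ys" arbitrary: xs ys \<sigma> \<rho> rule: less_induct)
  case less
  let ?S = "set xs \<union> set ys" and ?\<tau> = "cyc xs \<circ> cyc ys"
  note perms = annular_perms_permutes[OF less.prems(2)] annular_perms_permutes[OF less.prems(3)]
  have ne: "xs \<noteq> []" "ys \<noteq> []" using less.prems(2) by (auto simp: annular_perms_def)
  have p\<tau>: "?\<tau> permutes ?S" by (intro permutes_compose permutes_subset[OF cycle_permutes]) auto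
  have disj: "set xs \<inter> set ys = {}" and d2: "distinct (ys @ xs)" using less.prems(1) by auto
  have \<tau>x: "?\<tau> a = cyc xs a" if "a \<in> set xs" for a
  proof -
    have "a \<notin> set ys" using that disj by auto
    then show ?thesis by (simp add: id_outside_supp)
  qed
  have \<tau>y: "?\<tau> a = cyc ys a" if "a \<in> set ys" for a
  proof -
    have "cyc ys a \<notin> set xs" using permutes_in_image[OF cycle_permutes, of ys a] that disj by auto
    then show ?thesis by (simp add: id_outside_supp)
  qed
  have step: "\<sigma> = \<rho>" if a: "a \<in> ?S" and c: "\<sigma> a = a \<or> ?\<tau> a \<noteq> a \<and> ?\<tau> a \<in> orbit \<sigma> a" for a
  proof (cases "a \<in> set xs")
    case True
    show ?thesis
      by (rule annular_inj_step[OF _ less.prems(1-5) True])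
        (use less.hyps[of _ ys] c \<tau>x[OF True] in auto)
  next
    case False
    then have y: "a \<in> set ys" using a by simp
    note com = annular_perms_commute[OF less.prems(1)] Un_commute[of "set xs" "set ys"]
    show ?thesis
    proof (rule annular_inj_step[OF _ d2 _ _ _ _ y])
      show "\<sigma>' = \<rho>'" if h: "length zs < length ys" "distinct (zs @ xs)" "\<sigma>' \<in> annular_perms zs xs"
        "\<rho>' \<in> annular_perms zs xs" "cycle_supports (set zs \<union> set xs) \<sigma>' = cycle_supports (set zs \<union> set xs) \<rho>'"
        "two_through zs xs (cycle_supports (set zs \<union> set xs) \<sigma>')" for zs \<sigma>' \<rho>'
        by (rule less.hyps[of zs xs]) (use h in auto)
      show "\<sigma> \<in> annular_perms ys xs" "\<rho> \<in> annular_perms ys xs" using less.prems com by auto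
      show "cycle_supports (set ys \<union> set xs) \<sigma> = cycle_supports (set ys \<union> set xs) \<rho>"
        using less.prems(4) com by simp
      show "two_through ys xs (cycle_supports (set ys \<union> set xs) \<sigma>)"
        using less.prems(5) com two_through_commute by simp
      show "\<sigma> a = a \<or> cyc ys a \<noteq> a \<and> cyc ys a \<in> orbit \<sigma> a" using c \<tau>y[OF y] by simp
    qed
  qed
  have fin: "finite ?S" by simp
  show ?case
    using fin perms(1) p\<tau>
  proof (cases rule: reducible_cases)
    case (fixpoint a)
    then show ?thesis using step by blast
  next
    case (adjacent a)
    then show ?thesis using step by blast
  next
    case free
    have "num_cycles ?S \<sigma> + num_cycles ?S (inv \<sigma> \<circ> ?\<tau>) = card ?S"
      using less.prems(2) annular_perms_iff[OF less.prems(1) ne] by simp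
    then have "2 * num_cycles ?S \<sigma> = card ?S" using free(1,2) by linarith
    from involution_unique[OF fin perms less.prems(4) free(3)[OF this]] show ?thesis .
  qed
qed

section \<open>Annular permutations with exactly one through cycle\<close>

lemma annular_crossing:
  assumes d: "distinct (xs @ ys)" and \<sigma>: "\<sigma> \<in> annular_perms xs ys"
  obtains x where "x \<in> set xs" "\<sigma> x \<in> set ys"
proof -
  have p: "\<sigma> permutes set xs \<union> set ys" by (rule annular_perms_permutes[OF \<sigma>])
  have ne: "xs \<noteq> []" "ys \<noteq> []" and k: "comps (set xs \<union> set ys) \<sigma> (cyc xs \<circ> cyc ys) = 1"
    using \<sigma> by (auto simp: annular_perms_def)
  have dd: "distinct xs" "distinct ys" "set xs \<inter> set ys = {}" using d by auto
  have "\<exists>x\<in>set xs. \<sigma> x \<in> set ys"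
  proof (rule ccontr)
    assume neg: "\<not> ?thesis"
    have "\<sigma> x \<in> set xs" if x: "x \<in> set xs" for x
      using permutes_in_image[OF p, of x] x neg by auto
    then obtain \<sigma>1 \<sigma>2 where s: "\<sigma>1 permutes set xs" "\<sigma>2 permutes set ys" "\<sigma> = \<sigma>1 \<circ> \<sigma>2"
      using permutes_Un_decompose[OF _ p dd(3)] by auto
    have "comps (set xs \<union> set ys) \<sigma> (cyc xs \<circ> cyc ys) = comps (set xs) \<sigma>1 (cyc xs) + comps (set ys) \<sigma>2 (cyc ys)"
      unfolding s(3) by (intro comps_Un(1) s cycle_permutes dd) auto
    then show False using k comps_cyc[OF dd(1) ne(1)] comps_cyc[OF dd(2) ne(2)] by simp
  qed
  then show ?thesis using that by blast
qed

text \<open>If the cycle crossed twice, cutting it between the two arrival points on the first boundary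
  would leave these connected through the second boundary.\<close>

lemma annular_crossing_unique:
  assumes d: "distinct (xs @ ys)" and \<sigma>: "\<sigma> \<in> annular_perms xs ys"
    and x: "x \<in> set ys" "\<sigma> x \<in> set xs" and y: "y \<in> set ys" "\<sigma> y \<in> set xs" and O: "y \<in> orbit \<sigma> x"
  shows "x = y"
proof (rule ccontr)
  assume ne: "x \<noteq> y"
  let ?S = "set xs \<union> set ys" and ?\<tau> = "cyc xs \<circ> cyc ys"
  define u v where "u = \<sigma> x" and "v = \<sigma> y"
  have p: "\<sigma> permutes ?S" "planar ?S \<sigma> ?\<tau>" using \<sigma> by (auto simp: annular_perms_def)
  have perm: "permutation \<sigma>" by (rule permutes_permutation[OF _ p(1)]) simp
  have p\<tau>: "?\<tau> permutes ?S" by (intro permutes_compose permutes_subset[OF cycle_permutes]) auto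
  have dd: "distinct xs" "distinct ys" "set xs \<inter> set ys = {}" "set ys \<inter> set xs = {}" using d by auto
  have uv: "u \<in> ?S" "v \<in> ?S" "u \<noteq> v" "u \<in> set xs" "v \<in> set xs"
    using x y ne permutes_inj[OF p(1)] by (auto simp: u_def v_def inj_eq)
  have "orbit \<sigma> u = orbit \<sigma> v"
    unfolding u_def v_def permutation_orbit_step[OF perm] using O orbit_eq_iff[OF perm] by simp
  then have c1: "(u, v) \<in> conn (graph_of \<sigma>)"
    using orbit_eq_iff[OF perm] orbit_conn_iff[OF perm] by simp
  have c2: "(u, v) \<in> conn (graph_of ?\<tau>)"
    by (rule cyc_conn_left[OF dd(1) uv(4,5) cycle_permutes _ dd(3)]) simp
  let ?\<sigma> = "transpose u v \<circ> \<sigma>" and ?\<tau>0 = "(transpose u v \<circ> cyc xs) \<circ> cyc ys"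
  have nl: "(u, v) \<notin> linked ?\<sigma> ?\<tau>0"
    using planar_split(3)[OF _ p(1) p\<tau> uv(1-3) c1 c2 p(2)] by (simp add: o_assoc)
  have "transpose u v \<circ> cyc xs permutes set xs"
    by (intro permutes_transpose_comp cycle_permutes uv)
  then have "(x, y) \<in> linked ?\<sigma> ?\<tau>0"
    by (intro cyc_conn_comp(2)[OF dd(2) x(1) y(1) _ _ dd(4)]) auto
  moreover have "(x, v) \<in> linked ?\<sigma> ?\<tau>0" "(y, u) \<in> linked ?\<sigma> ?\<tau>0"
    using linked_step1[of x ?\<sigma> ?\<tau>0] linked_step1[of y ?\<sigma> ?\<tau>0] by (simp_all add: u_def v_def)
  ultimately show False using nl conn_sym conn_trans by metis
qed

text \<open>The arrow that ended in \<open>u\<close> now ends in \<open>v\<close> and conversely, so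
  that the two disc cycles are spliced into one through cycle.\<close>

definition glue :: "((nat \<Rightarrow> nat) \<times> nat) \<times> ((nat \<Rightarrow> nat) \<times> nat) \<Rightarrow> nat \<Rightarrow> nat" where
  "glue = (\<lambda>((\<sigma>1, u), (\<sigma>2, v)). transpose u v \<circ> (\<sigma>1 \<circ> \<sigma>2))"

definition join_blocks :: "(nat set set \<times> nat set) \<times> (nat set set \<times> nat set) \<Rightarrow> nat set set" where
  "join_blocks = (\<lambda>((\<pi>1, V1), (\<pi>2, V2)). insert (V1 \<union> V2) ((\<pi>1 - {V1}) \<union> (\<pi>2 - {V2})))"

text \<open>For permutations a splice is given by a point of the cycle, for partitions only by the
  block. The difference between the two kinds of marks is the multiplicity r s.\<close>

definition marked_perms :: "nat list \<Rightarrow> ((nat \<Rightarrow> nat) \<times> nat) set" where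
  "marked_perms xs = disc_perms xs \<times> set xs"

definition marked_partitions :: "nat list \<Rightarrow> (nat set set \<times> nat set) set" where
  "marked_partitions xs = (SIGMA \<pi>:cycle_supports (set xs) ` disc_perms xs. \<pi>)"

text \<open>Connectedness of the annulus provides a through cycle, so excluding two of them leaves
  exactly one.\<close>

definition one_through_perms :: "nat list \<Rightarrow> nat list \<Rightarrow> (nat \<Rightarrow> nat) set" where
  "one_through_perms xs ys =
     {\<sigma> \<in> annular_perms xs ys. \<not> two_through xs ys (cycle_supports (set xs \<union> set ys) \<sigma>)}"

context
  fixes xs ys :: "nat list"
  assumes d: "distinct (xs @ ys)"
begin

private lemma dd: "distinct xs" "distinct ys" "set xs \<inter> set ys = {}"
  using d by auto

private lemma glue_facts:
  assumes "\<sigma>1 \<in> disc_perms xs" "u \<in> set xs" "\<sigma>2 \<in> disc_perms ys" "v \<in> set ys"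
  shows "\<sigma>1 permutes set xs" "\<sigma>2 permutes set ys" "\<sigma>1 \<circ> \<sigma>2 permutes set xs \<union> set ys" "u \<noteq> v"
    "orbit (\<sigma>1 \<circ> \<sigma>2) u = orbit \<sigma>1 u" "orbit (\<sigma>1 \<circ> \<sigma>2) v = orbit \<sigma>2 v"
    "orbit \<sigma>1 u \<subseteq> set xs" "orbit \<sigma>2 v \<subseteq> set ys"
    "u \<in> orbit \<sigma>1 u" "v \<in> orbit \<sigma>2 v"
proof -
  show p: "\<sigma>1 permutes set xs" "\<sigma>2 permutes set ys" using assms disc_perms_permutes by auto
  show "\<sigma>1 \<circ> \<sigma>2 permutes set xs \<union> set ys"
    by (intro permutes_compose permutes_subset[OF p(1)] permutes_subset[OF p(2)]) auto
  show "u \<noteq> v" using assms dd by auto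
  show "orbit (\<sigma>1 \<circ> \<sigma>2) u = orbit \<sigma>1 u" by (rule orbit_comp_disjoint[OF p dd(3) assms(2)])
  show "orbit (\<sigma>1 \<circ> \<sigma>2) v = orbit \<sigma>2 v"
    unfolding comp_disjoint_commute[OF p dd(3)]
    by (rule orbit_comp_disjoint[OF p(2,1) _ assms(4)]) (use dd in auto)
  show "orbit \<sigma>1 u \<subseteq> set xs" "orbit \<sigma>2 v \<subseteq> set ys"
    using permutes_orbit_subset[OF p(1) assms(2)] permutes_orbit_subset[OF p(2) assms(4)] by auto
  show "u \<in> orbit \<sigma>1 u" "v \<in> orbit \<sigma>2 v"
    using permutes_permutation[OF _ p(1)] permutes_permutation[OF _ p(2)]
    by (simp_all add: permutation_self_in_orbit)
qed

lemma cycle_supports_glue: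
  assumes m: "\<sigma>1 \<in> disc_perms xs" "u \<in> set xs" "\<sigma>2 \<in> disc_perms ys" "v \<in> set ys"
  shows "cycle_supports (set xs \<union> set ys) (glue ((\<sigma>1, u), (\<sigma>2, v))) =
    join_blocks ((cycle_supports (set xs) \<sigma>1, orbit \<sigma>1 u), (cycle_supports (set ys) \<sigma>2, orbit \<sigma>2 v))"
proof -
  note f = glue_facts[OF m]
  have "v \<notin> orbit (\<sigma>1 \<circ> \<sigma>2) u" using f(5,7) m(4) dd(3) by auto
  then have "cycle_supports (set xs \<union> set ys) (transpose u v \<circ> (\<sigma>1 \<circ> \<sigma>2)) =
      insert (orbit (\<sigma>1 \<circ> \<sigma>2) u \<union> orbit (\<sigma>1 \<circ> \<sigma>2) v)
        (cycle_supports (set xs \<union> set ys) (\<sigma>1 \<circ> \<sigma>2) - {orbit (\<sigma>1 \<circ> \<sigma>2) u, orbit (\<sigma>1 \<circ> \<sigma>2) v})"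
    by (intro cycle_supports_join f(3,4)) (use m in auto)
  moreover have "orbit \<sigma>2 v \<notin> cycle_supports (set xs) \<sigma>1"
    using cycle_supports_disjoint[OF f(1,2) dd(3)] orbit_in_cycle_supports[OF m(4)] by blast
  moreover have "orbit \<sigma>1 u \<notin> cycle_supports (set ys) \<sigma>2"
    using cycle_supports_disjoint[OF f(1,2) dd(3)] orbit_in_cycle_supports[OF m(2)] by blast
  ultimately show ?thesis
    unfolding f(5,6) cycle_supports_Un[OF f(1,2) dd(3)] join_blocks_def glue_def by auto
qed

private lemma through_join_blocks:
  assumes \<pi>: "\<And>W. W \<in> \<pi>1 \<Longrightarrow> W \<subseteq> set xs \<and> W \<noteq> {}" "\<And>W. W \<in> \<pi>2 \<Longrightarrow> W \<subseteq> set ys \<and> W \<noteq> {}"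
    and V: "V1 \<in> \<pi>1" "V2 \<in> \<pi>2"
  shows "W \<in> join_blocks ((\<pi>1, V1), (\<pi>2, V2)) \<and> through xs ys W \<longleftrightarrow> W = V1 \<union> V2"
proof
  assume W: "W \<in> join_blocks ((\<pi>1, V1), (\<pi>2, V2)) \<and> through xs ys W"
  have "W \<notin> \<pi>1" using W \<pi>(1)[of W] dd(3) by (auto simp: through_def)
  moreover have "W \<notin> \<pi>2" using W \<pi>(2)[of W] dd(3) by (auto simp: through_def)
  ultimately show "W = V1 \<union> V2" using W by (auto simp: join_blocks_def)
next
  assume W: "W = V1 \<union> V2"
  have "V1 \<subseteq> set xs" "V1 \<noteq> {}" "V2 \<subseteq> set ys" "V2 \<noteq> {}" using \<pi> V by auto
  then show "W \<in> join_blocks ((\<pi>1, V1), (\<pi>2, V2)) \<and> through xs ys W"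
    using W by (auto simp: join_blocks_def through_def)
qed

lemma glue_one_through:
  assumes m: "\<sigma>1 \<in> disc_perms xs" "u \<in> set xs" "\<sigma>2 \<in> disc_perms ys" "v \<in> set ys"
  shows "glue ((\<sigma>1, u), (\<sigma>2, v)) \<in> one_through_perms xs ys"
proof -
  note f = glue_facts[OF m]
  let ?S = "set xs \<union> set ys" and ?\<tau> = "cyc xs \<circ> cyc ys" and ?\<sigma> = "\<sigma>1 \<circ> \<sigma>2"
  have fin: "finite (set xs)" "finite (set ys)" "finite ?S" by simp_all
  have ne: "xs \<noteq> []" "ys \<noteq> []" using m by auto
  have p\<tau>: "?\<tau> permutes ?S" by (intro permutes_compose permutes_subset[OF cycle_permutes]) auto
  have P: "planar ?S ?\<sigma> ?\<tau>"
    using planar_Un[OF fin(1,2) f(1,2) cycle_permutes cycle_permutes dd(3)] m by (simp add: disc_perms_def)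
  have nl: "(u, v) \<notin> linked ?\<sigma> ?\<tau>"
    by (rule comps_Un(2)[OF fin(1,2) f(1,2) cycle_permutes cycle_permutes dd(3) m(2,4)])
  have k: "comps ?S ?\<sigma> ?\<tau> = 2"
    using comps_Un(1)[OF fin(1,2) f(1,2) cycle_permutes cycle_permutes dd(3)]
      comps_cyc[OF dd(1) ne(1)] comps_cyc[OF dd(2) ne(2)] by simp
  have uS: "u \<in> ?S" "v \<in> ?S" using m by auto
  note j = planar_join[OF fin(3) f(3) p\<tau> uS f(4) nl P]
  have "transpose u v \<circ> ?\<sigma> permutes ?S" by (intro permutes_transpose_comp f(3) uS)
  then have "glue ((\<sigma>1, u), (\<sigma>2, v)) \<in> annular_perms xs ys"
    using j k ne by (simp add: annular_perms_def glue_def)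
  moreover have "\<not> two_through xs ys (cycle_supports ?S (glue ((\<sigma>1, u), (\<sigma>2, v))))"
  proof -
    have "W = orbit \<sigma>1 u \<union> orbit \<sigma>2 v"
      if "W \<in> cycle_supports ?S (glue ((\<sigma>1, u), (\<sigma>2, v)))" "through xs ys W" for W
      using that through_join_blocks[of "cycle_supports (set xs) \<sigma>1" "cycle_supports (set ys) \<sigma>2"
          "orbit \<sigma>1 u" "orbit \<sigma>2 v" W] cycle_supports_subset[OF f(1)] cycle_supports_subset[OF f(2)]
        orbit_in_cycle_supports[OF m(2), of \<sigma>1] orbit_in_cycle_supports[OF m(4), of \<sigma>2]
      unfolding cycle_supports_glue[OF m] by simp
    then show ?thesis unfolding two_through_def by metis
  qed
  ultimately show ?thesis by (simp add: one_through_perms_def)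
qed

text \<open>By \<open>annular_crossing_unique\<close> the single through cycle crosses only once in
  each direction. Cutting it between its two arrival points \<open>u\<close> and \<open>v\<close>
  leaves a permutation that preserves both boundaries and is still planar by
  \<open>planar_cut\<close>.\<close>

lemma one_through_is_glue:
  assumes \<sigma>: "\<sigma> \<in> one_through_perms xs ys"
  obtains \<sigma>1 u \<sigma>2 v where "\<sigma>1 \<in> disc_perms xs" "u \<in> set xs" "\<sigma>2 \<in> disc_perms ys" "v \<in> set ys"
    "\<sigma> = glue ((\<sigma>1, u), (\<sigma>2, v))"
proof -
  let ?S = "set xs \<union> set ys" and ?\<tau> = "cyc xs \<circ> cyc ys"
  have a: "\<sigma> \<in> annular_perms xs ys" and nt: "\<not> two_through xs ys (cycle_supports ?S \<sigma>)"
    using \<sigma> by (auto simp: one_through_perms_def)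
  have d2: "distinct (ys @ xs)" using d by auto
  have a2: "\<sigma> \<in> annular_perms ys xs" using a annular_perms_commute[OF d] by simp
  have p: "\<sigma> permutes ?S" "planar ?S \<sigma> ?\<tau>" using a by (auto simp: annular_perms_def)
  have perm: "permutation \<sigma>" by (rule permutes_permutation[OF _ p(1)]) simp
  have p\<tau>: "?\<tau> permutes ?S" by (intro permutes_compose permutes_subset[OF cycle_permutes]) auto
  obtain x where x: "x \<in> set xs" "\<sigma> x \<in> set ys" using annular_crossing[OF d a] .
  obtain y where y: "y \<in> set ys" "\<sigma> y \<in> set xs" using annular_crossing[OF d2 a2] .
  have self: "z \<in> orbit \<sigma> z" "\<sigma> z \<in> orbit \<sigma> z" for z
    using permutation_self_in_orbit[OF perm] orbit.base by auto
  have same: "orbit \<sigma> z = orbit \<sigma> z'"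
    if "z \<in> ?S" "z' \<in> ?S" "through xs ys (orbit \<sigma> z)" "through xs ys (orbit \<sigma> z')" for z z'
  proof (rule ccontr)
    assume "orbit \<sigma> z \<noteq> orbit \<sigma> z'"
    then show False
      using nt orbit_in_cycle_supports[OF that(1), of \<sigma>] orbit_in_cycle_supports[OF that(2), of \<sigma>] that(3,4)
      unfolding two_through_def by metis
  qed
  have th: "through xs ys (orbit \<sigma> z)" if "z \<in> set xs" "\<sigma> z \<in> set ys" for z
    using that self[of z] by (auto simp: through_def)
  have thy: "through xs ys (orbit \<sigma> y)" using y self[of y] by (auto simp: through_def)
  define u v where "u = \<sigma> y" and "v = \<sigma> x"
  have uv: "u \<in> ?S" "v \<in> ?S" "u \<noteq> v" "u \<in> set xs" "v \<in> set ys"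
    using x y dd(3) by (auto simp: u_def v_def)
  have "orbit \<sigma> u = orbit \<sigma> v"
    unfolding u_def v_def permutation_orbit_step[OF perm] using same[of y x] thy th[OF x] x y by simp
  then have c1: "(u, v) \<in> conn (graph_of \<sigma>)"
    using orbit_eq_iff[OF perm] orbit_conn_iff[OF perm] by simp
  define \<sigma>0 where "\<sigma>0 = transpose u v \<circ> \<sigma>"
  have P: "planar ?S \<sigma>0 ?\<tau>"
    unfolding \<sigma>0_def by (rule planar_cut[OF _ p(1) p\<tau> uv(1-3) c1 p(2)]) simp
  have p0: "\<sigma>0 permutes ?S" unfolding \<sigma>0_def by (intro permutes_transpose_comp p uv)
  have "\<sigma>0 z \<in> set xs" if z: "z \<in> set xs" for z
  proof (cases "z = x")
    case True
    then show ?thesis using uv by (simp add: \<sigma>0_def v_def)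
  next
    case False
    have "\<sigma> z \<notin> set ys"
    proof
      assume zy: "\<sigma> z \<in> set ys"
      have "orbit \<sigma> x = orbit \<sigma> z" using same[of x z] th[OF x] th[OF z zy] x z by simp
      then have "z \<in> orbit \<sigma> x" using self by simp
      then show False using annular_crossing_unique[OF d2 a2 x z zy] False by simp
    qed
    then have "\<sigma> z \<in> set xs" using permutes_in_image[OF p(1), of z] z by auto
    moreover have "\<sigma> z \<noteq> u"
      using permutes_inj[OF p(1)] z y(1) dd(3) by (auto simp: u_def inj_eq)
    moreover have "\<sigma> z \<noteq> v" using \<open>\<sigma> z \<notin> set ys\<close> uv by auto
    ultimately show ?thesis by (simp add: \<sigma>0_def)
  qed
  then obtain \<sigma>1 \<sigma>2 where s: "\<sigma>1 permutes set xs" "\<sigma>2 permutes set ys" "\<sigma>0 = \<sigma>1 \<circ> \<sigma>2"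
    using permutes_Un_decompose[OF _ p0 dd(3)] by auto
  have "planar (set xs) \<sigma>1 (cyc xs)" "planar (set ys) \<sigma>2 (cyc ys)"
    using P planar_Un[OF _ _ s(1,2) cycle_permutes cycle_permutes dd(3)] unfolding s(3) by simp_all
  then have "\<sigma>1 \<in> disc_perms xs" "\<sigma>2 \<in> disc_perms ys" using s by (auto simp: disc_perms_def)
  moreover have "\<sigma> = glue ((\<sigma>1, u), (\<sigma>2, v))"
    unfolding glue_def prod.case s(3)[symmetric] \<sigma>0_def transpose_twice ..
  ultimately show ?thesis using that uv by blast
qed

text \<open>A glued permutation has one arrow from the first boundary to the second, ending in
  \<open>v\<close>, and one in the opposite direction, ending in \<open>u\<close>. So the splice
  points can be read off, and undoing the splice recovers both factors.\<close>

lemma inj_on_glue_marked: "inj_on glue (marked_perms xs \<times> marked_perms ys)"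
proof (rule inj_onI)
  fix s t
  assume st: "s \<in> marked_perms xs \<times> marked_perms ys" "t \<in> marked_perms xs \<times> marked_perms ys" "glue s = glue t"
  obtain f u g v where s: "s = ((f, u), (g, v))" by (metis surj_pair)
  obtain f' u' g' v' where t: "t = ((f', u'), (g', v'))" by (metis surj_pair)
  have m: "(f, u) \<in> marked_perms xs" "(g, v) \<in> marked_perms ys" "(f', u') \<in> marked_perms xs" "(g', v') \<in> marked_perms ys"
    using st(1,2) unfolding s t mem_Sigma_iff by blast+
  have eq: "glue ((f, u), (g, v)) = glue ((f', u'), (g', v'))"
    using st(3) unfolding s t .
  have *: "v = v' \<and> u = u'" if m: "f \<in> disc_perms xs" "u \<in> set xs" "g \<in> disc_perms ys" "v \<in> set ys"
    and m': "f' \<in> disc_perms xs" "u' \<in> set xs" "g' \<in> disc_perms ys" "v' \<in> set ys"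
  proof
    note F = glue_facts[OF m] and F' = glue_facts[OF m']
    have out: "g x = x" "g' x = x" if "x \<in> set xs" for x
    proof -
      have "x \<notin> set ys" using that dd(3) by auto
      then show "g x = x" "g' x = x" using permutes_not_in[OF F(2)] permutes_not_in[OF F'(2)] by auto
    qed
    have out': "f x = x" "f' x = x" if "x \<in> set ys" for x
    proof -
      have "x \<notin> set xs" using that dd(3) by auto
      then show "f x = x" "f' x = x" using permutes_not_in[OF F(1)] permutes_not_in[OF F'(1)] by auto
    qed
    have G: "transpose u v (f (g x)) = transpose u' v' (f' (g' x))" for x
      using fun_cong[OF eq, of x] by (simp add: glue_def)
    obtain x where x: "x \<in> set xs" "f x = u" using permutes_image[OF F(1)] m(2) by (metis imageE)
    have "v = transpose u' v' (f' x)" using G[of x] x out[OF x(1)] by simp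
    moreover have "f' x \<in> set xs" using permutes_in_image[OF F'(1)] x by simp
    moreover have "v \<notin> set xs" using m dd(3) by auto
    ultimately show "v = v'" using m'(4) dd(3) by (cases "f' x = u'") (auto simp: transpose_def split: if_splits)
    obtain y where y: "y \<in> set ys" "g y = v" using permutes_image[OF F(2)] m(4) by (metis imageE)
    have "g' y \<in> set ys" using permutes_in_image[OF F'(2)] y by simp
    then have "u = transpose u' v' (g' y)" using G[of y] y out'(1)[OF m(4)] out'(2) by simp
    moreover have "u \<notin> set ys" using m dd(3) by auto
    ultimately show "u = u'" using m'(2) dd(3) \<open>g' y \<in> set ys\<close>
      by (cases "g' y = v'") (auto simp: transpose_def split: if_splits)
  qed
  then have uv: "u = u'" "v = v'" using m by (auto simp: marked_perms_def)
  have "f \<circ> g = f' \<circ> g'"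
    using eq unfolding glue_def prod.case uv by (rule transpose_comp_cancel)
  moreover have "f permutes set xs" "f' permutes set xs" "g permutes set ys" "g' permutes set ys"
    using m by (auto simp: marked_perms_def disc_perms_permutes)
  ultimately show "s = t" unfolding s t
    using comp_disjoint_inj[of f "set xs" f' g "set ys" g'] dd(3) uv by simp
qed

lemma glue_image: "glue ` (marked_perms xs \<times> marked_perms ys) = one_through_perms xs ys"
proof (intro equalityI subsetI)
  fix \<sigma> assume "\<sigma> \<in> glue ` (marked_perms xs \<times> marked_perms ys)"
  then show "\<sigma> \<in> one_through_perms xs ys"
    using glue_one_through by (auto simp: marked_perms_def)
next
  fix \<sigma> assume "\<sigma> \<in> one_through_perms xs ys"
  then obtain \<sigma>1 u \<sigma>2 v where s: "\<sigma>1 \<in> disc_perms xs" "u \<in> set xs" "\<sigma>2 \<in> disc_perms ys" "v \<in> set ys"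
    "\<sigma> = glue ((\<sigma>1, u), (\<sigma>2, v))" by (rule one_through_is_glue)
  then have "((\<sigma>1, u), (\<sigma>2, v)) \<in> marked_perms xs \<times> marked_perms ys" by (simp add: marked_perms_def)
  then show "\<sigma> \<in> glue ` (marked_perms xs \<times> marked_perms ys)" unfolding s(5) by (rule imageI)
qed

private lemma marked_partition_facts:
  assumes "(\<pi>, V) \<in> marked_partitions zs"
  shows "W \<in> \<pi> \<Longrightarrow> W \<subseteq> set zs \<and> W \<noteq> {}" "V \<in> \<pi>" "finite \<pi>"
proof -
  obtain \<sigma> where s: "\<sigma> \<in> disc_perms zs" "\<pi> = cycle_supports (set zs) \<sigma>" "V \<in> \<pi>"
    using assms by (auto simp: marked_partitions_def)
  show "W \<in> \<pi> \<Longrightarrow> W \<subseteq> set zs \<and> W \<noteq> {}"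
    using cycle_supports_subset[OF disc_perms_permutes[OF s(1)]] s(2) by auto
  show "V \<in> \<pi>" "finite \<pi>" using s finite_cycle_supports by auto
qed

text \<open>The only through block of the joined partition is the union of the marked blocks, and
  its traces on the two boundaries are the marks.\<close>

lemma inj_on_join_blocks: "inj_on join_blocks (marked_partitions xs \<times> marked_partitions ys)"
proof (rule inj_onI)
  fix s t
  assume st: "s \<in> marked_partitions xs \<times> marked_partitions ys"
    "t \<in> marked_partitions xs \<times> marked_partitions ys" "join_blocks s = join_blocks t"
  obtain p V q W where s: "s = ((p, V), (q, W))" by (metis surj_pair)
  obtain p' V' q' W' where t: "t = ((p', V'), (q', W'))" by (metis surj_pair)
  have m: "(p, V) \<in> marked_partitions xs" "(q, W) \<in> marked_partitions ys"
    "(p', V') \<in> marked_partitions xs" "(q', W') \<in> marked_partitions ys"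
    using st(1,2) unfolding s t mem_Sigma_iff by blast+
  have eq: "join_blocks ((p, V), (q, W)) = join_blocks ((p', V'), (q', W'))"
    using st(3) unfolding s t .
  note f = marked_partition_facts[OF m(1)] marked_partition_facts[OF m(2)]
    marked_partition_facts[OF m(3)] marked_partition_facts[OF m(4)]
  have "V \<union> W = V' \<union> W'"
    using through_join_blocks[OF f(1,4) f(2,5), of "V \<union> W"] through_join_blocks[OF f(7,10) f(8,11), of "V \<union> W"] eq
    by simp
  moreover have sub: "V \<subseteq> set xs" "V' \<subseteq> set xs" "W \<subseteq> set ys" "W' \<subseteq> set ys"
    using f(1)[OF f(2)] f(4)[OF f(5)] f(7)[OF f(8)] f(10)[OF f(11)] by simp_all
  moreover have "U = (U \<union> U') \<inter> set xs" "U' = (U \<union> U') \<inter> set ys" if "U \<subseteq> set xs" "U' \<subseteq> set ys" for U U'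
    using that dd(3) by auto
  ultimately have VW: "V = V'" "W = W'" by metis+
  \<comment> \<open>The traces of all blocks on one boundary give back the partition of that
    boundary; the blocks of the other one leave empty traces.\<close>
  have rec: "p = (\<lambda>U. U \<inter> set xs) ` join_blocks ((p, V), (q, W)) - {{}}"
    "q = (\<lambda>U. U \<inter> set ys) ` join_blocks ((p, V), (q, W)) - {{}}"
    if m: "(p, V) \<in> marked_partitions xs" "(q, W) \<in> marked_partitions ys" for p V q W
  proof -
    note f = marked_partition_facts[OF m(1)] marked_partition_facts[OF m(2)]
    have 1: "U \<inter> set xs = U \<and> U \<inter> set ys = {} \<and> U \<noteq> {}" if "U \<in> p" for U using f(1)[OF that] dd(3) by auto
    have 2: "U \<inter> set ys = U \<and> U \<inter> set xs = {} \<and> U \<noteq> {}" if "U \<in> q" for U using f(4)[OF that] dd(3) by auto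
    have J: "join_blocks ((p, V), (q, W)) = insert (V \<union> W) ((p - {V}) \<union> (q - {W}))" by (simp add: join_blocks_def)
    have VW: "(V \<union> W) \<inter> set xs = V" "(V \<union> W) \<inter> set ys = W" using 1[OF f(2)] 2[OF f(5)] by auto
    have ip: "(\<lambda>U. U \<inter> set xs) ` (p - {V}) = p - {V}" "(\<lambda>U. U \<inter> set ys) ` (q - {W}) = q - {W}"
      using 1 2 by (auto simp: image_iff)
    have iz: "(\<lambda>U. U \<inter> set xs) ` (q - {W}) \<subseteq> {{}}" "(\<lambda>U. U \<inter> set ys) ` (p - {V}) \<subseteq> {{}}"
      using 1 2 by auto
    have ne: "{} \<notin> p" "{} \<notin> q" using 1 2 by auto
    show "p = (\<lambda>U. U \<inter> set xs) ` join_blocks ((p, V), (q, W)) - {{}}"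
      unfolding J image_insert image_Un VW ip using iz(1) f(2) ne by auto
    show "q = (\<lambda>U. U \<inter> set ys) ` join_blocks ((p, V), (q, W)) - {{}}"
      unfolding J image_insert image_Un VW ip using iz(2) f(5) ne by auto
  qed
  have "p = p'" "q = q'"
    using rec[OF m(1,2)] rec[OF m(3,4)] eq by simp_all
  then show "s = t" unfolding s t using VW by simp
qed

lemma join_blocks_image:
  "join_blocks ` (marked_partitions xs \<times> marked_partitions ys) =
   cycle_supports (set xs \<union> set ys) ` one_through_perms xs ys"
proof (intro equalityI subsetI)
  fix P assume "P \<in> join_blocks ` (marked_partitions xs \<times> marked_partitions ys)"
  then obtain p V q W where P: "(p, V) \<in> marked_partitions xs" "(q, W) \<in> marked_partitions ys"
    "P = join_blocks ((p, V), (q, W))" by auto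
  obtain \<sigma>1 where s1: "\<sigma>1 \<in> disc_perms xs" "p = cycle_supports (set xs) \<sigma>1" "V \<in> p"
    using P by (auto simp: marked_partitions_def)
  obtain \<sigma>2 where s2: "\<sigma>2 \<in> disc_perms ys" "q = cycle_supports (set ys) \<sigma>2" "W \<in> q"
    using P by (auto simp: marked_partitions_def)
  obtain u where u: "u \<in> set xs" "V = orbit \<sigma>1 u" using s1 by (auto simp: cycle_supports_def)
  obtain v where v: "v \<in> set ys" "W = orbit \<sigma>2 v" using s2 by (auto simp: cycle_supports_def)
  have "P = cycle_supports (set xs \<union> set ys) (glue ((\<sigma>1, u), (\<sigma>2, v)))"
    unfolding cycle_supports_glue[OF s1(1) u(1) s2(1) v(1)] P(3) using s1 s2 u v by simp
  then show "P \<in> cycle_supports (set xs \<union> set ys) ` one_through_perms xs ys"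
    using glue_one_through[OF s1(1) u(1) s2(1) v(1)] by (rule image_eqI)
next
  fix P assume "P \<in> cycle_supports (set xs \<union> set ys) ` one_through_perms xs ys"
  then obtain \<sigma> where \<sigma>: "\<sigma> \<in> one_through_perms xs ys" "P = cycle_supports (set xs \<union> set ys) \<sigma>" by auto
  obtain \<sigma>1 u \<sigma>2 v where s: "\<sigma>1 \<in> disc_perms xs" "u \<in> set xs" "\<sigma>2 \<in> disc_perms ys" "v \<in> set ys"
    "\<sigma> = glue ((\<sigma>1, u), (\<sigma>2, v))" using \<sigma>(1) by (rule one_through_is_glue)
  have "P = join_blocks ((cycle_supports (set xs) \<sigma>1, orbit \<sigma>1 u), (cycle_supports (set ys) \<sigma>2, orbit \<sigma>2 v))"
    unfolding \<sigma>(2) s(5) by (rule cycle_supports_glue[OF s(1-4)])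
  moreover have "(cycle_supports (set xs) \<sigma>1, orbit \<sigma>1 u) \<in> marked_partitions xs"
    "(cycle_supports (set ys) \<sigma>2, orbit \<sigma>2 v) \<in> marked_partitions ys"
    using s orbit_in_cycle_supports by (auto simp: marked_partitions_def)
  ultimately show "P \<in> join_blocks ` (marked_partitions xs \<times> marked_partitions ys)"
    by (intro image_eqI) auto
qed

lemma prod_join_blocks:
  assumes m: "(\<pi>1, V1) \<in> marked_partitions xs" "(\<pi>2, V2) \<in> marked_partitions ys"
  shows "(\<Prod>V\<in>join_blocks ((\<pi>1, V1), (\<pi>2, V2)). (\<kappa> (card V) :: 'a::comm_monoid_mult)) =
    \<kappa> (card V1 + card V2) * ((\<Prod>V\<in>\<pi>1 - {V1}. \<kappa> (card V)) * (\<Prod>V\<in>\<pi>2 - {V2}. \<kappa> (card V)))"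
proof -
  note f = marked_partition_facts[OF m(1)] marked_partition_facts[OF m(2)]
  have sub: "V1 \<subseteq> set xs" "V2 \<subseteq> set ys" "V1 \<noteq> {}" "V2 \<noteq> {}" using f(1)[OF f(2)] f(4)[OF f(5)] by auto
  have 1: "V1 \<union> V2 \<notin> (\<pi>1 - {V1}) \<union> (\<pi>2 - {V2})"
  proof -
    have "\<not> V1 \<union> V2 \<subseteq> set xs" "\<not> V1 \<union> V2 \<subseteq> set ys" using sub dd(3) by auto
    then show ?thesis using f(1)[of "V1 \<union> V2"] f(4)[of "V1 \<union> V2"] by auto
  qed
  have 2: "(\<pi>1 - {V1}) \<inter> (\<pi>2 - {V2}) = {}"
  proof (rule ccontr)
    assume "\<not> ?thesis"
    then obtain U where "U \<in> \<pi>1" "U \<in> \<pi>2" by auto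
    then have "U \<subseteq> set xs \<inter> set ys" "U \<noteq> {}" using f(1)[of U] f(4)[of U] by auto
    then show False using dd(3) by auto
  qed
  have "card (V1 \<union> V2) = card V1 + card V2"
    using sub dd(3) by (intro card_Un_disjoint) (auto intro: finite_subset)
  then show ?thesis
    unfolding join_blocks_def prod.case using 1 2 f(3,6) by (simp add: prod.union_disjoint)
qed

end

section \<open>Sums over marked partitions and the cylinder moments\<close>

lemma cycle_weight_rooted:
  assumes "finite S" "\<sigma> permutes S" "u \<in> S"
  shows "cycle_weight (rooted \<kappa> w u) S \<sigma> =
    w (card (orbit \<sigma> u)) * (\<Prod>V\<in>cycle_supports S \<sigma> - {orbit \<sigma> u}. \<kappa> (card V))"
proof -
  note perm = permutes_permutation[OF assms(1,2)]
  have O: "orbit \<sigma> u \<in> cycle_supports S \<sigma>" "u \<in> orbit \<sigma> u"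
    using orbit_in_cycle_supports[OF assms(3)] permutation_self_in_orbit[OF perm] by auto
  have "(\<Prod>V\<in>cycle_supports S \<sigma> - {orbit \<sigma> u}. rooted \<kappa> w u V) =
      (\<Prod>V\<in>cycle_supports S \<sigma> - {orbit \<sigma> u}. \<kappa> (card V))"
  proof (rule prod.cong[OF refl])
    fix V assume V: "V \<in> cycle_supports S \<sigma> - {orbit \<sigma> u}"
    then have "u \<notin> V" using cycle_supports_orbit[OF perm, of V S u] by auto
    then show "rooted \<kappa> w u V = \<kappa> (card V)" by (simp add: rooted_def)
  qed
  then show ?thesis
    unfolding cycle_weight_def prod.remove[OF finite_cycle_supports[OF assms(1)] O(1)]
    using O(2) by (simp add: rooted_def)
qed

text \<open>Indicators fix the sizes \<open>r\<close> and \<open>s\<close> of the two marked blocks,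
  so that a weight depending on both becomes a combination of products of sums over one boundary
  each.\<close>

lemma bilinear_expand:
  fixes f :: "nat \<Rightarrow> nat \<Rightarrow> 'a::comm_semiring_1"
  assumes "\<And>p. p \<in> P \<Longrightarrow> a p \<le> i" "\<And>q. q \<in> Q \<Longrightarrow> b q \<le> j"
  shows "(\<Sum>(p, q)\<in>P \<times> Q. f (a p) (b q) * (X p * Y q)) =
    (\<Sum>r\<le>i. \<Sum>s\<le>j. f r s * ((\<Sum>p\<in>P. (if a p = r then 1 else 0) * X p) *
       (\<Sum>q\<in>Q. (if b q = s then 1 else 0) * Y q)))"
proof -
  let ?g = "\<lambda>r s p q. f r s * (((if a p = r then 1 else 0) * X p) * ((if b q = s then 1 else 0) * Y q))"
  have "(\<Sum>(p, q)\<in>P \<times> Q. f (a p) (b q) * (X p * Y q)) =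
      (\<Sum>(p, q)\<in>P \<times> Q. \<Sum>(r, s)\<in>{..i} \<times> {..j}. ?g r s p q)"
  proof (rule sum.cong[OF refl], clarify)
    fix p q assume pq: "p \<in> P" "q \<in> Q"
    have "(\<Sum>(r, s)\<in>{..i} \<times> {..j}. ?g r s p q) = (\<Sum>(r, s)\<in>{(a p, b q)}. ?g r s p q)"
      using assms pq by (intro sum.mono_neutral_right) (auto split: if_splits)
    then show "f (a p) (b q) * (X p * Y q) = (\<Sum>(r, s)\<in>{..i} \<times> {..j}. ?g r s p q)" by simp
  qed
  also have "\<dots> = (\<Sum>(r, s)\<in>{..i} \<times> {..j}. \<Sum>(p, q)\<in>P \<times> Q. ?g r s p q)"
    unfolding case_prod_unfold by (rule sum.swap)
  also have "\<dots> = (\<Sum>r\<le>i. \<Sum>s\<le>j. \<Sum>p\<in>P. \<Sum>q\<in>Q. ?g r s p q)"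
    by (simp only: sum.cartesian_product[symmetric])
  also have "\<dots> = (\<Sum>r\<le>i. \<Sum>s\<le>j. f r s * ((\<Sum>p\<in>P. (if a p = r then 1 else 0) * X p) *
       (\<Sum>q\<in>Q. (if b q = s then 1 else 0) * Y q)))"
    by (intro sum.cong refl, subst sum_product) (simp only: sum_distrib_left)
  finally show ?thesis .
qed

lemma sum_orbits:
  fixes F :: "nat set \<Rightarrow> 'a::comm_semiring_1"
  assumes "finite S" "\<sigma> permutes S"
  shows "(\<Sum>u\<in>S. F (orbit \<sigma> u)) = (\<Sum>V\<in>cycle_supports S \<sigma>. of_nat (card V) * F V)"
proof -
  note perm = permutes_permutation[OF assms]
  have "(\<Sum>u\<in>S. F (orbit \<sigma> u)) = (\<Sum>V\<in>orbit \<sigma> ` S. \<Sum>u\<in>{x \<in> S. orbit \<sigma> x = V}. F (orbit \<sigma> u))"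
    by (rule sum.image_gen[OF assms(1)])
  also have "\<dots> = (\<Sum>V\<in>cycle_supports S \<sigma>. of_nat (card V) * F V)"
    unfolding cycle_supports_def
  proof (rule sum.cong[OF refl])
    fix V assume "V \<in> orbit \<sigma> ` S"
    then have V: "V \<in> cycle_supports S \<sigma>" by (simp add: cycle_supports_def)
    have "{x \<in> S. orbit \<sigma> x = V} = V"
      using cycle_supports_orbit[OF perm V] cycle_supports_subset(1)[OF assms(2) V]
        permutation_self_in_orbit[OF perm] by auto
    moreover have "(\<Sum>u\<in>{x \<in> S. orbit \<sigma> x = V}. F (orbit \<sigma> u)) = (\<Sum>u\<in>{x \<in> S. orbit \<sigma> x = V}. F V)"
      by (rule sum.cong) auto
    ultimately show "(\<Sum>u\<in>{x \<in> S. orbit \<sigma> x = V}. F (orbit \<sigma> u)) = of_nat (card V) * F V" by simp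
  qed
  finally show ?thesis .
qed

lemma noncrossing_partitions_eq:
  assumes "a \<le> b"
  shows "noncrossing_partitions a b = cycle_supports (set [a..<Suc b]) ` disc_perms [a..<Suc b]"
proof -
  have S: "set [a..<Suc b] = {a..b}" by auto
  have "\<sigma> \<in> disc_perms [a..<Suc b] \<longleftrightarrow> \<sigma> permutes {a..b} \<and> genus_zero 1 {a..b} (interval_cycle a b) \<sigma>" for \<sigma>
    using disc_perms_iff[of "[a..<Suc b]" \<sigma>] assms unfolding S genus_zero_def interval_cycle_def by simp
  then show ?thesis
    unfolding noncrossing_partitions_def S by auto
qed

lemma annular_noncrossing_partitions_eq:
  fixes i j :: nat
  defines "xs \<equiv> [1..<Suc i]" and "ys \<equiv> [i + 1..<Suc (i + j)]"
  assumes "i \<ge> 1" "j \<ge> 1"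
  shows "annular_noncrossing_partitions i j = cycle_supports (set xs \<union> set ys) ` annular_perms xs ys"
proof -
  have S: "set xs \<union> set ys = {1..i + j}" and S12: "set xs = {1..i}" "set ys = {i + 1..i + j}"
    by (auto simp: xs_def ys_def)
  have d: "distinct (xs @ ys)" "xs \<noteq> []" "ys \<noteq> []" using assms(3,4) by (auto simp: xs_def ys_def)
  have t: "annular_tau i j = cyc xs \<circ> cyc ys"
    by (simp add: annular_tau_def interval_cycle_def xs_def ys_def)
  have "\<sigma> \<in> annular_perms xs ys \<longleftrightarrow> annular_noncrossing_perm i j \<sigma>" for \<sigma>
    unfolding annular_perms_iff[OF d] annular_noncrossing_perm_def S t genus_zero_def
    unfolding through_def S12 by auto
  then show ?thesis
    unfolding annular_noncrossing_partitions_def S by auto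
qed

context planar_counts
begin

lemma sum_marked_perms:
  assumes "distinct xs"
  shows "(\<Sum>(\<sigma>, u)\<in>marked_perms xs. cycle_weight (rooted \<kappa> w u) (set xs) \<sigma>) = of_nat (length xs) * D w (length xs)"
proof -
  have "(\<Sum>(\<sigma>, u)\<in>marked_perms xs. cycle_weight (rooted \<kappa> w u) (set xs) \<sigma>) =
      (\<Sum>u\<in>set xs. \<Sum>\<sigma>\<in>disc_perms xs. cycle_weight (rooted \<kappa> w u) (set xs) \<sigma>)"
    unfolding marked_perms_def by (subst sum.swap) (simp add: sum.cartesian_product)
  also have "\<dots> = (\<Sum>u\<in>set xs. D w (length xs))"
  proof (rule sum.cong[OF refl])
    fix u assume "u \<in> set xs"
    then obtain p q where xs: "xs = p @ u # q" by (rule rotate_to_front)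
    have "disc_perms xs = disc_perms (u # q @ p)"
      using disc_perms_rotate[of p "u # q"] assms by (simp add: xs)
    moreover have "set xs = set (u # q @ p)" "distinct (u # q @ p)" "length xs = Suc (length (q @ p))"
      using assms by (auto simp: xs)
    ultimately show "(\<Sum>\<sigma>\<in>disc_perms xs. cycle_weight (rooted \<kappa> w u) (set xs) \<sigma>) = D w (length xs)"
      using sum_disc_rooted by metis
  qed
  also have "\<dots> = of_nat (length xs) * D w (length xs)"
    by (simp add: distinct_card[OF assms])
  finally show ?thesis .
qed

end

text \<open>A block with \<open>k\<close> points is marked by each of its \<open>k\<close> points,
  so marking points instead of blocks requires the weight \<open>w k / of_nat k\<close>. By
  \<open>disc_perms_inj\<close> the sum over partitions is one over permutations.\<close>

lemma sum_marked_partitions: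
  fixes \<kappa> :: "nat \<Rightarrow> 'a::field_char_0"
  assumes "planar_counts \<kappa> m D T" and d: "distinct xs"
  shows "(\<Sum>(\<pi>, V)\<in>marked_partitions xs. w (card V) * (\<Prod>U\<in>\<pi> - {V}. \<kappa> (card U))) =
    of_nat (length xs) * D (\<lambda>k. w k / of_nat k) (length xs)"
proof -
  interpret planar_counts \<kappa> m D T by fact
  let ?S = "set xs" and ?w = "\<lambda>k. w k / of_nat k"
  have "(\<Sum>(\<pi>, V)\<in>marked_partitions xs. w (card V) * (\<Prod>U\<in>\<pi> - {V}. \<kappa> (card U))) =
      (\<Sum>\<pi>\<in>cycle_supports ?S ` disc_perms xs. \<Sum>V\<in>\<pi>. w (card V) * (\<Prod>U\<in>\<pi> - {V}. \<kappa> (card U)))"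
    unfolding marked_partitions_def
    by (rule sum.Sigma[symmetric]) (auto simp: finite_disc_perms finite_cycle_supports)
  also have "\<dots> = (\<Sum>\<sigma>\<in>disc_perms xs. \<Sum>V\<in>cycle_supports ?S \<sigma>. w (card V) * (\<Prod>U\<in>cycle_supports ?S \<sigma> - {V}. \<kappa> (card U)))"
    by (subst sum.reindex) (auto intro!: inj_onI disc_perms_inj[OF d])
  also have "\<dots> = (\<Sum>\<sigma>\<in>disc_perms xs. \<Sum>u\<in>?S. cycle_weight (rooted \<kappa> ?w u) ?S \<sigma>)"
  proof (rule sum.cong[OF refl])
    fix \<sigma> assume \<sigma>: "\<sigma> \<in> disc_perms xs"
    note p = disc_perms_permutes[OF \<sigma>]
    let ?F = "\<lambda>V. ?w (card V) * (\<Prod>U\<in>cycle_supports ?S \<sigma> - {V}. \<kappa> (card U))"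
    have "(\<Sum>u\<in>?S. cycle_weight (rooted \<kappa> ?w u) ?S \<sigma>) = (\<Sum>u\<in>?S. ?F (orbit \<sigma> u))"
      by (intro sum.cong refl cycle_weight_rooted p) auto
    also have "\<dots> = (\<Sum>V\<in>cycle_supports ?S \<sigma>. of_nat (card V) * ?F V)"
      by (rule sum_orbits[OF _ p]) simp
    also have "\<dots> = (\<Sum>V\<in>cycle_supports ?S \<sigma>. w (card V) * (\<Prod>U\<in>cycle_supports ?S \<sigma> - {V}. \<kappa> (card U)))"
    proof (rule sum.cong[OF refl])
      fix V assume "V \<in> cycle_supports ?S \<sigma>"
      then have "V \<noteq> {}" "finite V" using cycle_supports_subset[OF p] finite_subset by blast+
      then have "card V \<noteq> 0" by simp
      then show "of_nat (card V) * ?F V = w (card V) * (\<Prod>U\<in>cycle_supports ?S \<sigma> - {V}. \<kappa> (card U))"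
        by simp
    qed
    finally show "(\<Sum>V\<in>cycle_supports ?S \<sigma>. w (card V) * (\<Prod>U\<in>cycle_supports ?S \<sigma> - {V}. \<kappa> (card U))) =
        (\<Sum>u\<in>?S. cycle_weight (rooted \<kappa> ?w u) ?S \<sigma>)" by simp
  qed
  also have "\<dots> = of_nat (length xs) * D ?w (length xs)"
    using sum_marked_perms[OF d, of ?w] by (simp add: marked_perms_def sum.cartesian_product)
  finally show ?thesis .
qed

lemma card_marked_partition:
  assumes "(\<pi>, V) \<in> marked_partitions xs"
  shows "card V \<le> length xs"
proof -
  obtain \<sigma> where s: "\<sigma> \<in> disc_perms xs" "V \<in> cycle_supports (set xs) \<sigma>"
    using assms by (auto simp: marked_partitions_def)
  have "card V \<le> card (set xs)"
    using cycle_supports_subset(1)[OF disc_perms_permutes[OF s(1)] s(2)] by (intro card_mono) auto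
  then show ?thesis using card_length le_trans by blast
qed

lemma sum_marked_partition_pairs:
  fixes \<kappa> :: "nat \<Rightarrow> 'a::field_char_0"
  assumes C: "planar_counts \<kappa> m D T" and d: "distinct xs" "distinct ys"
  shows "(\<Sum>((\<pi>1, V1), (\<pi>2, V2))\<in>marked_partitions xs \<times> marked_partitions ys.
      f (card V1) (card V2) * ((\<Prod>V\<in>\<pi>1 - {V1}. \<kappa> (card V)) * (\<Prod>V\<in>\<pi>2 - {V2}. \<kappa> (card V)))) =
    (\<Sum>r\<le>length xs. \<Sum>s\<le>length ys. f r s *
      ((of_nat (length xs) * D (\<lambda>k. (if k = r then 1 else 0) / of_nat k) (length xs)) *
       (of_nat (length ys) * D (\<lambda>k. (if k = s then 1 else 0) / of_nat k) (length ys))))"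
proof -
  let ?a = "\<lambda>(\<pi> :: nat set set, V :: nat set). card V"
  let ?X = "\<lambda>(\<pi>, V). \<Prod>U\<in>\<pi> - {V}. \<kappa> (card U)"
  have "(\<Sum>((\<pi>1, V1), (\<pi>2, V2))\<in>marked_partitions xs \<times> marked_partitions ys.
      f (card V1) (card V2) * ((\<Prod>V\<in>\<pi>1 - {V1}. \<kappa> (card V)) * (\<Prod>V\<in>\<pi>2 - {V2}. \<kappa> (card V)))) =
    (\<Sum>(p, q)\<in>marked_partitions xs \<times> marked_partitions ys. f (?a p) (?a q) * (?X p * ?X q))"
    by (simp add: case_prod_unfold)
  also have "\<dots> = (\<Sum>r\<le>length xs. \<Sum>s\<le>length ys. f r s *
      ((\<Sum>p\<in>marked_partitions xs. (if ?a p = r then 1 else 0) * ?X p) *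
       (\<Sum>q\<in>marked_partitions ys. (if ?a q = s then 1 else 0) * ?X q)))"
    by (rule bilinear_expand) (auto simp: card_marked_partition)
  finally show ?thesis
    using sum_marked_partitions[OF C d(1), of "\<lambda>k. if k = _ then 1 else 0"]
      sum_marked_partitions[OF C d(2), of "\<lambda>k. if k = _ then 1 else 0"]
    by (simp add: case_prod_unfold)
qed

lemma sum_one_through_partitions:
  fixes \<kappa> :: "nat \<Rightarrow> 'a::comm_semiring_1"
  assumes "distinct (xs @ ys)"
  shows "(\<Sum>P\<in>cycle_supports (set xs \<union> set ys) ` one_through_perms xs ys. \<Prod>V\<in>P. \<kappa> (card V)) =
    (\<Sum>((\<pi>1, V1), (\<pi>2, V2))\<in>marked_partitions xs \<times> marked_partitions ys.
      \<kappa> (card V1 + card V2) * ((\<Prod>V\<in>\<pi>1 - {V1}. \<kappa> (card V)) * (\<Prod>V\<in>\<pi>2 - {V2}. \<kappa> (card V))))"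
  unfolding join_blocks_image[OF assms, symmetric]
  by (subst sum.reindex[OF inj_on_join_blocks[OF assms]])
    (auto intro!: sum.cong prod_join_blocks[OF assms])

text \<open>Here the marks are points, so the delta weights are not divided by the block size.
  Compared with \<open>sum_marked_partition_pairs\<close>, each pair of sizes gains the factor r
  s.\<close>

lemma sum_one_through_perms:
  assumes C: "planar_counts \<kappa> m D T" and d: "distinct (xs @ ys)"
  shows "(\<Sum>\<sigma>\<in>one_through_perms xs ys. cycle_weight (unrooted \<kappa>) (set xs \<union> set ys) \<sigma>) =
    (\<Sum>r\<le>length xs. \<Sum>s\<le>length ys. \<kappa> (r + s) *
      ((of_nat (length xs) * D (\<lambda>k. if k = r then 1 else 0) (length xs)) *
       (of_nat (length ys) * D (\<lambda>k. if k = s then 1 else 0) (length ys))))"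
proof -
  interpret planar_counts \<kappa> m D T by fact
  let ?S = "set xs \<union> set ys"
  have dd: "distinct xs" "distinct ys" using d by auto
  define a where "a = (\<lambda>(\<sigma>, u). card (orbit \<sigma> (u :: nat)))"
  define X where "X = (\<lambda>zs (\<sigma>, u). \<Prod>V\<in>cycle_supports (set zs) \<sigma> - {orbit \<sigma> u}. \<kappa> (card V))"
  have mp: "(cycle_supports (set zs) \<sigma>, orbit \<sigma> u) \<in> marked_partitions zs" if "(\<sigma>, u) \<in> marked_perms zs" for \<sigma> u zs
    using that orbit_in_cycle_supports by (auto simp: marked_partitions_def marked_perms_def)
  have le: "a p \<le> length zs" if "p \<in> marked_perms zs" for p zs
    using card_marked_partition[OF mp[of "fst p" "snd p" zs]] that by (simp add: a_def case_prod_unfold)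
  have "(\<Sum>\<sigma>\<in>one_through_perms xs ys. cycle_weight (unrooted \<kappa>) ?S \<sigma>) =
      (\<Sum>p\<in>marked_perms xs \<times> marked_perms ys. cycle_weight (unrooted \<kappa>) ?S (glue p))"
    unfolding glue_image[OF d, symmetric] by (subst sum.reindex[OF inj_on_glue_marked[OF d]]) simp
  also have "\<dots> = (\<Sum>(p, q)\<in>marked_perms xs \<times> marked_perms ys. \<kappa> (a p + a q) * (X xs p * X ys q))"
  proof (rule sum.cong[OF refl])
    fix t assume t: "t \<in> marked_perms xs \<times> marked_perms ys"
    obtain \<sigma>1 u \<sigma>2 v where t': "t = ((\<sigma>1, u), (\<sigma>2, v))" by (metis surj_pair)
    have m: "\<sigma>1 \<in> disc_perms xs" "u \<in> set xs" "\<sigma>2 \<in> disc_perms ys" "v \<in> set ys"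
      "(\<sigma>1, u) \<in> marked_perms xs" "(\<sigma>2, v) \<in> marked_perms ys"
      using t by (auto simp: t' marked_perms_def)
    show "cycle_weight (unrooted \<kappa>) ?S (glue t) = (case t of (p, q) \<Rightarrow> \<kappa> (a p + a q) * (X xs p * X ys q))"
      unfolding t' cycle_weight_def cycle_supports_glue[OF d m(1-4)] prod_join_blocks[OF d mp[OF m(5)] mp[OF m(6)]]
      by (simp add: a_def X_def)
  qed
  also have "\<dots> = (\<Sum>r\<le>length xs. \<Sum>s\<le>length ys. \<kappa> (r + s) *
      ((\<Sum>p\<in>marked_perms xs. (if a p = r then 1 else 0) * X xs p) *
       (\<Sum>q\<in>marked_perms ys. (if a q = s then 1 else 0) * X ys q)))"
    by (rule bilinear_expand) (auto intro: le)
  also have "\<dots> = (\<Sum>r\<le>length xs. \<Sum>s\<le>length ys. \<kappa> (r + s) *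
      ((of_nat (length xs) * D (\<lambda>k. if k = r then 1 else 0) (length xs)) *
       (of_nat (length ys) * D (\<lambda>k. if k = s then 1 else 0) (length ys))))"
  proof -
    have "(\<Sum>p\<in>marked_perms zs. (if a p = r then 1 else 0) * X zs p) =
        of_nat (length zs) * D (\<lambda>k. if k = r then 1 else 0) (length zs)" if "distinct zs" for zs r
      unfolding sum_marked_perms[OF that, symmetric]
    proof (rule sum.cong[OF refl])
      fix p assume p: "p \<in> marked_perms zs"
      obtain \<sigma> u where p': "p = (\<sigma>, u)" by (metis surj_pair)
      have "\<sigma> permutes set zs" "u \<in> set zs" using p by (auto simp: p' marked_perms_def disc_perms_permutes)
      then show "(if a p = r then 1 else 0) * X zs p =
          (case p of (\<sigma>, u) \<Rightarrow> cycle_weight (rooted \<kappa> (\<lambda>k. if k = r then 1 else 0) u) (set zs) \<sigma>)"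
        using cycle_weight_rooted[of "set zs" \<sigma> u \<kappa> "\<lambda>k. if k = r then 1 else 0"]
        by (simp add: p' a_def X_def)
    qed
    then show ?thesis using dd by simp
  qed
  finally show ?thesis .
qed

text \<open>Where there are two through cycles, passing to supports is injective and the sums over
  permutations and partitions agree. Where there is one, the sum over permutations contained in
  \<open>T\<close> is exchanged for the sum over partitions, which has the shape of the second sum
  of the moment and is combined with it.\<close>

theorem cylinder_moment_eq:
  fixes \<kappa> :: "nat \<Rightarrow> 'a::field_char_0"
  assumes C: "planar_counts \<kappa> m D T" and ij: "i \<ge> 1" "j \<ge> 1"
  shows "cylinder_moment \<kappa> \<kappa>' i j = T \<kappa> i j +
    (\<Sum>r\<le>i. \<Sum>s\<le>j. (\<kappa>' r s + \<kappa> (r + s)) *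
      ((of_nat i * D (\<lambda>k. (if k = r then 1 else 0) / of_nat k) i) *
       (of_nat j * D (\<lambda>k. (if k = s then 1 else 0) / of_nat k) j))) -
    (\<Sum>r\<le>i. \<Sum>s\<le>j. \<kappa> (r + s) *
      ((of_nat i * D (\<lambda>k. if k = r then 1 else 0) i) * (of_nat j * D (\<lambda>k. if k = s then 1 else 0) j)))"
proof -
  interpret planar_counts \<kappa> m D T by fact
  define xs ys where "xs = [1..<Suc i]" and "ys = [i + 1..<Suc (i + j)]"
  let ?S = "set xs \<union> set ys"
  have len: "length xs = i" "length ys = j" by (simp_all add: xs_def ys_def)
  have d: "distinct (xs @ ys)" "xs \<noteq> []" "ys \<noteq> []" "distinct xs" "distinct ys"
    using ij by (auto simp: xs_def ys_def)
  define two where "two = {\<sigma> \<in> annular_perms xs ys. two_through xs ys (cycle_supports ?S \<sigma>)}"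
  have un: "annular_perms xs ys = one_through_perms xs ys \<union> two" "one_through_perms xs ys \<inter> two = {}"
    by (auto simp: one_through_perms_def two_def)
  have fin: "finite (one_through_perms xs ys)" "finite two"
    using finite_annular_perms[of xs ys] un(1) by auto
  have inj: "inj_on (cycle_supports ?S) two"
    by (intro inj_onI annular_perms_inj[OF d(1)]) (auto simp: two_def)
  have disj: "cycle_supports ?S ` one_through_perms xs ys \<inter> cycle_supports ?S ` two = {}"
    by (auto simp: one_through_perms_def two_def)
  let ?M = "marked_partitions xs \<times> marked_partitions ys"
  let ?R = "\<lambda>f. \<Sum>((\<pi>1, V1), (\<pi>2, V2))\<in>?M. f (card V1) (card V2) *
      ((\<Prod>V\<in>\<pi>1 - {V1}. \<kappa> (card V)) * (\<Prod>V\<in>\<pi>2 - {V2}. \<kappa> (card V)))"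
  have 1: "(\<Sum>\<pi>\<in>annular_noncrossing_partitions i j. \<Prod>V\<in>\<pi>. \<kappa> (card V)) =
      ?R (\<lambda>r s. \<kappa> (r + s)) + (\<Sum>\<sigma>\<in>two. cycle_weight (unrooted \<kappa>) ?S \<sigma>)"
    unfolding annular_noncrossing_partitions_eq[OF ij, folded xs_def ys_def] un(1) image_Un
      sum.union_disjoint[OF finite_imageI[OF fin(1)] finite_imageI[OF fin(2)] disj]
      sum_one_through_partitions[OF d(1)] sum.reindex[OF inj] cycle_weight_def comp_def ..
  have 2: "T \<kappa> i j = (\<Sum>\<sigma>\<in>one_through_perms xs ys. cycle_weight (unrooted \<kappa>) ?S \<sigma>) +
      (\<Sum>\<sigma>\<in>two. cycle_weight (unrooted \<kappa>) ?S \<sigma>)"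
    using sum_annular[OF d(1-3)] unfolding un(1) sum.union_disjoint[OF fin un(2)] len by simp
  have 3: "(\<Sum>(\<pi>\<^sub>1, V\<^sub>1, \<pi>\<^sub>2, V\<^sub>2) \<in> {(\<pi>\<^sub>1, V\<^sub>1, \<pi>\<^sub>2, V\<^sub>2).
           \<pi>\<^sub>1 \<in> noncrossing_partitions 1 i \<and> V\<^sub>1 \<in> \<pi>\<^sub>1 \<and>
           \<pi>\<^sub>2 \<in> noncrossing_partitions (i + 1) (i + j) \<and> V\<^sub>2 \<in> \<pi>\<^sub>2}.
        \<kappa>' (card V\<^sub>1) (card V\<^sub>2) *
        (\<Prod>V \<in> \<pi>\<^sub>1 - {V\<^sub>1}. \<kappa> (card V)) * (\<Prod>V \<in> \<pi>\<^sub>2 - {V\<^sub>2}. \<kappa> (card V))) = ?R \<kappa>'"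
  proof -
    let ?U = "{(\<pi>\<^sub>1, V\<^sub>1, \<pi>\<^sub>2, V\<^sub>2). \<pi>\<^sub>1 \<in> noncrossing_partitions 1 i \<and> V\<^sub>1 \<in> \<pi>\<^sub>1 \<and>
           \<pi>\<^sub>2 \<in> noncrossing_partitions (i + 1) (i + j) \<and> V\<^sub>2 \<in> \<pi>\<^sub>2}"
    have nc: "noncrossing_partitions 1 i = cycle_supports (set xs) ` disc_perms xs"
      "noncrossing_partitions (i + 1) (i + j) = cycle_supports (set ys) ` disc_perms ys"
      using noncrossing_partitions_eq[of 1 i] noncrossing_partitions_eq[of "i + 1" "i + j"] ij
      by (simp_all add: xs_def ys_def)
    have U: "bij_betw (\<lambda>((p, V), (q, W)). (p, V, q, W)) ?M ?U"
      unfolding nc marked_partitions_def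
      by (intro bij_betwI[of _ _ _ "\<lambda>(p, V, q, W). ((p, V), (q, W))"]) auto
    show ?thesis
      by (subst sum.reindex_bij_betw[OF U, symmetric]) (simp add: case_prod_unfold mult.assoc)
  qed
  have "cylinder_moment \<kappa> \<kappa>' i j = ?R (\<lambda>r s. \<kappa> (r + s)) + (\<Sum>\<sigma>\<in>two. cycle_weight (unrooted \<kappa>) ?S \<sigma>) + ?R \<kappa>'"
    unfolding cylinder_moment_def 1 3 ..
  also have "\<dots> = T \<kappa> i j + ?R (\<lambda>r s. \<kappa>' r s + \<kappa> (r + s)) -
      (\<Sum>\<sigma>\<in>one_through_perms xs ys. cycle_weight (unrooted \<kappa>) ?S \<sigma>)"
    unfolding 2 by (simp add: case_prod_unfold distrib_right sum.distrib algebra_simps)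
  also have "?R (\<lambda>r s. \<kappa>' r s + \<kappa> (r + s)) = (\<Sum>r\<le>i. \<Sum>s\<le>j. (\<kappa>' r s + \<kappa> (r + s)) *
      ((of_nat i * D (\<lambda>k. (if k = r then 1 else 0) / of_nat k) i) *
       (of_nat j * D (\<lambda>k. (if k = s then 1 else 0) / of_nat k) j)))"
    using sum_marked_partition_pairs[OF C d(4,5), of "\<lambda>r s. \<kappa>' r s + \<kappa> (r + s)"] unfolding len .
  finally show ?thesis
    unfolding sum_one_through_perms[OF C d(1)] len .
qed

section \<open>Formal power series in two variables\<close>

definition fps_map :: "('a::zero \<Rightarrow> 'b::zero) \<Rightarrow> 'a fps \<Rightarrow> 'b fps" where
  "fps_map h F = Abs_fps (\<lambda>n. h (F $ n))"

lemma fps_map_nth [simp]: "fps_map h F $ n = h (F $ n)"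
  by (simp add: fps_map_def)

text \<open>Change of coefficients, substitution and the embedding into Laurent series are all ring
  homomorphisms, and power series identities are transported along each of them.\<close>

locale fps_hom =
  fixes h :: "'a::comm_ring_1 \<Rightarrow> 'b::comm_ring_1"
  assumes add: "h (a + b) = h a + h b" and mult: "h (a * b) = h a * h b" and one: "h 1 = 1"
begin

lemma zero: "h 0 = 0"
  using add[of 0 0] by simp

lemma diff: "h (a - b) = h a - h b"
  using add[of "a - b" b] by simp

lemma sum: "h (\<Sum>i\<in>A. f i) = (\<Sum>i\<in>A. h (f i))"
  by (induction A rule: infinite_finite_induct) (simp_all add: zero add)

lemma map_add: "fps_map h (F + G) = fps_map h F + fps_map h G"
  by (simp add: fps_eq_iff add)

lemma map_diff: "fps_map h (F - G) = fps_map h F - fps_map h G"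
  by (simp add: fps_eq_iff diff)

lemma map_mult: "fps_map h (F * G) = fps_map h F * fps_map h G"
  by (simp add: fps_eq_iff fps_mult_nth sum mult)

lemma map_one: "fps_map h 1 = 1"
  by (simp add: fps_eq_iff one zero)

lemma map_X: "fps_map h fps_X = fps_X"
  by (simp add: fps_eq_iff one zero)

lemma map_const: "fps_map h (fps_const c) = fps_const (h c)"
  by (simp add: fps_eq_iff zero)

lemma map_power: "fps_map h (F ^ n) = fps_map h F ^ n"
  by (induction n) (simp_all add: map_one map_mult)

lemma map_compose: "fps_map h (F oo G) = fps_map h F oo fps_map h G"
  by (simp add: fps_eq_iff fps_compose_nth sum mult map_power[symmetric])

end

interpretation const_hom: fps_hom "fps_const :: 'a::comm_ring_1 \<Rightarrow> 'a fps"
  by unfold_locales simp_all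

interpretation to_fls_hom: fps_hom "fps_to_fls :: 'a::comm_ring_1 fps \<Rightarrow> 'a fls"
  by unfold_locales (simp_all add: fls_times_fps_to_fls)

lemma compose_hom: "p $ 0 = 0 \<Longrightarrow> fps_hom (\<lambda>f. f oo p :: 'a::idom fps)"
  by unfold_locales (simp_all add: fps_compose_add_distrib fps_compose_mult_distrib)

text \<open>A series in two variables is a power series in the second variable \<open>z\<^sub>2\<close> over power series in
  the first variable \<open>z\<^sub>1\<close>; \<open>ser1\<close> and \<open>ser2\<close> embed series in \<open>z\<^sub>1\<close> and in \<open>z\<^sub>2\<close>.\<close>

abbreviation ser1 :: "'a::comm_ring_1 fps \<Rightarrow> 'a fps fps" where
  "ser1 f \<equiv> fps_const f"

definition ser2 :: "'a::comm_ring_1 fps \<Rightarrow> 'a fps fps" where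
  "ser2 f = fps_map fps_const f"

lemma ser2_nth [simp]: "ser2 f $ n = fps_const (f $ n)"
  by (simp add: ser2_def)

lemma ser2_simps:
  "ser2 (f + g) = ser2 f + ser2 g" "ser2 (f - g) = ser2 f - ser2 g" "ser2 (f * g) = ser2 f * ser2 g"
  "ser2 (f ^ n) = ser2 f ^ n" "ser2 fps_X = fps_X" "ser2 (f oo g) = ser2 f oo ser2 g" "ser2 1 = 1"
  unfolding ser2_def
  by (rule const_hom.map_add const_hom.map_diff const_hom.map_mult const_hom.map_power const_hom.map_X
      const_hom.map_compose const_hom.map_one)+

lemma ser2_const: "ser2 (fps_const c) = ser1 (fps_const c)"
  unfolding ser2_def by (rule const_hom.map_const)

lemma ser2_deriv: "fps_deriv (ser2 f) = ser2 (fps_deriv f)"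
proof (rule fps_ext)
  fix n
  have "of_nat (n + 1) = fps_const (of_nat (n + 1) :: 'a)" by (rule fps_of_nat[symmetric])
  then show "fps_deriv (ser2 f) $ n = ser2 (fps_deriv f) $ n" by (simp del: of_nat_Suc of_nat_add)
qed

definition comp2 :: "'a::idom fps fps \<Rightarrow> 'a fps \<Rightarrow> 'a fps \<Rightarrow> 'a fps fps" where
  "comp2 F p q = fps_map (\<lambda>f. f oo p) F oo ser2 q"

context
  fixes p q :: "'a::idom fps"
  assumes p0: "p $ 0 = 0" and q0: "q $ 0 = 0"
begin

interpretation P: fps_hom "\<lambda>f. f oo p" by (rule compose_hom[OF p0])

lemma comp2_hom: "fps_hom (\<lambda>F. comp2 F p q)"
  by unfold_locales
    (simp_all add: comp2_def P.map_add P.map_mult P.map_one fps_compose_add_distrib fps_compose_mult_distrib q0)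

lemma comp2_ser1: "comp2 (ser1 f) p q = ser1 (f oo p)"
  by (simp add: comp2_def P.map_const)

lemma map_compose_ser2: "fps_map (\<lambda>f. f oo p) (ser2 g) = ser2 g"
  by (simp add: fps_eq_iff)

lemma comp2_ser2: "comp2 (ser2 g) p q = ser2 (g oo q)"
  by (simp add: comp2_def map_compose_ser2 ser2_simps)

lemma comp2_inverse:
  assumes "p' $ 0 = 0" "q' $ 0 = 0" "p' oo p = fps_X" "q' oo q = fps_X"
  shows "comp2 (comp2 F p' q') p q = F"
proof -
  have "fps_map (\<lambda>f. f oo p) (fps_map (\<lambda>f. f oo p') F oo ser2 q') =
      fps_map (\<lambda>f. f oo p) (fps_map (\<lambda>f. f oo p') F) oo ser2 q'"
    by (simp add: P.map_compose map_compose_ser2)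
  also have "fps_map (\<lambda>f. f oo p) (fps_map (\<lambda>f. f oo p') F) = F"
    by (simp add: fps_eq_iff fps_compose_assoc[OF p0 assms(1), symmetric] assms(3))
  finally have "comp2 (comp2 F p' q') p q = (F oo ser2 q') oo ser2 q"
    by (simp add: comp2_def)
  also have "\<dots> = F oo (ser2 q' oo ser2 q)"
    by (rule fps_compose_assoc[symmetric]) (simp_all add: q0 assms(2))
  also have "ser2 q' oo ser2 q = fps_X"
    unfolding ser2_simps(6)[symmetric] assms(4) by (rule ser2_simps)
  finally show ?thesis by simp
qed

end

text \<open>The power \<open>q ^ s\<close> starts in degree \<open>s\<close> or later, so all inner
  sums may be extended or cut off uniformly at \<open>n\<close>.\<close>

lemma mult_compose_nth:
  fixes c :: "'a::idom fps"
  assumes "q $ 0 = 0"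
  shows "(c * (G oo q)) $ n = (\<Sum>s\<le>n. G $ s * (c * q ^ s) $ n)"
proof -
  have z: "(q ^ s) $ k = 0" if "k < s" for k s
    using startsby_zero_power_prefix[OF assms] that by blast
  have "(G oo q) $ k = (\<Sum>s\<le>n. G $ s * (q ^ s) $ k)" if "k \<le> n" for k
    unfolding fps_compose_nth using that z
    by (intro sum.mono_neutral_left) (auto simp: atLeast0AtMost)
  then have "(c * (G oo q)) $ n = (\<Sum>i=0..n. c $ i * (\<Sum>s\<le>n. G $ s * (q ^ s) $ (n - i)))"
    by (simp add: fps_mult_nth)
  also have "\<dots> = (\<Sum>s\<le>n. \<Sum>i=0..n. c $ i * (G $ s * (q ^ s) $ (n - i)))"
    unfolding sum_distrib_left by (rule sum.swap)
  also have "\<dots> = (\<Sum>s\<le>n. G $ s * (c * q ^ s) $ n)"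
    by (simp add: fps_mult_nth sum_distrib_left mult_ac)
  finally show ?thesis .
qed

lemma comp2_nth:
  assumes "p $ 0 = 0" "q $ 0 = 0"
  shows "(ser1 f * ser2 g * comp2 F p q) $ j $ i =
    (\<Sum>s\<le>j. \<Sum>r\<le>i. F $ s $ r * (f * p ^ r) $ i * (g * q ^ s) $ j)"
proof -
  have "(ser2 g * comp2 F p q) $ j = (\<Sum>s\<le>j. (F $ s oo p) * fps_const ((g * q ^ s) $ j))"
    unfolding comp2_def
    by (subst mult_compose_nth) (simp_all add: assms ser2_simps(3,4)[symmetric])
  then have "(ser1 f * ser2 g * comp2 F p q) $ j =
      (\<Sum>s\<le>j. f * (F $ s oo p) * fps_const ((g * q ^ s) $ j))"
    by (simp add: mult.assoc sum_distrib_left)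
  then have "(ser1 f * ser2 g * comp2 F p q) $ j $ i =
      (\<Sum>s\<le>j. (f * (F $ s oo p)) $ i * (g * q ^ s) $ j)"
    by (simp add: fps_sum_nth)
  also have "\<dots> = (\<Sum>s\<le>j. \<Sum>r\<le>i. F $ s $ r * (f * p ^ r) $ i * (g * q ^ s) $ j)"
    by (simp add: mult_compose_nth[OF assms(1)] sum_distrib_right)
  finally show ?thesis .
qed

text \<open>This is z1 z2 times the divided difference of \<open>u\<close>, as
  \<open>hankel_eq\<close> shows. Giving the coefficients directly avoids a division by z1 -
  z2.\<close>

definition hankel :: "'a::comm_ring_1 fps \<Rightarrow> 'a fps fps" where
  "hankel u = Abs_fps (\<lambda>j. Abs_fps (\<lambda>n. if n \<ge> 1 \<and> j \<ge> 1 then u $ (n + j - 1) else 0))"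

lemma hankel_eq:
  "(ser1 fps_X - fps_X) * hankel u = ser1 fps_X * fps_X * (ser1 u - ser2 u)"
proof (intro fps_ext)
  fix j n
  show "((ser1 fps_X - fps_X) * hankel u) $ j $ n = (ser1 fps_X * fps_X * (ser1 u - ser2 u)) $ j $ n"
    by (cases j; cases n) (auto simp: hankel_def left_diff_distrib right_diff_distrib mult.assoc Suc_le_eq)
qed

section \<open>Solving the recursion for annular permutations\<close>

text \<open>The recursion for the annulus taken as a definition, with the disc numbers as
  parameters; \<open>sum_annular\<close> identifies it with the weighted sum over annular
  permutations.\<close>

fun annular_count :: "(nat \<Rightarrow> 'a::comm_ring_1) \<Rightarrow> (nat \<Rightarrow> 'a) \<Rightarrow> ((nat \<Rightarrow> 'a) \<Rightarrow> nat \<Rightarrow> 'a) \<Rightarrow>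
    (nat \<Rightarrow> 'a) \<Rightarrow> nat \<Rightarrow> nat \<Rightarrow> 'a" where
  "annular_count \<kappa> m D w 0 j = 0"
| "annular_count \<kappa> m D w (Suc n) j =
     (\<Sum>k\<le>n. m k * annular_count \<kappa> m D (shift_weight w) (n - k) j +
        annular_count \<kappa> m D \<kappa> k j * D (shift_weight w) (n - k)) + of_nat j * D (shift_weight w) (n + j)"

lemma annular_count_zero: "annular_count \<kappa> m D w n 0 = 0"
  by (induction \<kappa> m D w n "0 :: nat" rule: annular_count.induct) simp_all

context
  fixes \<kappa> :: "nat \<Rightarrow> 'a::field_char_0"
begin

text \<open>The value \<open>\<kappa> 0\<close> is irrelevant; with 1 in its place the series is \<open>y X(y)\<close>. The series \<open>y_series\<close>
  solves \<open>X(y(z)) = 1 / z\<close>.\<close>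

definition cumulant_series :: "'a fps" where
  "cumulant_series = Abs_fps (\<kappa>(0 := 1))"

definition recip_X :: "'a fps" where
  "recip_X = fls_regpart (1 / X_series \<kappa>)"

definition y_series :: "'a fps" where
  "y_series = fps_inv recip_X"

definition weight_series :: "(nat \<Rightarrow> 'a) \<Rightarrow> 'a fps" where
  "weight_series w = Abs_fps w oo y_series"

text \<open>This is w'(y(z)): the derivative is taken before the substitution and is not the
  z-derivative of \<open>weight_series\<close>.\<close>

definition weight_deriv :: "(nat \<Rightarrow> 'a) \<Rightarrow> 'a fps" where
  "weight_deriv w = fps_deriv (Abs_fps w) oo y_series"

text \<open>By \<open>y_series_eq\<close> these are the coefficients of y(z) / z.\<close>

definition moment :: "nat \<Rightarrow> 'a" where
  "moment n = (cumulant_series oo y_series) $ n"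

text \<open>The disc numbers have the generating series w(y(z)). Their recursion comes from w(y) =
  w(0) + y v(y), where v has the shifted weights, together with y(z) = z M(z), where M is the series
  of the moments.\<close>

definition disc_count :: "(nat \<Rightarrow> 'a) \<Rightarrow> nat \<Rightarrow> 'a" where
  "disc_count w n = weight_series w $ n"

definition annular_series :: "(nat \<Rightarrow> 'a) \<Rightarrow> 'a fps fps" where
  "annular_series w = Abs_fps (\<lambda>j. Abs_fps (\<lambda>n. annular_count \<kappa> moment disc_count w n j))"

section \<open>The inverse series y(z) and the recursions solved with it\<close>

lemma recip_X_nth: "recip_X $ 0 = 0" "recip_X $ 1 = 1"
  unfolding recip_X_def by (rule inverse_X_series)+

lemma X_series_shift: "X_series \<kappa> = fls_shift 1 (fps_to_fls cumulant_series)"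
proof (rule fls_eqI)
  fix n :: int
  show "X_series \<kappa> $$ n = fls_shift 1 (fps_to_fls cumulant_series) $$ n"
  proof (cases "n < 0")
    case True
    then show ?thesis
      by (cases "n = -1") (simp_all add: X_series_def cumulant_series_def fls_inverse_X)
  next
    case False
    then obtain k where "n = int k" by (metis nonneg_int_cases not_less)
    then show ?thesis
      by (simp add: X_series_def cumulant_series_def fls_inverse_X nat_add_distrib)
  qed
qed

lemma X_series_nonzero: "X_series \<kappa> \<noteq> 0"
proof
  assume "X_series \<kappa> = 0"
  then have "recip_X $ 1 = 0" by (simp add: recip_X_def)
  then show False using recip_X_nth by simp
qed

lemma recip_X_cumulant: "recip_X * cumulant_series = fps_X"
proof -
  have "fps_to_fls (recip_X * cumulant_series) = 1 / X_series \<kappa> * fps_to_fls cumulant_series"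
    by (simp add: fls_times_fps_to_fls recip_X_def inverse_X_series(1))
  also have "fps_to_fls cumulant_series = X_series \<kappa> * fls_X"
    unfolding X_series_shift by (simp add: fls_X_times_conv_shift fls_shifted_times_simps)
  also have "1 / X_series \<kappa> * \<dots> = fps_to_fls fps_X"
    using X_series_nonzero by (simp add: fls_X_conv_shift_1)
  finally show ?thesis by (simp only: fps_to_fls_eq_iff)
qed

lemma y_series_nth_0: "y_series $ 0 = 0"
  by (simp add: y_series_def fps_inv_def)

lemma y_series_recip_X: "y_series oo recip_X = fps_X" "recip_X oo y_series = fps_X"
  unfolding y_series_def using recip_X_nth by (auto intro: fps_inv fps_inv_right)

lemma y_series_eq: "y_series = fps_X * (cumulant_series oo y_series)"
proof -
  have "(recip_X * cumulant_series) oo y_series = fps_X oo y_series" by (simp add: recip_X_cumulant)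
  then show ?thesis
    by (simp add: fps_compose_mult_distrib y_series_nth_0 y_series_recip_X)
qed

lemma y_series_mult: "y_series * f = fps_X * ((cumulant_series oo y_series) * f)"
proof -
  have "y_series * f = fps_X * (cumulant_series oo y_series) * f" by (rule arg_cong[OF y_series_eq])
  then show ?thesis by (simp only: mult.assoc)
qed

lemma y_series_power_nth: "i < k \<Longrightarrow> (y_series ^ k * f) $ i = 0"
proof -
  assume "i < k"
  have "y_series ^ k * f = (fps_X * (cumulant_series oo y_series)) ^ k * f" by (rule arg_cong[OF y_series_eq])
  also have "\<dots> = fps_X ^ k * ((cumulant_series oo y_series) ^ k * f)" by (simp only: power_mult_distrib mult.assoc)
  finally show ?thesis using \<open>i < k\<close> by (simp only: fps_X_power_mult_nth if_True)
qed

lemma Abs_fps_shift: "Abs_fps w = fps_const (w 0) + fps_X * Abs_fps (shift_weight w)"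
  for w :: "nat \<Rightarrow> 'a"
proof (rule fps_ext)
  fix n
  show "Abs_fps w $ n = (fps_const (w 0) + fps_X * Abs_fps (shift_weight w)) $ n"
    by (cases n) simp_all
qed

lemma weight_series_rec:
  "weight_series w = fps_const (w 0) + y_series * weight_series (shift_weight w)"
  unfolding weight_series_def
  by (subst Abs_fps_shift) (simp add: fps_compose_add_distrib fps_compose_mult_distrib y_series_nth_0)

lemma weight_deriv_rec:
  "weight_deriv w = weight_series (shift_weight w) + y_series * weight_deriv (shift_weight w)"
  unfolding weight_series_def weight_deriv_def
  by (subst Abs_fps_shift) (simp add: fps_compose_add_distrib fps_compose_mult_distrib y_series_nth_0 add.commute)

lemma deriv_weight_series: "fps_deriv (weight_series w) = weight_deriv w * fps_deriv y_series"
  unfolding weight_series_def weight_deriv_def by (rule fps_compose_deriv[OF y_series_nth_0])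

lemma cumulant_series_eq: "cumulant_series = fps_const (1 - \<kappa> 0) + Abs_fps \<kappa>"
  by (rule fps_ext) (simp add: cumulant_series_def)

lemma planar_counts_series: "planar_counts \<kappa> moment disc_count (annular_count \<kappa> moment disc_count)"
proof unfold_locales
  show "disc_count w 0 = w 0" for w by (simp add: disc_count_def weight_series_def)
  show "disc_count w (Suc n) = (\<Sum>k\<le>n. moment k * disc_count (shift_weight w) (n - k))" for w n
  proof -
    have "weight_series w $ Suc n = (fps_X * ((cumulant_series oo y_series) * weight_series (shift_weight w))) $ Suc n"
      by (subst weight_series_rec, subst y_series_mult) simp
    also have "\<dots> = ((cumulant_series oo y_series) * weight_series (shift_weight w)) $ n" by simp
    finally show ?thesis
      unfolding disc_count_def moment_def by (simp add: fps_mult_nth atLeast0AtMost)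
  qed
  show "moment 0 = 1" by (simp add: moment_def cumulant_series_def)
  show "moment (Suc n) = disc_count \<kappa> (Suc n)" for n
    by (simp add: moment_def disc_count_def weight_series_def cumulant_series_eq fps_compose_add_distrib)
qed simp_all

lemma fps_X_mult_Suc_nth: "(fps_X * f) $ Suc n = f $ n"
  for f :: "'b::comm_ring_1 fps"
  by simp

lemma X_deriv_nth: "(fps_X * fps_deriv G) $ j = of_nat j * G $ j"
  for G :: "'b::comm_ring_1 fps"
  by (cases j) simp_all

text \<open>In the inhomogeneous term the Euler operator in z2 supplies the factor j, and the index
  n + j - 1 of \<open>hankel\<close> becomes the required n' + j for n = n' + 1.\<close>

lemma annular_series_rec:
  "annular_series w = ser1 y_series * annular_series (shift_weight w) +
     ser1 (fps_X * weight_series (shift_weight w)) * annular_series \<kappa> +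
     fps_X * fps_deriv (hankel (weight_series (shift_weight w)))"
proof (intro fps_ext)
  fix j n
  let ?v = "weight_series (shift_weight w)" and ?T = "\<lambda>w. annular_series w $ j"
  have of_nat: "(of_nat j * f) $ n = of_nat j * f $ n" for f :: "'a fps"
    by (simp add: fps_of_nat[symmetric])
  have T: "?T w $ n = annular_count \<kappa> moment disc_count w n j" for w n
    by (simp add: annular_series_def)
  have "(ser1 y_series * annular_series (shift_weight w) + ser1 (fps_X * ?v) * annular_series \<kappa> +
      fps_X * fps_deriv (hankel ?v)) $ j $ n =
      (fps_X * ((cumulant_series oo y_series) * ?T (shift_weight w) + ?T \<kappa> * ?v)) $ n + of_nat j * hankel ?v $ j $ n"
    by (simp add: X_deriv_nth of_nat y_series_mult algebra_simps)
  also have "\<dots> = annular_series w $ j $ n"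
  proof (cases n)
    case 0
    then show ?thesis by (simp add: hankel_def annular_series_def)
  next
    case (Suc n')
    have "(fps_X * ((cumulant_series oo y_series) * ?T (shift_weight w) + ?T \<kappa> * ?v)) $ n =
        ((cumulant_series oo y_series) * ?T (shift_weight w) + ?T \<kappa> * ?v) $ n'"
      unfolding Suc by (rule fps_X_mult_Suc_nth)
    also have "\<dots> = (\<Sum>k\<le>n'. moment k * annular_count \<kappa> moment disc_count (shift_weight w) (n' - k) j +
          annular_count \<kappa> moment disc_count \<kappa> k j * disc_count (shift_weight w) (n' - k))"
      by (simp add: fps_mult_nth T moment_def disc_count_def sum.distrib atLeast0AtMost)
    finally have "(fps_X * ((cumulant_series oo y_series) * ?T (shift_weight w) + ?T \<kappa> * ?v)) $ n =
        (\<Sum>k\<le>n'. moment k * annular_count \<kappa> moment disc_count (shift_weight w) (n' - k) j +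
          annular_count \<kappa> moment disc_count \<kappa> k j * disc_count (shift_weight w) (n' - k))" .
    moreover have "of_nat j * hankel ?v $ j $ n = of_nat j * disc_count (shift_weight w) (n' + j)"
      by (cases j) (simp_all add: Suc hankel_def disc_count_def)
    ultimately show ?thesis by (simp add: Suc T)
  qed
  finally show "annular_series w $ j $ n = (ser1 y_series * annular_series (shift_weight w) +
     ser1 (fps_X * ?v) * annular_series \<kappa> + fps_X * fps_deriv (hankel ?v)) $ j $ n" ..
qed

text \<open>The equation can be iterated because it is assumed for all weights at once, and
  \<open>y_series\<close> has no constant term, so its powers start in arbitrarily high
  degree.\<close>

lemma divisible_imp_zero:
  fixes \<Delta> :: "(nat \<Rightarrow> 'a) \<Rightarrow> 'a fps fps"
  assumes "\<And>w. \<Delta> w = ser1 y_series * \<Delta> (shift_weight w)"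
  shows "\<Delta> w = 0"
proof -
  have pow: "\<exists>G. \<Delta> w = ser1 (y_series ^ k) * G" for k w
  proof (induction k arbitrary: w)
    case (Suc k)
    obtain G where "\<Delta> (shift_weight w) = ser1 (y_series ^ k) * G" using Suc by blast
    then have "\<Delta> w = ser1 (y_series ^ Suc k) * G"
      using assms[of w] by (simp add: mult.assoc[symmetric])
    then show ?case by blast
  qed simp
  show ?thesis
  proof (intro fps_ext)
    fix j i
    obtain G where "\<Delta> w = ser1 (y_series ^ Suc i) * G" using pow by blast
    then have "\<Delta> w $ j $ i = (y_series ^ Suc i * G $ j) $ i" by simp
    also have "\<dots> = 0" by (rule y_series_power_nth) simp
    finally show "\<Delta> w $ j $ i = (0 :: 'a fps fps) $ j $ i" by simp
  qed
qed

text \<open>With \<open>e = z\<^sub>1 - z\<^sub>2\<close>, \<open>d = y(z\<^sub>1) - y(z\<^sub>2)\<close> and \<open>N = d w'(y\<^sub>1) - (w(y\<^sub>1) - w(y\<^sub>2))\<close>, the recursion is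
  solved by \<open>T\<^sub>w = z\<^sub>1 w'(y\<^sub>1) T\<^sub>\<kappa> + z\<^sub>2 \<partial>\<^sub>2 (z\<^sub>1 z\<^sub>2 N / (e d))\<close>; here it is multiplied by \<open>(e d)\<^sup>2\<close>. The
  solution is unique because the difference of two of them is divisible by every power of \<open>y\<^sub>1\<close>.\<close>

theorem annular_series_solution:
  fixes w :: "nat \<Rightarrow> 'a"
  defines "e \<equiv> ser1 fps_X - fps_X" and "d \<equiv> ser1 y_series - ser2 y_series" and "q \<equiv> ser1 fps_X * fps_X"
    and "dy \<equiv> ser2 (fps_deriv y_series)"
  defines "N \<equiv> \<lambda>w. d * ser1 (weight_deriv w) - (ser1 (weight_series w) - ser2 (weight_series w))"
    and "dN \<equiv> \<lambda>w. dy * (ser2 (weight_deriv w) - ser1 (weight_deriv w))"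
  shows "(e * d)\<^sup>2 * annular_series w = (e * d)\<^sup>2 * (ser1 fps_X * ser1 (weight_deriv w)) * annular_series \<kappa> +
    fps_X * ((ser1 fps_X * N w + q * dN w) * (e * d) + q * N w * (d + e * dy))"
proof -
  \<comment> \<open>Numerator of the quotient rule for the Euler operator in z2 applied to q N / (e
    d): the z2-derivative of \<open>N\<close> is \<open>dN\<close>, and that of \<open>e * d\<close>
    is -(d + e dy).\<close>
  define E where "E w = fps_X * ((ser1 fps_X * N w + q * dN w) * (e * d) + q * N w * (d + e * dy))" for w
  define \<Delta> where "\<Delta> w = (e * d)\<^sup>2 * annular_series w -
    (e * d)\<^sup>2 * (ser1 fps_X * ser1 (weight_deriv w)) * annular_series \<kappa> - E w" for w
  have "\<Delta> w = ser1 y_series * \<Delta> (shift_weight w)" for w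
  proof -
    let ?s = "shift_weight w"
    define z1 z2 y1 y2 v1 v2 a1 a2 T1 T0 G where "z1 = ser1 (fps_X :: 'a fps)" and "z2 = (fps_X :: 'a fps fps)"
      and "y1 = ser1 y_series" and "y2 = ser2 y_series" and "v1 = ser1 (weight_series ?s)" and "v2 = ser2 (weight_series ?s)"
      and "a1 = ser1 (weight_deriv ?s)" and "a2 = ser2 (weight_deriv ?s)" and "T1 = annular_series ?s"
      and "T0 = annular_series \<kappa>" and "G = hankel (weight_series ?s)"
    define G' where "G' = fps_deriv G"
    have w1: "ser1 (weight_series w) = ser1 (fps_const (w 0)) + y1 * v1"
      by (subst weight_series_rec) (simp add: y1_def v1_def)
    have w2: "ser2 (weight_series w) = ser1 (fps_const (w 0)) + y2 * v2"
      by (subst weight_series_rec) (simp add: y2_def v2_def ser2_simps ser2_const)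
    have b1: "ser1 (weight_deriv w) = v1 + y1 * a1"
      by (subst weight_deriv_rec) (simp add: y1_def v1_def a1_def)
    have b2: "ser2 (weight_deriv w) = v2 + y2 * a2"
      by (subst weight_deriv_rec) (simp add: y2_def v2_def a2_def ser2_simps)
    have e: "e = z1 - z2" and d: "d = y1 - y2" and q: "q = z1 * z2"
      by (simp_all add: e_def d_def q_def z1_def z2_def y1_def y2_def)
    have T: "annular_series w = y1 * T1 + z1 * v1 * T0 + z2 * G'"
      by (subst annular_series_rec) (simp add: y1_def T1_def z1_def v1_def T0_def z2_def G'_def G_def)
    have hG: "e * G = q * (v1 - v2)"
      using hankel_eq[of "weight_series ?s"] by (simp add: e_def G_def q_def v1_def v2_def)
    \<comment> \<open>\<open>G\<close> is known only through the product \<open>e * G\<close>.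
      Differentiating it in z2, where \<open>e\<close> has derivative -1, and multiplying by
      \<open>e\<close> once more expresses e^2 G' without a division.\<close>
    have l: "fps_deriv (e * G) = e * G' - G"
      by (simp add: e_def G'_def algebra_simps)
    have r: "fps_deriv (q * (v1 - v2)) = z1 * (v1 - v2) - q * (a2 * dy)"
      by (simp add: q_def v1_def v2_def a2_def dy_def z1_def ser2_deriv deriv_weight_series ser2_simps algebra_simps)
    have "e * G' - G = z1 * (v1 - v2) - q * (a2 * dy)"
      unfolding l[symmetric] r[symmetric] hG ..
    then have "e * G' = z1 * (v1 - v2) - q * (a2 * dy) + G"
      by (simp add: algebra_simps)
    then have "e * (e * G') = e * (z1 * (v1 - v2) - q * (a2 * dy)) + e * G"
      by (simp only: distrib_left)
    then have "e * (e * G') = e * (z1 * (v1 - v2) - q * (a2 * dy)) + q * (v1 - v2)"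
      unfolding hG .
    then have eG: "e\<^sup>2 * G' = e * (z1 * (v1 - v2) - q * (a2 * dy)) + q * (v1 - v2)"
      by (simp add: power2_eq_square mult.assoc)
    have Nw: "N w = y1 * N ?s + d * (v1 - v2)"
      unfolding N_def w1 w2 b1 unfolding d by (simp add: v1_def[symmetric] v2_def[symmetric] a1_def[symmetric] algebra_simps)
    have dNw: "dN w = y1 * dN ?s - dy * (v1 - v2) - d * a2 * dy"
      unfolding dN_def b1 b2 unfolding d by (simp add: a1_def[symmetric] a2_def[symmetric] algebra_simps)
    \<comment> \<open>\<open>N\<close> and \<open>dN\<close> are multiplied by y1 under the weight
      shift, up to terms in v1 - v2 and a2; in \<open>E\<close> these terms combine to exactly the
      inhomogeneous term.\<close>
    have "E w - y1 * E ?s = z2 * d\<^sup>2 * (e\<^sup>2 * G')"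
      unfolding eG E_def Nw dNw z1_def[symmetric] z2_def[symmetric]
      by (simp add: power2_eq_square algebra_simps)
    moreover have "\<Delta> w - y1 * \<Delta> ?s = (e * d)\<^sup>2 * (z2 * G') - (E w - y1 * E ?s)"
      unfolding \<Delta>_def T b1 T1_def[symmetric] T0_def[symmetric] z1_def[symmetric] a1_def[symmetric]
      by (simp add: algebra_simps)
    moreover have "(e * d)\<^sup>2 * (z2 * G') = z2 * d\<^sup>2 * (e\<^sup>2 * G')"
      by (simp add: power_mult_distrib mult_ac)
    ultimately show ?thesis by (simp add: y1_def)
  qed
  then have "\<Delta> w = 0" by (rule divisible_imp_zero)
  then show ?thesis by (simp add: \<Delta>_def E_def algebra_simps)
qed

section \<open>Coefficients of the terms with one through block\<close>

lemma fps_X_power_compose: "fps_X ^ r oo y_series = y_series ^ r"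
  using fps_compose_power[OF y_series_nth_0, of fps_X r] by (simp add: y_series_nth_0)

lemma Abs_fps_delta: "Abs_fps (\<lambda>k. if k = r then 1 else 0) = (fps_X ^ r :: 'a fps)"
  by (rule fps_ext) (simp add: fps_X_power_nth)

lemma disc_count_delta: "disc_count (\<lambda>k. if k = r then 1 else 0) i = (y_series ^ r) $ i"
  by (simp add: disc_count_def weight_series_def Abs_fps_delta fps_X_power_compose)

lemma disc_count_delta_div: "disc_count (\<lambda>k. (if k = r then 1 else 0) / of_nat k) i = (y_series ^ r) $ i / of_nat r"
proof -
  have "Abs_fps (\<lambda>k. (if k = r then 1 else 0) / of_nat k) = fps_const (1 / of_nat r) * (fps_X ^ r :: 'a fps)"
    by (rule fps_ext) (simp add: fps_X_power_nth)
  then show ?thesis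
    by (simp add: disc_count_def weight_series_def fps_compose_mult_distrib fps_X_power_compose y_series_nth_0)
qed

text \<open>Both sides are the coefficient at \<open>i\<close> of the Euler operator applied to
  \<open>y_series ^ Suc r\<close>.\<close>

lemma rooted_coeff:
  "of_nat i * (y_series ^ Suc r) $ i = of_nat (Suc r) * (fps_X * fps_deriv y_series * y_series ^ r) $ i"
proof -
  have "of_nat i * (y_series ^ Suc r) $ i = (fps_X * fps_deriv (y_series ^ Suc r)) $ i"
    by (simp only: X_deriv_nth)
  also have "fps_X * fps_deriv (y_series ^ Suc r) = fps_const (of_nat (Suc r)) * (fps_X * fps_deriv y_series * y_series ^ r)"
    by (subst fps_deriv_power) (simp add: mult_ac fps_of_nat del: of_nat_Suc)
  finally show ?thesis by simp
qed

lemma rooted_coeff_top: "i \<le> r \<Longrightarrow> (fps_X * fps_deriv y_series * y_series ^ r) $ i = 0"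
proof -
  assume "i \<le> r"
  have "fps_X * fps_deriv y_series * y_series ^ r = fps_X * (y_series ^ r * fps_deriv y_series)" by (simp add: mult_ac)
  moreover have "(fps_X * (y_series ^ r * fps_deriv y_series)) $ i = 0"
    using \<open>i \<le> r\<close> by (cases i) (simp_all only: fps_X_mult_Suc_nth y_series_power_nth Suc_le_eq, simp)
  ultimately show ?thesis by (simp only:)
qed

text \<open>With block parts of sizes R = r + 1 and S = s + 1, the weight at R + S is counted once
  for the partition and subtracted R S times for its permutations.\<close>

definition cylinder_coeffs :: "(nat \<Rightarrow> nat \<Rightarrow> 'a) \<Rightarrow> 'a fps fps" where
  "cylinder_coeffs \<kappa>' = Abs_fps (\<lambda>s. Abs_fps (\<lambda>r.
     \<kappa>' (r + 1) (s + 1) + \<kappa> (r + s + 2) * (1 - of_nat (r + 1) * of_nat (s + 1))))"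

text \<open>A marked block of size r + 1 contributes z y' y^r, because the division by the block
  size cancels the factor in \<open>rooted_coeff\<close>; a marked point keeps this factor.\<close>

lemma cylinder_moment_series:
  assumes "i \<ge> 1" "j \<ge> 1"
  shows "cylinder_moment \<kappa> \<kappa>' i j =
    (annular_series \<kappa> + ser1 (fps_X * fps_deriv y_series) * ser2 (fps_X * fps_deriv y_series) *
       comp2 (cylinder_coeffs \<kappa>') y_series y_series) $ j $ i"
proof -
  let ?A = "\<lambda>i r. (fps_X * fps_deriv y_series * y_series ^ r) $ i"
  let ?d = "\<lambda>r k. if k = r then 1 else (0 :: 'a)"
  have D1: "of_nat i * disc_count (?d (Suc r)) i = of_nat (Suc r) * ?A i r" for i r
    unfolding disc_count_delta by (rule rooted_coeff)
  have D2: "of_nat i * disc_count (\<lambda>k. ?d (Suc r) k / of_nat k) i = ?A i r" for i r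
    unfolding disc_count_delta_div times_divide_eq_right rooted_coeff by (simp del: of_nat_Suc)
  have D0: "disc_count (?d 0) i = 0" "disc_count (\<lambda>k. ?d 0 k / of_nat k) i = 0" if "i \<ge> 1" for i
    using that unfolding disc_count_delta disc_count_delta_div by simp_all
  \<comment> \<open>The terms of block size 0 vanish, so the sizes are shifted to start at 1; the
    top term of the shifted range vanishes by \<open>rooted_coeff_top\<close>.\<close>
  have shift: "(\<Sum>r\<le>n. f r) = (\<Sum>r<n. f (Suc r))" if "f 0 = 0" for n and f :: "nat \<Rightarrow> 'a"
    using that by (simp add: lessThan_Suc_atMost[symmetric] sum.lessThan_Suc_shift del: sum.lessThan_Suc)
  have top: "(\<Sum>r\<le>n. f r) = (\<Sum>r<n. f r)" if "f n = 0" for n and f :: "nat \<Rightarrow> 'a"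
    using that by (simp add: lessThan_Suc_atMost[symmetric])
  have shift2: "(\<Sum>r\<le>i. \<Sum>s\<le>j. f r s * (a r * b s)) = (\<Sum>r<i. \<Sum>s<j. f (Suc r) (Suc s) * (a (Suc r) * b (Suc s)))"
    if "a 0 = 0" "b 0 = 0" for f and a b :: "nat \<Rightarrow> 'a"
    using shift[of "\<lambda>r. \<Sum>s\<le>j. f r s * (a r * b s)" i] shift[of "\<lambda>s. f r s * (a r * b s)" j for r] that by simp
  have 1: "(\<Sum>r\<le>i. \<Sum>s\<le>j. f r s * ((of_nat i * disc_count (\<lambda>k. ?d r k / of_nat k) i) *
      (of_nat j * disc_count (\<lambda>k. ?d s k / of_nat k) j))) =
      (\<Sum>r<i. \<Sum>s<j. f (Suc r) (Suc s) * (?A i r * ?A j s))" for f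
    using shift2[of "\<lambda>r. of_nat i * disc_count (\<lambda>k. ?d r k / of_nat k) i"
        "\<lambda>s. of_nat j * disc_count (\<lambda>k. ?d s k / of_nat k) j" f] D0 assms unfolding D2 by simp
  have 2: "(\<Sum>r\<le>i. \<Sum>s\<le>j. f r s * ((of_nat i * disc_count (?d r) i) * (of_nat j * disc_count (?d s) j))) =
      (\<Sum>r<i. \<Sum>s<j. f (Suc r) (Suc s) * ((of_nat (Suc r) * ?A i r) * (of_nat (Suc s) * ?A j s)))" for f
    using shift2[of "\<lambda>r. of_nat i * disc_count (?d r) i" "\<lambda>s. of_nat j * disc_count (?d s) j" f] D0 assms
    unfolding D1 by simp
  have "(ser1 (fps_X * fps_deriv y_series) * ser2 (fps_X * fps_deriv y_series) * comp2 (cylinder_coeffs \<kappa>') y_series y_series) $ j $ i =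
      (\<Sum>s\<le>j. \<Sum>r\<le>i. cylinder_coeffs \<kappa>' $ s $ r * ?A i r * ?A j s)"
    by (rule comp2_nth) (rule y_series_nth_0)+
  also have "\<dots> = (\<Sum>s<j. \<Sum>r<i. cylinder_coeffs \<kappa>' $ s $ r * ?A i r * ?A j s)"
    by (subst top) (simp_all add: rooted_coeff_top top)
  also have "\<dots> = (\<Sum>r<i. \<Sum>s<j. cylinder_coeffs \<kappa>' $ s $ r * ?A i r * ?A j s)"
    by (rule sum.swap)
  also have "\<dots> = (\<Sum>r<i. \<Sum>s<j. (\<kappa>' (Suc r) (Suc s) + \<kappa> (Suc r + Suc s)) * (?A i r * ?A j s) -
      \<kappa> (Suc r + Suc s) * ((of_nat (Suc r) * ?A i r) * (of_nat (Suc s) * ?A j s)))"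
    by (intro sum.cong refl) (simp add: cylinder_coeffs_def algebra_simps)
  finally show ?thesis
    unfolding cylinder_moment_eq[OF planar_counts_series assms] 1 2
    by (simp add: sum_subtractf annular_series_def)
qed

text \<open>The factor z1 z2 accounts for the exponents i + 1 and j + 1. As the left side has no
  terms with i = 0 or j = 0, it must be checked that the bracket has none either.\<close>

lemma W_par2_eq:
  "W_par2 \<kappa> \<kappa>' = ser1 fps_X * fps_X * (annular_series \<kappa> +
     ser1 (fps_X * fps_deriv y_series) * ser2 (fps_X * fps_deriv y_series) * comp2 (cylinder_coeffs \<kappa>') y_series y_series)"
    (is "_ = _ * ?G")
proof (intro fps_ext)
  fix q p
  have G0: "?G $ j $ i = 0" if "i = 0 \<or> j = 0" for i j
  proof -
    have "ser2 (fps_X * fps_deriv y_series) = fps_X * ser2 (fps_deriv y_series)" by (simp add: ser2_simps)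
    then have "?G $ j $ i = annular_count \<kappa> moment disc_count \<kappa> i j +
        (fps_X * (ser1 (fps_X * fps_deriv y_series) * ser2 (fps_deriv y_series) * comp2 (cylinder_coeffs \<kappa>') y_series y_series)) $ j $ i"
      by (simp add: annular_series_def mult_ac)
    then show ?thesis using that by (cases j) (auto simp: annular_count_zero mult.assoc)
  qed
  have "(ser1 fps_X * fps_X * ?G) $ q $ p = (if p \<ge> 1 \<and> q \<ge> 1 then ?G $ (q - 1) $ (p - 1) else 0)"
    by (cases q; cases p) (simp_all add: mult.assoc)
  also have "\<dots> = W_par2 \<kappa> \<kappa>' $ q $ p"
    using G0[of "p - 1" "q - 1"] cylinder_moment_series[of "p - 1" "q - 1" \<kappa>'] by (auto simp: W_par2_def)
  finally show "W_par2 \<kappa> \<kappa>' $ q $ p = (ser1 fps_X * fps_X * ?G) $ q $ p" ..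
qed

end

section \<open>Substitution and the functional equation\<close>

definition lift_fls :: "'a::field fps fps \<Rightarrow> 'a fls fls" where
  "lift_fls F = fps_to_fls (fps_map fps_to_fls F)"

interpretation lift_hom: fps_hom "lift_fls :: 'a::field fps fps \<Rightarrow> 'a fls fls"
  by unfold_locales
    (simp_all add: lift_fls_def to_fls_hom.map_add to_fls_hom.map_mult to_fls_hom.map_one fls_times_fps_to_fls)

lemma lift_fls_eq_0: "lift_fls F = 0 \<longleftrightarrow> F = 0"
proof
  assume "lift_fls F = 0"
  then have "fps_map fps_to_fls F = 0" by (simp add: lift_fls_def)
  then show "F = 0" by (metis fps_eq_iff fps_map_nth fps_to_fls_eq_0_iff fps_zero_nth)
qed (simp add: lift_hom.zero)

lemma in_y2_nth: "in_y2 f $$ n = fls_const (f $$ n)"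
  unfolding in_y2_def by (rule fls_map_coeffs_nth) simp

lemma lift_ser1: "lift_fls (ser1 f) = in_y1 (fps_to_fls f)"
  unfolding lift_fls_def in_y1_def to_fls_hom.map_const by (rule fps_const_to_fls)

lemma lift_ser2: "lift_fls (ser2 f) = in_y2 (fps_to_fls f)"
  by (rule fls_eqI) (simp add: in_y2_nth lift_fls_def fps_const_to_fls)

lemma lift_X: "lift_fls (ser1 fps_X) = y1" "lift_fls fps_X = y2"
  unfolding lift_ser1 by (simp_all add: in_y1_def y1_def y2_def lift_fls_def to_fls_hom.map_X)

lemma in_y1_mult: "in_y1 (f * g) = in_y1 f * in_y1 g"
  by (simp add: in_y1_def)

lemma in_y2_shift: "in_y2 (fls_shift n (fps_to_fls g)) = fls_shift n (lift_fls (ser2 g))"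
  by (rule fls_eqI) (simp add: in_y2_nth lift_ser2)

text \<open>Every Laurent series is a shifted power series, and on power series \<open>in_y2\<close>
  is the homomorphism \<open>ser2\<close> followed by the lift.\<close>

lemma in_y2_mult: "in_y2 (f * g) = in_y2 f * in_y2 g"
proof -
  obtain m n p q where f: "f = fls_shift m (fps_to_fls p)" and g: "g = fls_shift n (fps_to_fls q)"
    by (metis fls_conv_base_factor_to_fps_shift_subdegree)
  have "f * g = fls_shift (m + n) (fps_to_fls (p * q))"
    by (simp add: f g fls_shifted_times_simps fls_times_fps_to_fls add.commute)
  moreover have "in_y2 f * in_y2 g = fls_shift (m + n) (lift_fls (ser2 (p * q)))"
    by (simp add: f g in_y2_shift fls_shifted_times_simps ser2_simps lift_hom.mult add.commute)
  ultimately show ?thesis by (simp add: in_y2_shift)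
qed

lemma in_y2_add: "in_y2 (f + g) = in_y2 f + in_y2 g"
  by (rule fls_eqI) (simp add: in_y2_nth fls_plus_const)

lemma in_y2_0: "in_y2 0 = 0"
  by (rule fls_eqI) (simp add: in_y2_nth)

lemma in_y2_1: "in_y2 1 = 1"
  by (rule fls_eqI) (simp add: in_y2_nth)

lemma eval_at_inverses_eq:
  "eval_at_inverses F f g = lift_fls (comp2 F (fls_regpart (1 / f)) (fls_regpart (1 / g)))"
proof -
  let ?p = "fls_regpart (1 / f)" and ?q = "fls_regpart (1 / g)"
  have 1: "Abs_fps (\<lambda>q. fps_to_fls (fps_compose (F $ q) ?p)) = fps_map fps_to_fls (fps_map (\<lambda>f. f oo ?p) F)"
    by (simp add: fps_eq_iff)
  have 2: "Abs_fps (\<lambda>n. fls_const (?q $ n)) = fps_map fps_to_fls (ser2 ?q)"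
    by (simp add: fps_eq_iff fps_const_to_fls)
  show ?thesis
    unfolding eval_at_inverses_def 1 2 lift_fls_def comp2_def to_fls_hom.map_compose ..
qed

lemma deriv_y2_lift: "deriv_y2 (lift_fls F) = lift_fls (fps_deriv F)"
proof -
  have "fps_deriv (fps_map fps_to_fls F) = fps_map fps_to_fls (fps_deriv F)"
    by (rule fps_ext) (simp add: fls_times_fps_to_fls fps_to_fls_of_nat del: of_nat_Suc of_nat_add)
  then show ?thesis by (simp add: deriv_y2_def lift_fls_def fls_deriv_fps_to_fls)
qed

lemma deriv_y1_lift: "deriv_y1 (lift_fls F) = lift_fls (fps_map fps_deriv F)"
  unfolding deriv_y1_def
  by (rule fls_eqI) (simp add: fls_map_coeffs_nth lift_fls_def fls_deriv_fps_to_fls)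

text \<open>The functional equation after the substitution: here \<open>Y\<^sub>i = y\<^sub>i\<close>, \<open>Z\<^sub>i = 1 / X(y\<^sub>i)\<close>, \<open>s\<^sub>i\<close> is the
  derivative of \<open>Z\<^sub>i\<close>, \<open>k\<^sub>i = y\<^sub>i X(y\<^sub>i)\<close> and \<open>A\<^sub>i\<close> is the derivative of \<open>k\<^sub>i\<close>.\<close>

lemma annular_field_identity:
  fixes Y1 :: "'b::field"
  assumes nz: "Z1 \<noteq> 0" "Z2 \<noteq> 0" "s1 \<noteq> 0" "s2 \<noteq> 0" "Y1 \<noteq> 0" "Z1 - Z2 \<noteq> 0" "Y1 - Y2 \<noteq> 0"
    and k: "Z1 * k1 = Y1" "Z2 * k2 = Y2" and A: "s1 * k1 + Z1 * A1 = 1" "s2 * k2 + Z2 * A2 = 1"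
    and t: "t2 * s2 = 1"
    and N: "N = (Y1 - Y2) * A1 - (k1 - k2)" and dN: "dN = t2 * (A2 - A1)"
    and eq: "((Z1 - Z2) * (Y1 - Y2))\<^sup>2 * T = ((Z1 - Z2) * (Y1 - Y2))\<^sup>2 * (Z1 * A1) * T +
      Z2 * ((Z1 * N + Z1 * Z2 * dN) * ((Z1 - Z2) * (Y1 - Y2)) + Z1 * Z2 * N * ((Y1 - Y2) + (Z1 - Z2) * t2))"
  shows "T = Z1 * Z2 * (1 / (s1 * s2 * (Y1 - Y2)\<^sup>2) - 1 / (Z1 - Z2)\<^sup>2)"
proof -
  define e d where "e = Z1 - Z2" and "d = Y1 - Y2"
  have ed: "e \<noteq> 0" "d \<noteq> 0" using nz by (simp_all add: e_def d_def)
  have k': "k1 = Y1 / Z1" "k2 = Y2 / Z2" using k nz by (auto simp: field_simps)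
  have A': "A1 = (1 - s1 * k1) / Z1" "A2 = (1 - s2 * k2) / Z2" using A nz by (auto simp: field_simps)
  have t': "t2 = 1 / s2" using t nz by (auto simp: field_simps)
  have N': "Z1 * Z2 * N = Y2 * e - d * (s1 * k1 * Z2)"
    unfolding N A' k' d_def e_def using nz by (simp add: field_simps)
  have dN': "Z1 * Z2 * dN * s2 = e * 1 - s2 * k2 * Z1 + s1 * k1 * Z2"
    unfolding dN A' t' k' e_def using nz by (simp add: field_simps)
  note eq' = eq[folded e_def d_def]
  have "(e * d)\<^sup>2 * T * (1 - Z1 * A1) = (e * d)\<^sup>2 * T - (e * d)\<^sup>2 * (Z1 * A1) * T"
    by (simp add: algebra_simps)
  also have "\<dots> = Z2 * ((Z1 * N + Z1 * Z2 * dN) * (e * d) + Z1 * Z2 * N * (d + e * t2))"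
    by (simp only: eq' add_diff_cancel_left')
  finally have "(e * d)\<^sup>2 * T * (1 - Z1 * A1) =
      Z2 * ((Z1 * N + Z1 * Z2 * dN) * (e * d) + Z1 * Z2 * N * (d + e * t2))" .
  \<comment> \<open>The unknown \<open>T\<close> occurs on both sides of the equation, with total
    coefficient 1 - Z1 A1. This equals s1 k1, which is nonzero, so the equation determines
    \<open>T\<close>.\<close>
  moreover have "1 - Z1 * A1 = s1 * k1" using A by (simp add: algebra_simps)
  ultimately have "(e * d)\<^sup>2 * T * (s1 * k1) =
      Z2 * ((Z1 * N + Z1 * Z2 * dN) * (e * d) + Z1 * Z2 * N * (d + e * t2))" by simp
  then have "(e * d)\<^sup>2 * T * (s1 * k1) * s2 =
      (Z1 * Z2 * N * s2 + Z2 * (Z1 * Z2 * dN * s2)) * (e * d) + Z2 * (Z1 * Z2 * N) * (d * s2 + e)"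
    unfolding t' using nz by (simp add: field_simps)
  \<comment> \<open>Substituting Y = Z k for both variables makes all mixed terms cancel; the common
    factor \<open>k1\<close> is divided out afterwards.\<close>
  also have "\<dots> = Z1 * Z2 * k1 * (e\<^sup>2 - s1 * s2 * d\<^sup>2)"
    unfolding N' dN' unfolding d_def e_def k[symmetric] by (simp add: power2_eq_square algebra_simps)
  finally have "k1 * (((e * d)\<^sup>2 * (s1 * s2)) * T) = k1 * (Z1 * Z2 * (e\<^sup>2 - s1 * s2 * d\<^sup>2))"
    by (simp add: mult_ac)
  moreover have "k1 \<noteq> 0" using k nz by auto
  ultimately have "((e * d)\<^sup>2 * (s1 * s2)) * T = Z1 * Z2 * (e\<^sup>2 - s1 * s2 * d\<^sup>2)"
    by simp
  moreover have "(e * d)\<^sup>2 * (s1 * s2) \<noteq> 0" using ed nz by simp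
  ultimately have "T = Z1 * Z2 * (e\<^sup>2 - s1 * s2 * d\<^sup>2) / ((e * d)\<^sup>2 * (s1 * s2))"
    by (simp add: nonzero_eq_divide_eq mult.commute)
  also have "\<dots> = Z1 * Z2 * (1 / (s1 * s2 * d\<^sup>2) - 1 / e\<^sup>2)"
    using ed nz by (simp add: divide_simps)
  finally show ?thesis by (simp add: e_def d_def)
qed

section \<open>The substitution z = 1 / X(y)\<close>

context
  fixes \<kappa> :: "nat \<Rightarrow> 'a::field_char_0"
begin

private abbreviation (input) \<Theta> :: "'a fps fps \<Rightarrow> 'a fls fls" where
  "\<Theta> F \<equiv> lift_fls (comp2 F (recip_X \<kappa>) (recip_X \<kappa>))"

lemma subst_hom: "fps_hom \<Theta>"
proof -
  interpret C: fps_hom "\<lambda>F. comp2 F (recip_X \<kappa>) (recip_X \<kappa>)"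
    by (rule comp2_hom) (rule recip_X_nth)+
  show ?thesis
    by unfold_locales (simp_all add: C.add C.mult C.one lift_hom.add lift_hom.mult lift_hom.one)
qed

lemma subst_ser1: "\<Theta> (ser1 f) = lift_fls (ser1 (f oo recip_X \<kappa>))"
  by (simp add: comp2_ser1 recip_X_nth)

lemma subst_ser2: "\<Theta> (ser2 f) = lift_fls (ser2 (f oo recip_X \<kappa>))"
  by (simp add: comp2_ser2 recip_X_nth)

lemma subst_X: "\<Theta> fps_X = lift_fls (ser2 (recip_X \<kappa>))"
  using subst_ser2[of fps_X] by (simp add: ser2_simps recip_X_nth)

lemma weight_series_recip_X: "weight_series \<kappa> w oo recip_X \<kappa> = Abs_fps w"
  unfolding weight_series_def
  by (simp add: fps_compose_assoc[symmetric] recip_X_nth y_series_nth_0 y_series_recip_X)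

lemma weight_deriv_recip_X: "weight_deriv \<kappa> w oo recip_X \<kappa> = fps_deriv (Abs_fps w)"
  unfolding weight_deriv_def
  by (simp add: fps_compose_assoc[symmetric] recip_X_nth y_series_nth_0 y_series_recip_X)

lemma deriv_y_series_recip_X: "(fps_deriv (y_series \<kappa>) oo recip_X \<kappa>) * fps_deriv (recip_X \<kappa>) = 1"
proof -
  have "fps_deriv (y_series \<kappa> oo recip_X \<kappa>) = 1" by (simp add: y_series_recip_X)
  then show ?thesis by (simp add: fps_compose_deriv recip_X_nth)
qed

lemma recip_X_cumulant_deriv: "fps_deriv (recip_X \<kappa>) * cumulant_series \<kappa> + recip_X \<kappa> * fps_deriv (Abs_fps \<kappa>) = 1"
proof -
  have "fps_deriv (recip_X \<kappa> * cumulant_series \<kappa>) = 1" by (simp add: recip_X_cumulant)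
  then show ?thesis by (simp add: cumulant_series_eq algebra_simps)
qed

text \<open>Both formulas come from X Z = 1 and its derivative, with Z = 1/X. The map
  \<open>h\<close> is kept abstract because they are needed in y1 and in y2.\<close>

lemma subst_in_y:
  assumes "\<And>f g. h (f * g) = h f * h g" "h 1 = (1 :: 'a fls fls)" "h 0 = 0" "\<And>f g. h (f + g) = h f + h g"
    and "h (fps_to_fls (recip_X \<kappa>)) \<noteq> 0"
  shows "h (X_series \<kappa>) = 1 / h (fps_to_fls (recip_X \<kappa>))"
    and "h (fls_deriv (X_series \<kappa>)) = - h (fps_to_fls (fps_deriv (recip_X \<kappa>))) / (h (fps_to_fls (recip_X \<kappa>)))\<^sup>2"
proof -
  let ?Z = "fps_to_fls (recip_X \<kappa>)" and ?X = "X_series \<kappa>"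
  have ZX: "?X * ?Z = 1"
    using X_series_nonzero[of \<kappa>] inverse_X_series(1)[of \<kappa>] by (simp add: recip_X_def)
  then have "h ?X * h ?Z = 1" using assms(1,2) by metis
  then show X: "h ?X = 1 / h ?Z" using assms(5) by (simp add: nonzero_eq_divide_eq)
  have "fls_deriv (?X * ?Z) = 0" unfolding ZX by simp
  then have "?X * fps_to_fls (fps_deriv (recip_X \<kappa>)) + fls_deriv ?X * ?Z = 0"
    by (simp add: fls_deriv_fps_to_fls)
  then have "h ?X * h (fps_to_fls (fps_deriv (recip_X \<kappa>))) + h (fls_deriv ?X) * h ?Z = 0"
    using assms(1,3,4) by metis
  then show "h (fls_deriv ?X) = - h (fps_to_fls (fps_deriv (recip_X \<kappa>))) / (h ?Z)\<^sup>2"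
    unfolding X using assms(5) by (simp add: field_simps power2_eq_square eq_neg_iff_add_eq_0)
qed

lemma X_series2_lift: "X_series2 \<kappa>' = lift_fls (Abs_fps (\<lambda>q. Abs_fps (\<lambda>p. \<kappa>' (p + 1) (q + 1) :: 'a)))"
  by (simp add: X_series2_def lift_fls_def fps_map_def)

text \<open>For X = 1/y + f(y) the polar parts contribute -1/(y1 y2) to the divided difference. The
  summand 1 cancels this, and y1 y2 times the divided difference of \<open>f\<close>
  remains.\<close>

lemma hankel_lift:
  fixes f :: "'a fps"
  assumes "X1 * y1 = 1 + y1 * lift_fls (ser1 f)" "X2 * y2 = 1 + y2 * lift_fls (ser2 f)"
    and "y1 - y2 \<noteq> (0 :: 'a fls fls)"
  shows "y1 * y2 * ((X1 - X2) / (y1 - y2)) + 1 = lift_fls (hankel f)"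
proof -
  have h: "(y1 - y2) * lift_fls (hankel f) = y1 * y2 * (lift_fls (ser1 f) - lift_fls (ser2 f))"
    using arg_cong[OF hankel_eq[of f], of lift_fls]
    by (simp only: lift_hom.mult lift_hom.diff lift_X)
  have "y1 * y2 * (X1 - X2) = y2 * (X1 * y1) - y1 * (X2 * y2)"
    by (simp add: algebra_simps)
  also have "\<dots> = y1 * y2 * (lift_fls (ser1 f) - lift_fls (ser2 f)) - (y1 - y2)"
    unfolding assms(1,2) by (simp add: algebra_simps)
  also have "\<dots> = (y1 - y2) * (lift_fls (hankel f) - 1)"
    unfolding h[symmetric] by (simp add: right_diff_distrib)
  finally have "y1 * y2 * (X1 - X2) = (y1 - y2) * (lift_fls (hankel f) - 1)" .
  then show ?thesis using assms(3) by simp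
qed

text \<open>The two Euler operators multiply the coefficient at (n, j) by n j; for n = r + 1 and j =
  s + 1 this gives the factor that also occurs in \<open>cylinder_coeffs\<close>.\<close>

lemma hankel_euler:
  fixes f :: "'a fps"
  shows "hankel f - ser1 fps_X * fps_map fps_deriv (fps_X * fps_deriv (hankel f)) =
    ser1 fps_X * fps_X * Abs_fps (\<lambda>s. Abs_fps (\<lambda>r. f $ (r + s + 1) * (1 - of_nat (r + 1) * of_nat (s + 1))))"
proof (intro fps_ext)
  fix j n
  have of_nat: "(of_nat j * g) $ n = of_nat j * g $ n" for g :: "'a fps" and j n
    by (simp add: fps_of_nat[symmetric])
  have "(hankel f - ser1 fps_X * fps_map fps_deriv (fps_X * fps_deriv (hankel f))) $ j $ n =
      hankel f $ j $ n - (fps_X * fps_deriv (of_nat j * hankel f $ j)) $ n"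
    by (simp add: X_deriv_nth)
  also have "\<dots> = hankel f $ j $ n - of_nat n * (of_nat j * hankel f $ j $ n)"
    unfolding X_deriv_nth of_nat ..
  also have "\<dots> = (ser1 fps_X * fps_X * Abs_fps (\<lambda>s. Abs_fps (\<lambda>r. f $ (r + s + 1) *
      (1 - of_nat (r + 1) * of_nat (s + 1))))) $ j $ n"
    by (cases j; cases n) (simp_all add: hankel_def mult.assoc algebra_simps)
  finally show "(hankel f - ser1 fps_X * fps_map fps_deriv (fps_X * fps_deriv (hankel f))) $ j $ n = \<dots>" .
qed

end

theorem theorem4p3:
  fixes \<kappa> :: "nat \<Rightarrow> 'a::field_char_0"
    and \<kappa>' :: "nat \<Rightarrow> nat \<Rightarrow> 'a"
  defines "X \<equiv> X_series \<kappa>"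
  defines "X1 \<equiv> in_y1 X" and "X2 \<equiv> in_y2 X"
    and "dX1 \<equiv> in_y1 (fls_deriv X)" and "dX2 \<equiv> in_y2 (fls_deriv X)"
  defines "H \<equiv> y1 * y2 * ((X1 - X2) / (y1 - y2)) + 1"
  shows "eval_at_inverses (W_par2 \<kappa> \<kappa>') X X =
           (X_series2 \<kappa>' + 1 / (y1 - y2)\<^sup>2) / (dX1 * dX2) - 1 / (X1 - X2)\<^sup>2 +
           (1 / (y1 * y2) * (H - y1 * deriv_y1 (y2 * deriv_y2 H))) / (dX1 * dX2)"
proof -
  define \<Theta> where "\<Theta> F = lift_fls (comp2 F (recip_X \<kappa>) (recip_X \<kappa>))" for F
  interpret \<Theta>: fps_hom \<Theta> unfolding \<Theta>_def by (rule subst_hom)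
  note \<Theta>1 = subst_ser1[where \<kappa> = \<kappa>, folded \<Theta>_def] and \<Theta>2 = subst_ser2[where \<kappa> = \<kappa>, folded \<Theta>_def]
    and \<Theta>X = subst_X[where \<kappa> = \<kappa>, folded \<Theta>_def]
  define Z1 Z2 s1 s2 t1 t2 k1 k2 A1 A2 where "Z1 = lift_fls (ser1 (recip_X \<kappa>))" and "Z2 = lift_fls (ser2 (recip_X \<kappa>))"
    and "s1 = lift_fls (ser1 (fps_deriv (recip_X \<kappa>)))" and "s2 = lift_fls (ser2 (fps_deriv (recip_X \<kappa>)))"
    and "t1 = lift_fls (ser1 (fps_deriv (y_series \<kappa>) oo recip_X \<kappa>))" and "t2 = lift_fls (ser2 (fps_deriv (y_series \<kappa>) oo recip_X \<kappa>))"
    and "k1 = lift_fls (ser1 (cumulant_series \<kappa>))" and "k2 = lift_fls (ser2 (cumulant_series \<kappa>))"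
    and "A1 = lift_fls (ser1 (fps_deriv (Abs_fps \<kappa>)))" and "A2 = lift_fls (ser2 (fps_deriv (Abs_fps \<kappa>)))"
  note defs = this
  have hom1: "lift_fls (ser1 f) * lift_fls (ser1 g) = lift_fls (ser1 (f * g))"
    "lift_fls (ser1 f) + lift_fls (ser1 g) = lift_fls (ser1 (f + g))" "lift_fls (ser1 1) = 1" for f g :: "'a fps"
    by (simp_all add: lift_hom.mult[symmetric] lift_hom.add[symmetric] lift_hom.one)
  have hom2: "lift_fls (ser2 f) * lift_fls (ser2 g) = lift_fls (ser2 (f * g))"
    "lift_fls (ser2 f) + lift_fls (ser2 g) = lift_fls (ser2 (f + g))" "lift_fls (ser2 1) = 1" for f g :: "'a fps"
    by (simp_all add: lift_hom.mult[symmetric] lift_hom.add[symmetric] lift_hom.one ser2_simps)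
  have k: "Z1 * k1 = y1" "Z2 * k2 = y2"
    unfolding defs hom1 hom2 recip_X_cumulant using lift_X by (simp_all add: ser2_simps)
  have A: "s1 * k1 + Z1 * A1 = 1" "s2 * k2 + Z2 * A2 = 1"
    unfolding defs hom1 hom2 recip_X_cumulant_deriv by (rule refl)+
  have t: "t1 * s1 = 1" "t2 * s2 = 1"
    unfolding defs hom1 hom2 deriv_y_series_recip_X by (rule refl)+
  have y0: "y1 \<noteq> (0 :: 'a fls fls)" "y2 \<noteq> (0 :: 'a fls fls)"
    unfolding lift_X[symmetric] lift_fls_eq_0 by simp_all
  have Z0: "Z1 \<noteq> 0" "Z2 \<noteq> 0" using k y0 by auto
  have s0: "s1 \<noteq> 0" "s2 \<noteq> 0" using t by auto
  have e0: "Z1 - Z2 \<noteq> 0"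
  proof
    assume "Z1 - Z2 = 0"
    then have "ser1 (recip_X \<kappa>) - ser2 (recip_X \<kappa>) = 0" unfolding defs lift_hom.diff[symmetric] lift_fls_eq_0 .
    then have "(ser1 (recip_X \<kappa>) - ser2 (recip_X \<kappa>)) $ 0 $ 1 = 0" by simp
    then show False using recip_X_nth[of \<kappa>] by simp
  qed
  have d0: "y1 - y2 \<noteq> (0 :: 'a fls fls)"
  proof
    assume "y1 - y2 = (0 :: 'a fls fls)"
    then have "ser1 fps_X - (fps_X :: 'a fps fps) = 0" unfolding lift_X[symmetric] lift_hom.diff[symmetric] lift_fls_eq_0 .
    then have "(ser1 fps_X - (fps_X :: 'a fps fps)) $ 0 $ 1 = 0" by simp
    then show False by simp
  qed
  have X1: "X1 = 1 / Z1" "dX1 = - s1 / Z1\<^sup>2"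
    using subst_in_y[where h = in_y1 and \<kappa> = \<kappa>] Z0 unfolding X1_def dX1_def X_def defs lift_ser1
    by (simp_all add: in_y1_mult, simp_all add: in_y1_def fls_plus_const)
  have X2: "X2 = 1 / Z2" "dX2 = - s2 / Z2\<^sup>2"
    using subst_in_y[where h = in_y2 and \<kappa> = \<kappa>, OF in_y2_mult in_y2_1 in_y2_0 in_y2_add] Z0
    unfolding X2_def dX2_def X_def defs lift_ser2 by simp_all
  define T where "T = \<Theta> (annular_series \<kappa> \<kappa>)"
  have \<Theta>T: "\<Theta> (ser1 fps_X) = Z1" "\<Theta> fps_X = Z2" "\<Theta> (ser1 (y_series \<kappa>)) = y1" "\<Theta> (ser2 (y_series \<kappa>)) = y2"
    "\<Theta> (ser2 (fps_deriv (y_series \<kappa>))) = t2" "\<Theta> (ser1 (fps_deriv (y_series \<kappa>))) = t1"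
    "\<Theta> (ser1 (weight_deriv \<kappa> \<kappa>)) = A1" "\<Theta> (ser2 (weight_deriv \<kappa> \<kappa>)) = A2"
    unfolding \<Theta>1 \<Theta>2 \<Theta>X defs
    by (simp_all add: recip_X_nth y_series_recip_X lift_X ser2_simps weight_deriv_recip_X)
  have "\<Theta> (ser1 (weight_series \<kappa> \<kappa>)) - \<Theta> (ser2 (weight_series \<kappa> \<kappa>)) = k1 - k2"
    unfolding \<Theta>1 \<Theta>2 weight_series_recip_X defs cumulant_series_eq
    by (simp add: lift_hom.add ser2_simps ser2_const flip: fps_const_add)
  then have N: "\<Theta> ((ser1 (y_series \<kappa>) - ser2 (y_series \<kappa>)) * ser1 (weight_deriv \<kappa> \<kappa>) -
      (ser1 (weight_series \<kappa> \<kappa>) - ser2 (weight_series \<kappa> \<kappa>))) = (y1 - y2) * A1 - (k1 - k2)"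
    by (simp add: \<Theta>.diff \<Theta>.mult \<Theta>T)
  \<comment> \<open>\<open>annular_series_solution\<close> for w = \<kappa>, carried over by the
    substitution, is the last hypothesis of the field identity.\<close>
  have T: "T = Z1 * Z2 * (1 / (s1 * s2 * (y1 - y2)\<^sup>2) - 1 / (Z1 - Z2)\<^sup>2)"
  proof (rule annular_field_identity[OF Z0 s0 y0(1) e0 d0 k A t(2) refl refl])
    show "((Z1 - Z2) * (y1 - y2))\<^sup>2 * T = ((Z1 - Z2) * (y1 - y2))\<^sup>2 * (Z1 * A1) * T +
      Z2 * ((Z1 * ((y1 - y2) * A1 - (k1 - k2)) + Z1 * Z2 * (t2 * (A2 - A1))) * ((Z1 - Z2) * (y1 - y2)) +
        Z1 * Z2 * ((y1 - y2) * A1 - (k1 - k2)) * ((y1 - y2) + (Z1 - Z2) * t2))"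
      using arg_cong[OF annular_series_solution[where \<kappa> = \<kappa> and w = \<kappa>], of \<Theta>] N
      by (simp only: \<Theta>.mult \<Theta>.add \<Theta>.diff \<Theta>T power2_eq_square T_def)
  qed
  define C where "C = lift_fls (cylinder_coeffs \<kappa> \<kappa>')"
  \<comment> \<open>\<open>recip_X\<close> and \<open>y_series\<close> are inverse to each other, so
    the outer substitution undoes the one inside the moment series.\<close>
  have "\<Theta> (comp2 (cylinder_coeffs \<kappa> \<kappa>') (y_series \<kappa>) (y_series \<kappa>)) = C"
    unfolding \<Theta>_def C_def by (simp add: comp2_inverse recip_X_nth y_series_nth_0 y_series_recip_X)
  moreover have "\<Theta> (ser1 (fps_X * fps_deriv (y_series \<kappa>))) = Z1 * t1" "\<Theta> (ser2 (fps_X * fps_deriv (y_series \<kappa>))) = Z2 * t2"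
    using \<Theta>T \<Theta>.mult[of "ser1 fps_X" "ser1 (fps_deriv (y_series \<kappa>))"] \<Theta>.mult[of fps_X "ser2 (fps_deriv (y_series \<kappa>))"]
    by (simp_all add: ser2_simps)
  ultimately have LHS: "eval_at_inverses (W_par2 \<kappa> \<kappa>') X X = Z1 * Z2 * (T + Z1 * t1 * (Z2 * t2) * C)"
    unfolding eval_at_inverses_eq X_def recip_X_def[symmetric] \<Theta>_def[symmetric] W_par2_eq
    by (simp only: \<Theta>.mult \<Theta>.add \<Theta>T T_def)
  define f where "f = Abs_fps (\<lambda>n. \<kappa> (n + 1))"
  define C0 where "C0 = Abs_fps (\<lambda>s. Abs_fps (\<lambda>r. f $ (r + s + 1) * (1 - of_nat (r + 1) * of_nat (s + 1))))"
  have Kf: "cumulant_series \<kappa> = 1 + fps_X * f"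
  proof (rule fps_ext)
    fix n show "cumulant_series \<kappa> $ n = (1 + fps_X * f) $ n" by (cases n) (simp_all add: cumulant_series_def f_def)
  qed
  have "k1 = 1 + y1 * lift_fls (ser1 f)" "k2 = 1 + y2 * lift_fls (ser2 f)"
    unfolding defs Kf lift_X[symmetric] using hom1(3) hom2(3)
    by (simp_all add: ser2_simps lift_hom.add lift_hom.mult lift_hom.one flip: fps_const_mult fps_const_add)
  moreover have "X1 * y1 = k1" "X2 * y2 = k2"
    unfolding X1(1) X2(1) k[symmetric] using Z0 by simp_all
  ultimately have H: "H = lift_fls (hankel f)"
    unfolding H_def using hankel_lift d0 by metis
  have "H - y1 * deriv_y1 (y2 * deriv_y2 H) =
      lift_fls (hankel f - ser1 fps_X * fps_map fps_deriv (fps_X * fps_deriv (hankel f)))"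
    unfolding H deriv_y2_lift lift_hom.diff lift_hom.mult lift_X
    unfolding lift_X[symmetric] lift_hom.mult[symmetric] deriv_y1_lift ..
  also have "\<dots> = y1 * y2 * lift_fls C0"
    unfolding hankel_euler C0_def[symmetric] lift_hom.mult lift_X ..
  finally have H': "1 / (y1 * y2) * (H - y1 * deriv_y1 (y2 * deriv_y2 H)) = lift_fls C0"
    using y0 by simp
  have C: "C = X_series2 \<kappa>' + lift_fls C0"
    unfolding C_def X_series2_lift lift_hom.add[symmetric]
    by (rule arg_cong[of _ _ lift_fls], intro fps_ext) (simp add: cylinder_coeffs_def C0_def f_def)
  have t': "t1 = 1 / s1" "t2 = 1 / s2" using t s0 by (auto simp: field_simps)
  \<comment> \<open>In each variable X' = -s / Z^2; the two signs cancel in the product.\<close>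
  have D: "1 / (dX1 * dX2) = (Z1 * Z2)\<^sup>2 * (t1 * t2)"
    unfolding X1 X2 t' by (simp add: power_mult_distrib)
  have "X1 - X2 = (Z2 - Z1) / (Z1 * Z2)"
    unfolding X1(1) X2(1) using Z0 by (simp add: field_simps)
  then have "1 / (X1 - X2)\<^sup>2 = (Z1 * Z2)\<^sup>2 / (Z1 - Z2)\<^sup>2"
    by (simp add: power_divide power2_commute[of Z2 Z1])
  then have "(X_series2 \<kappa>' + 1 / (y1 - y2)\<^sup>2) / (dX1 * dX2) - 1 / (X1 - X2)\<^sup>2 + lift_fls C0 / (dX1 * dX2) =
      (X_series2 \<kappa>' + 1 / (y1 - y2)\<^sup>2 + lift_fls C0) * ((Z1 * Z2)\<^sup>2 * (t1 * t2)) - (Z1 * Z2)\<^sup>2 / (Z1 - Z2)\<^sup>2"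
    unfolding D[symmetric] by (simp add: add_divide_distrib)
  also have "\<dots> = Z1 * Z2 * (T + Z1 * t1 * (Z2 * t2) * C)"
    unfolding T C t' by (simp add: power2_eq_square add_divide_distrib algebra_simps)
  finally show ?thesis unfolding LHS H' ..
qed

end
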